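(* Let $\mathcal V$ be a variety of signature $\tau$ with a weakly-associative difference term $m$, let $A\in\mathcal V$, and let $u\in A$ be a characteristic idempotent. If $\alpha\in\mathrm{Con}\,A$ is abelian, $Q=A/\alpha$, and $\alpha$ affords a representation $A\cong I_{\alpha}\rtimes_{\ast,T}Q$, then there is an exact sequence $$1\longrightarrow\mathrm{Der}(Q,I_{\alpha},\ast)\longrightarrow\mathrm{Aut}_{I_{\alpha}}A\stackrel{\psi}{\longrightarrow}C(Q,I_{\alpha},\ast)\stackrel{W_{T}}{\longrightarrow}H^{2}_{\mathcal V}(Q,I_{\alpha},\ast).$$ Here the first two nontrivial maps are group homomorphisms, $W_T$ is a map of sets, and exactness at $C(Q,I_\alpha,\ast)$ means $\mathrm{im}\,\psi=\{(\sigma,\kappa):W_T(\sigma,\kappa)=0\}$.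
   Context: A ternary term $m$ is a difference term for $\mathcal V$ if for all $B\in\mathcal V$, $\theta\in\mathrm{Con}\,B$ and $(x,y)\in\theta$: $m(x,x,y)=y$ and $m(x,y,y)\mathrel{[\theta,\theta]}x$ (term-condition commutator). It is weakly-associative if $\mathcal V\vDash x=m(m(x,y,z),z,y)$. A congruence $\alpha$ is abelian if $[\alpha,\alpha]=0$. An element $u\in A$ is idempotent if $f^A(u,\dots,u)=u$ for all $f\in\tau$, and characteristic if it is fixed by every automorphism of $A$. **Representation.** $I_\alpha$ is the $\alpha$-class of $u$ (a subalgebra of $A$), with abelian group operation $x+_uy=m(x,u,y)$ and zero $u$; sums of elements of $I_\alpha$ refer to $+_u$. Let $\pi:A\to Q=A/\alpha$ be the canonical map and $l:Q\to A$ a section of $\pi$ with $l(\pi(u))=u$. For $f\in\tau$ with $n=\mathrm{ar} f$, $\vec x\in Q^n$, $\vec a\in I_\alpha^n$ define $T_f(\vec x)=m\big(f^A(l(x_1),\dots,l(x_n)),\,l(f^Q(\vec x)),\,u\big)$ and $a(f,i)(\vec x,\vec a)=m\big(f^A(l(x_1),\dots,m(a_i,u,l(x_i)),\dots,l(x_n)),\,f^A(l(x_1),\dots,l(x_n)),\,u\big)$, $1\le i\le n$, both in $I_\alpha$. The action is $\ast=\{a(f,i)\}$, and for any family $T=\{T_f:Q^{\mathrm{ar} f}\to I_\alpha\}_{f\in\tau}$ the algebra $I_\alpha\rtimes_{\ast,T}Q$ has universe $I_\alpha\times Q$ and operations $f(\langle a_1,x_1\rangle,\dots,\langle a_n,x_n\rangle)=\big\langle\sum_{i=1}^n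 a(f,i)(\vec x,\vec a)+_uT_f(\vec x),\,f^Q(\vec x)\big\rangle$. For the $T$ defined from $l$, $a\mapsto\langle m(a,l(\pi(a)),u),\pi(a)\rangle$ is the isomorphism $A\cong I_\alpha\rtimes_{\ast,T}Q$. **Groups and maps.** A 2-cocycle is a family $T=\{T_f:Q^{\mathrm{ar} f}\to I_\alpha\}_{f\in\tau}$; it is $\mathcal V$-compatible if $I_\alpha\rtimes_{\ast,T}Q\in\mathcal V$. $S\sim T$ iff there is $h:Q\to I_\alpha$ with $S_f(\vec x)-T_f(\vec x)=\sum_i a(f,i)(\vec x,h(\vec x))-h(f^Q(\vec x))$ for all $f\in\tau$ and $\vec x$. $H^2_{\mathcal V}(Q,I_\alpha,\ast)$ is the abelian group of classes of $\mathcal V$-compatible 2-cocycles under pointwise addition. $\mathrm{Der}(Q,I_\alpha,\ast)$ is the abelian group of maps $d:Q\to I_\alpha$ with $d(f^Q(\vec x))=\sum_i a(f,i)(\vec x,d(\vec x))$ for all $f\in\tau$; it maps to $\mathrm{Aut}_{I_\alpha}A$ by sending $d$ to the automorphism corresponding to $\langle a,x\rangle\mapsto\langle a+_ud(x),x\rangle$. $\mathrm{Aut}_{I_\alpha}A=\{\phi\in\mathrm{Aut}\,A:\phi(I_\alpha)=I_\alpha\}$. $C(Q,I_\alpha,\ast)$ is the group of pairs $(\sigma,\kappa)\in\mathrm{Aut}\,I_\alpha\times\mathrm{Aut}\,Q$ with $\sigma(a(f,i)(\vec x,\vec a))=a(f,i)(\kappa(\vec x),\sigma(\vec a))$ for all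 $f\in\tau$, $i$, $\vec x$, $\vec a$. The map $\psi$ is $\psi(\phi)=(\phi|_{I_\alpha},\pi\circ\phi\circ l)$, and $W_T(\sigma,\kappa)=[T-T^{(\sigma,\kappa)}]$ with $T^{(\sigma,\kappa)}_f(\vec x)=\sigma(T_f(\kappa^{-1}(\vec x)))$. *)

theory Defs
  imports "HOL-Algebra.Bij" "HOL-Algebra.Coset" "HOL-Algebra.FiniteProduct"
begin

section \<open>Signatures, algebras and terms\<close>

record 'f signature =
  symbols :: "'f set"
  arity :: "'f \<Rightarrow> nat"

record ('f, 'a) alg = "'a partial_object" +
  interp :: "'f \<Rightarrow> 'a list \<Rightarrow> 'a"

definition tuples :: "'a set \<Rightarrow> nat \<Rightarrow> 'a list set" where
  "tuples X n = {xs. set xs \<subseteq> X \<and> length xs = n}"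

definition is_alg :: "'f signature \<Rightarrow> ('f, 'a) alg \<Rightarrow> bool" where
  "is_alg \<tau> A \<longleftrightarrow> carrier A \<noteq> {} \<and>
     (\<forall>f\<in>symbols \<tau>. interp A f \<in> tuples (carrier A) (arity \<tau> f) \<rightarrow> carrier A)"

datatype ('f, vars: 'v) trm = Var 'v | App 'f "('f, 'v) trm list"

fun wf_trm :: "'f signature \<Rightarrow> ('f, 'v) trm \<Rightarrow> bool" where
  "wf_trm \<tau> (Var v) \<longleftrightarrow> True"
| "wf_trm \<tau> (App f ts) \<longleftrightarrow>
     f \<in> symbols \<tau> \<and> length ts = arity \<tau> f \<and> (\<forall>t\<in>set ts. wf_trm \<tau> t)"

fun eval :: "('f, 'a) alg \<Rightarrow> ('v \<Rightarrow> 'a) \<Rightarrow> ('f, 'v) trm \<Rightarrow> 'a" where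
  "eval A \<rho> (Var v) = \<rho> v"
| "eval A \<rho> (App f ts) = interp A f (map (eval A \<rho>) ts)"

definition alg_iso :: "'f signature \<Rightarrow> ('f, 'a) alg \<Rightarrow> ('f, 'b) alg \<Rightarrow> ('a \<Rightarrow> 'b) \<Rightarrow> bool" where
  "alg_iso \<tau> A B g \<longleftrightarrow> bij_betw g (carrier A) (carrier B) \<and>
     (\<forall>f\<in>symbols \<tau>. \<forall>xs\<in>tuples (carrier A) (arity \<tau> f).
        g (interp A f xs) = interp B f (map g xs))"

definition Aut :: "'f signature \<Rightarrow> ('f, 'a) alg \<Rightarrow> ('a \<Rightarrow> 'a) set" where
  "Aut \<tau> A = extensional (carrier A) \<inter> {\<phi>. alg_iso \<tau> A A \<phi>}"

definition aut_group :: "'f signature \<Rightarrow> ('f, 'a) alg \<Rightarrow> ('a \<Rightarrow> 'a) monoid" where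
  "aut_group \<tau> A = BijGroup (carrier A)\<lparr>carrier := Aut \<tau> A\<rparr>"

definition idempotent_elt :: "'f signature \<Rightarrow> ('f, 'a) alg \<Rightarrow> 'a \<Rightarrow> bool" where
  "idempotent_elt \<tau> A u \<longleftrightarrow> u \<in> carrier A \<and>
     (\<forall>f\<in>symbols \<tau>. interp A f (replicate (arity \<tau> f) u) = u)"

definition characteristic_elt :: "'f signature \<Rightarrow> ('f, 'a) alg \<Rightarrow> 'a \<Rightarrow> bool" where
  "characteristic_elt \<tau> A u \<longleftrightarrow> u \<in> carrier A \<and> (\<forall>\<phi>\<in>Aut \<tau> A. \<phi> u = u)"


section \<open>Varieties\<close>

text \<open>A variety is presented by a set of identities; countably many variables suffice because an
  identity mentions only finitely many. This makes membership meaningful for algebras over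
  every type.\<close>

definition variety :: "'f signature \<Rightarrow> (('f, nat) trm \<times> ('f, nat) trm) set \<Rightarrow> bool" where
  "variety \<tau> V \<longleftrightarrow> (\<forall>(s, t)\<in>V. wf_trm \<tau> s \<and> wf_trm \<tau> t)"

definition in_variety ::
  "'f signature \<Rightarrow> (('f, nat) trm \<times> ('f, nat) trm) set \<Rightarrow> ('f, 'a) alg \<Rightarrow> bool" where
  "in_variety \<tau> V A \<longleftrightarrow> is_alg \<tau> A \<and>
     (\<forall>(s, t)\<in>V. \<forall>\<rho>. range \<rho> \<subseteq> carrier A \<longrightarrow> eval A \<rho> s = eval A \<rho> t)"


section \<open>Congruences and the term-condition commutator\<close>

definition congruence :: "'f signature \<Rightarrow> ('f, 'a) alg \<Rightarrow> ('a \<times> 'a) set \<Rightarrow> bool" where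
  "congruence \<tau> A \<theta> \<longleftrightarrow> equiv (carrier A) \<theta> \<and>
     (\<forall>f\<in>symbols \<tau>. \<forall>xs\<in>tuples (carrier A) (arity \<tau> f). \<forall>ys\<in>tuples (carrier A) (arity \<tau> f).
        list_all2 (\<lambda>x y. (x, y) \<in> \<theta>) xs ys \<longrightarrow> (interp A f xs, interp A f ys) \<in> \<theta>)"

text \<open>The relation $C(\theta_1, \theta_2; \delta)$. The variables of the term are split into two
  blocks by the sum type; the tuples are infinite, but a term only reads a finite part of them.\<close>

definition centralizes ::
  "'f signature \<Rightarrow> ('f, 'a) alg \<Rightarrow> ('a \<times> 'a) set \<Rightarrow> ('a \<times> 'a) set \<Rightarrow> ('a \<times> 'a) set \<Rightarrow> bool" where
  "centralizes \<tau> A \<theta>\<^sub>1 \<theta>\<^sub>2 \<delta> \<longleftrightarrow>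
     (\<forall>t :: ('f, nat + nat) trm. wf_trm \<tau> t \<longrightarrow>
       (\<forall>a b c d. (\<forall>i. (a i, b i) \<in> \<theta>\<^sub>1) \<longrightarrow> (\<forall>j. (c j, d j) \<in> \<theta>\<^sub>2) \<longrightarrow>
          (eval A (case_sum a c) t, eval A (case_sum a d) t) \<in> \<delta> \<longrightarrow>
          (eval A (case_sum b c) t, eval A (case_sum b d) t) \<in> \<delta>))"

definition commutator ::
  "'f signature \<Rightarrow> ('f, 'a) alg \<Rightarrow> ('a \<times> 'a) set \<Rightarrow> ('a \<times> 'a) set \<Rightarrow> ('a \<times> 'a) set" where
  "commutator \<tau> A \<theta>\<^sub>1 \<theta>\<^sub>2 = \<Inter>{\<delta>. congruence \<tau> A \<delta> \<and> centralizes \<tau> A \<theta>\<^sub>1 \<theta>\<^sub>2 \<delta>}"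

definition abelian_congruence :: "'f signature \<Rightarrow> ('f, 'a) alg \<Rightarrow> ('a \<times> 'a) set \<Rightarrow> bool" where
  "abelian_congruence \<tau> A \<alpha> \<longleftrightarrow>
     congruence \<tau> A \<alpha> \<and> commutator \<tau> A \<alpha> \<alpha> = Id_on (carrier A)"


section \<open>Weakly-associative difference terms\<close>

definition ternary_term :: "'f signature \<Rightarrow> ('f, nat) trm \<Rightarrow> bool" where
  "ternary_term \<tau> m \<longleftrightarrow> wf_trm \<tau> m \<and> vars m \<subseteq> {0, 1, 2}"

definition tern :: "('f, 'a) alg \<Rightarrow> ('f, nat) trm \<Rightarrow> 'a \<Rightarrow> 'a \<Rightarrow> 'a \<Rightarrow> 'a" where
  "tern A m x y z = eval A (\<lambda>i. if i = 0 then x else if i = 1 then y else z) m"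

definition difference_term_on :: "'b itself \<Rightarrow> 'f signature \<Rightarrow>
    (('f, nat) trm \<times> ('f, nat) trm) set \<Rightarrow> ('f, nat) trm \<Rightarrow> bool" where
  "difference_term_on _ \<tau> V m \<longleftrightarrow>
     (\<forall>(B :: ('f, 'b) alg) \<theta>. in_variety \<tau> V B \<longrightarrow> congruence \<tau> B \<theta> \<longrightarrow>
        (\<forall>(x, y)\<in>\<theta>. tern B m x x y = y \<and> (tern B m x y y, x) \<in> commutator \<tau> B \<theta> \<theta>))"

definition weakly_associative_on :: "'b itself \<Rightarrow> 'f signature \<Rightarrow>
    (('f, nat) trm \<times> ('f, nat) trm) set \<Rightarrow> ('f, nat) trm \<Rightarrow> bool" where
  "weakly_associative_on _ \<tau> V m \<longleftrightarrow>
     (\<forall>B :: ('f, 'b) alg. in_variety \<tau> V B \<longrightarrow>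
        (\<forall>x\<in>carrier B. \<forall>y\<in>carrier B. \<forall>z\<in>carrier B. x = tern B m (tern B m x y z) z y))"

text \<open>HOL cannot quantify over all types inside a definition. It is enough to let \<open>B\<close> range over
  the algebras whose elements are sets of terms: every countably generated algebra has an
  isomorphic copy there, and both conditions concern at most three elements at a time. The
  lemmas \<open>difference_term_every_type\<close> and \<open>weakly_associative_every_type\<close> below prove that the
  two definitions imply the corresponding conditions for algebras over every type.\<close>

definition difference_term ::
  "'f signature \<Rightarrow> (('f, nat) trm \<times> ('f, nat) trm) set \<Rightarrow> ('f, nat) trm \<Rightarrow> bool" where
  "difference_term \<tau> V m \<longleftrightarrow>
     ternary_term \<tau> m \<and> difference_term_on TYPE(('f, nat) trm set) \<tau> V m"

definition weakly_associative ::
  "'f signature \<Rightarrow> (('f, nat) trm \<times> ('f, nat) trm) set \<Rightarrow> ('f, nat) trm \<Rightarrow> bool" where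
  "weakly_associative \<tau> V m \<longleftrightarrow>
     ternary_term \<tau> m \<and> weakly_associative_on TYPE(('f, nat) trm set) \<tau> V m"

lemma eval_closed:
  assumes "\<And>f xs. f \<in> symbols \<tau> \<Longrightarrow> xs \<in> tuples S (arity \<tau> f) \<Longrightarrow> interp A f xs \<in> S"
    and "range \<rho> \<subseteq> S" "wf_trm \<tau> t"
  shows "eval A \<rho> t \<in> S"
  using assms(3)
proof (induction t)
  case (Var v)
  then show ?case using assms(2) by auto
next
  case (App f ts)
  then have "map (eval A \<rho>) ts \<in> tuples S (arity \<tau> f)" by (auto simp: tuples_def)
  with App.prems show ?case using assms(1) by auto
qed

lemma eval_transport:
  assumes closed: "\<And>f xs. f \<in> symbols \<tau> \<Longrightarrow> xs \<in> tuples S (arity \<tau> f) \<Longrightarrow> interp A f xs \<in> S"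
    and hom: "\<And>f xs. f \<in> symbols \<tau> \<Longrightarrow> xs \<in> tuples S (arity \<tau> f) \<Longrightarrow>
                g (interp A f xs) = interp F f (map g xs)"
    and "range \<rho> \<subseteq> S" "wf_trm \<tau> t"
  shows "g (eval A \<rho> t) = eval F (\<lambda>v. g (\<rho> v)) t"
  using assms(4)
proof (induction t)
  case (Var v)
  then show ?case by simp
next
  case (App f ts)
  have "map (eval A \<rho>) ts \<in> tuples S (arity \<tau> f)"
    using App.prems eval_closed[OF closed assms(3)] by (auto simp: tuples_def)
  moreover have "map (\<lambda>t. g (eval A \<rho> t)) ts = map (eval F (\<lambda>v. g (\<rho> v))) ts"
    using App by simp
  ultimately show ?case using App.prems hom[of f "map (eval A \<rho>) ts"]
    by (simp only: eval.simps wf_trm.simps map_map comp_def)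
qed

lemma small_copy:
  fixes B :: "('f, 'b) alg" and \<rho> :: "nat \<Rightarrow> 'b"
  assumes V: "variety \<tau> V" and B: "in_variety \<tau> V B" and \<rho>: "range \<rho> \<subseteq> carrier B"
  obtains S g and F :: "('f, ('f, nat) trm set) alg"
  where "S \<subseteq> carrier B" "range \<rho> \<subseteq> S" "inj_on g S" "carrier F = g ` S"
    "\<And>f xs. f \<in> symbols \<tau> \<Longrightarrow> xs \<in> tuples S (arity \<tau> f) \<Longrightarrow> interp B f xs \<in> S"
    "\<And>f xs. f \<in> symbols \<tau> \<Longrightarrow> xs \<in> tuples S (arity \<tau> f) \<Longrightarrow>
       g (interp B f xs) = interp F f (map g xs)"
    "in_variety \<tau> V F"
proof -
  define S where "S = {eval B \<rho> t | t. wf_trm \<tau> t}"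
  define g where "g = (\<lambda>b. {t. wf_trm \<tau> t \<and> eval B \<rho> t = b})"
  define F :: "('f, ('f, nat) trm set) alg" where
    "F = \<lparr>carrier = g ` S, interp = \<lambda>f Xs. g (interp B f (map (inv_into S g) Xs))\<rparr>"
  have Bc: "\<And>f xs. f \<in> symbols \<tau> \<Longrightarrow> xs \<in> tuples (carrier B) (arity \<tau> f) \<Longrightarrow>
      interp B f xs \<in> carrier B"
    using B by (auto simp: in_variety_def is_alg_def)
  have SB: "S \<subseteq> carrier B"
    using eval_closed[OF Bc \<rho>] by (auto simp: S_def)
  have \<rho>S: "range \<rho> \<subseteq> S"
  proof
    fix x assume "x \<in> range \<rho>"
    then obtain i where "x = eval B \<rho> (Var i)" by auto
    then show "x \<in> S" unfolding S_def by (metis (mono_tags, lifting) mem_Collect_eq wf_trm.simps(1))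
  qed
  have inj: "inj_on g S"
    by (rule inj_onI) (auto simp: S_def g_def)
  have closed: "interp B f xs \<in> S"
    if f: "f \<in> symbols \<tau>" and xs: "xs \<in> tuples S (arity \<tau> f)" for f xs
  proof -
    have "\<forall>x\<in>set xs. \<exists>t. wf_trm \<tau> t \<and> eval B \<rho> t = x" using xs by (auto simp: tuples_def S_def)
    then obtain h where h: "\<And>x. x \<in> set xs \<Longrightarrow> wf_trm \<tau> (h x) \<and> eval B \<rho> (h x) = x" by metis
    then have "map (eval B \<rho>) (map h xs) = xs" by (simp add: map_idI)
    then have "interp B f xs = eval B \<rho> (App f (map h xs))" by simp
    moreover have "wf_trm \<tau> (App f (map h xs))" using h f xs by (auto simp: tuples_def)
    ultimately show ?thesis unfolding S_def by blast
  qed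
  have hom: "g (interp B f xs) = interp F f (map g xs)"
    if "f \<in> symbols \<tau>" and xs: "xs \<in> tuples S (arity \<tau> f)" for f xs
  proof -
    have "map (inv_into S g) (map g xs) = xs"
      using xs inj by (auto simp: tuples_def inv_into_f_f subset_iff intro!: map_idI)
    then show ?thesis by (simp add: F_def)
  qed
  have lift: "\<exists>ys\<in>tuples S n. Xs = map g ys" if "Xs \<in> tuples (g ` S) n" for Xs n
  proof (intro bexI)
    show "Xs = map g (map (inv_into S g) Xs)"
      using that by (auto simp: tuples_def f_inv_into_f subset_iff intro!: map_idI[symmetric])
    show "map (inv_into S g) Xs \<in> tuples S n"
      using that by (auto simp: tuples_def inv_into_into subset_iff)
  qed
  have "in_variety \<tau> V F"
    unfolding in_variety_def is_alg_def
  proof (intro conjI ballI allI impI; (clarify)?)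
    show "carrier F = {} \<Longrightarrow> False" using \<rho>S by (auto simp: F_def)
  next
    fix f Xs assume f: "f \<in> symbols \<tau>" and Xs: "Xs \<in> tuples (carrier F) (arity \<tau> f)"
    then obtain ys where ys: "ys \<in> tuples S (arity \<tau> f)" "Xs = map g ys"
      using lift by (auto simp: F_def)
    show "interp F f Xs \<in> carrier F"
      using hom[OF f ys(1)] closed[OF f ys(1)] ys(2) by (auto simp: F_def)
  next
    fix s t and \<xi> :: "nat \<Rightarrow> ('f, nat) trm set"
    assume st: "(s, t) \<in> V" and \<xi>: "range \<xi> \<subseteq> carrier F"
    define \<eta> where "\<eta> = (\<lambda>i. inv_into S g (\<xi> i))"
    have \<xi>': "\<xi> i \<in> g ` S" for i using \<xi> by (auto simp: F_def)
    have eq: "\<xi> = (\<lambda>i. g (\<eta> i))" using \<xi>' by (simp add: \<eta>_def f_inv_into_f)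
    have \<eta>: "range \<eta> \<subseteq> S" using \<xi>' by (auto simp: \<eta>_def intro: inv_into_into)
    have wf: "wf_trm \<tau> s" "wf_trm \<tau> t" using V st by (auto simp: variety_def)
    have "eval B \<eta> s = eval B \<eta> t"
      using B st \<eta> SB by (auto simp: in_variety_def)
    then show "eval F \<xi> s = eval F \<xi> t"
      using eval_transport[OF closed hom \<eta> wf(1)] eval_transport[OF closed hom \<eta> wf(2)] eq by simp
  qed
  with SB \<rho>S inj closed hom show thesis
    by (intro that[of S g F]) (auto simp: F_def)
qed

lemma tern_transport:
  assumes "\<And>f xs. f \<in> symbols \<tau> \<Longrightarrow> xs \<in> tuples S (arity \<tau> f) \<Longrightarrow> interp A f xs \<in> S"
    and "\<And>f xs. f \<in> symbols \<tau> \<Longrightarrow> xs \<in> tuples S (arity \<tau> f) \<Longrightarrow>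
           g (interp A f xs) = interp F f (map g xs)"
    and "ternary_term \<tau> m" "x \<in> S" "y \<in> S" "z \<in> S"
  shows "tern A m x y z \<in> S" "g (tern A m x y z) = tern F m (g x) (g y) (g z)"
proof -
  let ?\<rho> = "\<lambda>i :: nat. if i = 0 then x else if i = 1 then y else z"
  have r: "range ?\<rho> \<subseteq> S" and wf: "wf_trm \<tau> m" using assms(3-) by (auto simp: ternary_term_def)
  show "tern A m x y z \<in> S" unfolding tern_def by (rule eval_closed[OF assms(1) r wf])
  have "(\<lambda>i. g (?\<rho> i)) = (\<lambda>i. if i = 0 then g x else if i = 1 then g y else g z)" by auto
  then show "g (tern A m x y z) = tern F m (g x) (g y) (g z)"
    unfolding tern_def using eval_transport[OF assms(1,2) r wf] by simp
qed

lemma weakly_associative_every_type: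
  fixes V :: "(('f, nat) trm \<times> ('f, nat) trm) set"
  assumes V: "variety \<tau> V" and w: "weakly_associative \<tau> V m"
  shows "weakly_associative_on TYPE('b) \<tau> V m"
  unfolding weakly_associative_on_def
proof (intro allI ballI impI)
  fix B :: "('f, 'b) alg" and x y z
  assume B: "in_variety \<tau> V B" and xyz: "x \<in> carrier B" "y \<in> carrier B" "z \<in> carrier B"
  let ?\<rho> = "\<lambda>i :: nat. if i = 0 then x else if i = 1 then y else z"
  have r: "range ?\<rho> \<subseteq> carrier B" using xyz by auto
  obtain S g and F :: "('f, ('f, nat) trm set) alg"
    where SB: "S \<subseteq> carrier B" and S: "range ?\<rho> \<subseteq> S" and inj: "inj_on g S"
      and F: "carrier F = g ` S"
      and c: "\<And>f xs. f \<in> symbols \<tau> \<Longrightarrow> xs \<in> tuples S (arity \<tau> f) \<Longrightarrow> interp B f xs \<in> S"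
      and h: "\<And>f xs. f \<in> symbols \<tau> \<Longrightarrow> xs \<in> tuples S (arity \<tau> f) \<Longrightarrow>
           g (interp B f xs) = interp F f (map g xs)"
      and FV: "in_variety \<tau> V F"
    by (rule small_copy[OF V B r], rule that)
  have m: "ternary_term \<tau> m" using w by (simp add: weakly_associative_def)
  have xS: "x \<in> S" "y \<in> S" "z \<in> S"
    using S subsetD[OF S rangeI, of 0] subsetD[OF S rangeI, of 1] subsetD[OF S rangeI, of 2]
    by auto
  have t: "tern B m a b k \<in> S" "g (tern B m a b k) = tern F m (g a) (g b) (g k)"
    if "a \<in> S" "b \<in> S" "k \<in> S" for a b k
    using tern_transport[OF c h m that] by blast+
  have gS: "g x \<in> carrier F" "g y \<in> carrier F" "g z \<in> carrier F" using xS F by auto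
  have "g x = tern F m (tern F m (g x) (g y) (g z)) (g z) (g y)"
    using w FV gS by (simp add: weakly_associative_def weakly_associative_on_def)
  also have "\<dots> = g (tern B m (tern B m x y z) z y)" by (simp only: t xS)
  finally show "x = tern B m (tern B m x y z) z y"
    by (rule inj_onD[OF inj]) (simp_all only: t xS)
qed

lemma difference_term_every_type:
  fixes V :: "(('f, nat) trm \<times> ('f, nat) trm) set"
  assumes V: "variety \<tau> V" and d: "difference_term \<tau> V m"
  shows "difference_term_on TYPE('b) \<tau> V m"
  unfolding difference_term_on_def
proof (intro allI ballI impI, clarify)
  fix B :: "('f, 'b) alg" and \<theta> x y
  assume B: "in_variety \<tau> V B" and \<theta>: "congruence \<tau> B \<theta>" and xy: "(x, y) \<in> \<theta>"
  have xyB: "x \<in> carrier B" "y \<in> carrier B"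
    using xy \<theta> by (auto simp: congruence_def equiv_def refl_on_def)
  let ?\<rho> = "\<lambda>i :: nat. if i = 0 then x else y"
  have r: "range ?\<rho> \<subseteq> carrier B" using xyB by auto
  obtain S g and F :: "('f, ('f, nat) trm set) alg"
    where SB: "S \<subseteq> carrier B" and S: "range ?\<rho> \<subseteq> S" and inj: "inj_on g S"
      and F: "carrier F = g ` S"
      and c: "\<And>f xs. f \<in> symbols \<tau> \<Longrightarrow> xs \<in> tuples S (arity \<tau> f) \<Longrightarrow> interp B f xs \<in> S"
      and h: "\<And>f xs. f \<in> symbols \<tau> \<Longrightarrow> xs \<in> tuples S (arity \<tau> f) \<Longrightarrow>
           g (interp B f xs) = interp F f (map g xs)"
      and FV: "in_variety \<tau> V F"
    by (rule small_copy[OF V B r], rule that)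
  have m: "ternary_term \<tau> m" using d by (simp add: difference_term_def)
  have xS: "x \<in> S" "y \<in> S"
    using subsetD[OF S rangeI, of 0] subsetD[OF S rangeI, of 1] by auto
  have t: "tern B m a b k \<in> S" "g (tern B m a b k) = tern F m (g a) (g b) (g k)"
    if "a \<in> S" "b \<in> S" "k \<in> S" for a b k
    using tern_transport[OF c h m that] by blast+
  define P where "P = (\<lambda>\<delta>. {(g a, g b) | a b. a \<in> S \<and> b \<in> S \<and> (a, b) \<in> \<delta>})"
  have Pg: "(g a, g b) \<in> P \<delta> \<longleftrightarrow> (a, b) \<in> \<delta>" if "a \<in> S" "b \<in> S" for a b \<delta>
    using that inj by (auto simp: P_def dest: inj_onD)
  have lift: "\<exists>a\<in>S. \<exists>b\<in>S. p = g a \<and> q = g b \<and> (a, b) \<in> \<delta>" if "(p, q) \<in> P \<delta>" for p q \<delta>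
    using that by (auto simp: P_def)
  have cong: "congruence \<tau> F (P \<delta>)" if \<delta>: "congruence \<tau> B \<delta>" for \<delta>
    unfolding congruence_def
  proof (intro conjI ballI impI)
    have e: "equiv (carrier B) \<delta>" using \<delta> by (simp add: congruence_def)
    show "equiv (carrier F) (P \<delta>)"
    proof (rule equivI)
      show "P \<delta> \<subseteq> carrier F \<times> carrier F" by (auto simp: P_def F)
      show "refl_on (carrier F) (P \<delta>)"
      proof (rule refl_onI)
        fix p assume "p \<in> carrier F"
        then obtain a where a: "a \<in> S" "p = g a" by (auto simp: F)
        then have "(a, a) \<in> \<delta>" using e SB by (auto simp: refl_on_def equiv_def)
        then show "(p, p) \<in> P \<delta>" using a Pg by simp
      qed
      show "sym (P \<delta>)"
      proof (rule symI)
        fix p q assume "(p, q) \<in> P \<delta>"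
        then obtain a b where ab: "a \<in> S" "b \<in> S" "p = g a" "q = g b" "(a, b) \<in> \<delta>"
          using lift by metis
        then have "(b, a) \<in> \<delta>" using e by (meson equivE symD)
        then show "(q, p) \<in> P \<delta>" using ab Pg by simp
      qed
      show "trans (P \<delta>)"
      proof (rule transI)
        fix p q r assume "(p, q) \<in> P \<delta>" "(q, r) \<in> P \<delta>"
        then obtain a b b' k where "a \<in> S" "b \<in> S" "b' \<in> S" "k \<in> S" "p = g a" "q = g b" "q = g b'"
          "r = g k" "(a, b) \<in> \<delta>" "(b', k) \<in> \<delta>" using lift by metis
        moreover from this have "b = b'" using inj by (metis inj_onD)
        moreover have "trans \<delta>" using e by (simp add: equiv_def)
        ultimately have "(a, k) \<in> \<delta>" by (blast dest: transD)
        then show "(p, r) \<in> P \<delta>"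
          using Pg \<open>a \<in> S\<close> \<open>k \<in> S\<close> \<open>p = g a\<close> \<open>r = g k\<close> by simp
      qed
    qed
  next
    fix f Xs Ys
    assume f: "f \<in> symbols \<tau>" and X: "Xs \<in> tuples (carrier F) (arity \<tau> f)"
      and Y: "Ys \<in> tuples (carrier F) (arity \<tau> f)"
      and rel: "list_all2 (\<lambda>x y. (x, y) \<in> P \<delta>) Xs Ys"
    let ?i = "inv_into S g"
    have XY: "map ?i Xs \<in> tuples S (arity \<tau> f)" "map ?i Ys \<in> tuples S (arity \<tau> f)"
      using X Y by (auto simp: tuples_def F subset_iff inv_into_into)
    have gX: "map g (map ?i Xs) = Xs" "map g (map ?i Ys) = Ys"
      using X Y by (auto simp: tuples_def F subset_iff f_inv_into_f intro!: map_idI)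
    have "list_all2 (\<lambda>x y. (x, y) \<in> \<delta>) (map ?i Xs) (map ?i Ys)"
      unfolding list_all2_map1 list_all2_map2
      using rel by (rule list_all2_mono) (auto dest!: lift simp: inv_into_f_f[OF inj])
    moreover have "map ?i Xs \<in> tuples (carrier B) (arity \<tau> f)"
        "map ?i Ys \<in> tuples (carrier B) (arity \<tau> f)"
      using XY SB by (auto simp: tuples_def)
    ultimately have "(interp B f (map ?i Xs), interp B f (map ?i Ys)) \<in> \<delta>"
      using \<delta> f unfolding congruence_def by blast
    then have "(g (interp B f (map ?i Xs)), g (interp B f (map ?i Ys))) \<in> P \<delta>"
      using Pg c[OF f XY(1)] c[OF f XY(2)] by blast
    then show "(interp F f Xs, interp F f Ys) \<in> P \<delta>"
      using h[OF f XY(1)] h[OF f XY(2)] gX by simp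
  qed
  have central: "centralizes \<tau> F (P \<theta>) (P \<theta>) (P \<delta>)"
    if \<delta>: "centralizes \<tau> B \<theta> \<theta> \<delta>" for \<delta>
    unfolding centralizes_def
  proof (intro allI impI)
    fix s :: "('f, nat + nat) trm" and a b a' b'
    assume wf: "wf_trm \<tau> s" and 1: "\<forall>i. (a i, b i) \<in> P \<theta>" and 2: "\<forall>j. (a' j, b' j) \<in> P \<theta>"
      and hyp: "(eval F (case_sum a a') s, eval F (case_sum a b') s) \<in> P \<delta>"
    have "\<forall>i. \<exists>pq. fst pq \<in> S \<and> snd pq \<in> S \<and> a i = g (fst pq) \<and> b i = g (snd pq) \<and>
        pq \<in> \<theta>"
    proof
      fix i
      obtain v w where "v \<in> S" "w \<in> S" "a i = g v" "b i = g w" "(v, w) \<in> \<theta>"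
        using lift 1 by blast
      then show "\<exists>pq. fst pq \<in> S \<and> snd pq \<in> S \<and> a i = g (fst pq) \<and> b i = g (snd pq) \<and>
          pq \<in> \<theta>"
        by (intro exI[of _ "(v, w)"]) simp
    qed
    from choice[OF this] obtain r where r: "\<forall>i. fst (r i) \<in> S \<and> snd (r i) \<in> S \<and>
        a i = g (fst (r i)) \<and> b i = g (snd (r i)) \<and> r i \<in> \<theta>" ..
    define p q where "p = (\<lambda>i. fst (r i))" and "q = (\<lambda>i. snd (r i))"
    have pq: "p i \<in> S" "q i \<in> S" "a i = g (p i)" "b i = g (q i)" "(p i, q i) \<in> \<theta>" for i
      using r by (auto simp: p_def q_def)
    have "\<forall>i. \<exists>pq. fst pq \<in> S \<and> snd pq \<in> S \<and> a' i = g (fst pq) \<and> b' i = g (snd pq) \<and>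
        pq \<in> \<theta>"
    proof
      fix i
      obtain v w where "v \<in> S" "w \<in> S" "a' i = g v" "b' i = g w" "(v, w) \<in> \<theta>"
        using lift 2 by blast
      then show "\<exists>pq. fst pq \<in> S \<and> snd pq \<in> S \<and> a' i = g (fst pq) \<and> b' i = g (snd pq) \<and>
          pq \<in> \<theta>"
        by (intro exI[of _ "(v, w)"]) simp
    qed
    from choice[OF this] obtain r where r: "\<forall>i. fst (r i) \<in> S \<and> snd (r i) \<in> S \<and>
        a' i = g (fst (r i)) \<and> b' i = g (snd (r i)) \<and> r i \<in> \<theta>" ..
    define p' q' where "p' = (\<lambda>i. fst (r i))" and "q' = (\<lambda>i. snd (r i))"
    have pq': "p' i \<in> S" "q' i \<in> S" "a' i = g (p' i)" "b' i = g (q' i)" "(p' i, q' i) \<in> \<theta>" for i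
      using r by (auto simp: p'_def q'_def)
    have ev: "eval F (case_sum (\<lambda>i. g (v i)) (\<lambda>i. g (w i))) s = g (eval B (case_sum v w) s) \<and>
        eval B (case_sum v w) s \<in> S" if "\<And>i. v i \<in> S" "\<And>i. w i \<in> S" for v w
    proof -
      have r: "range (case_sum v w) \<subseteq> S" using that by (auto split: sum.splits)
      have "(\<lambda>i. g (case_sum v w i)) = case_sum (\<lambda>i. g (v i)) (\<lambda>i. g (w i))"
        by (auto split: sum.splits)
      then show ?thesis
        using eval_transport[OF c h r wf] eval_closed[OF c r wf] by simp
    qed
    have fn: "a = (\<lambda>i. g (p i))" "b = (\<lambda>i. g (q i))" "a' = (\<lambda>i. g (p' i))" "b' = (\<lambda>i. g (q' i))"
      by (rule ext, fact)+
    note [simp] = ev[OF pq(1) pq'(1)] ev[OF pq(1) pq'(2)] ev[OF pq(2) pq'(1)] ev[OF pq(2) pq'(2)]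
    have "(eval B (case_sum p p') s, eval B (case_sum p q') s) \<in> \<delta>"
      using hyp unfolding fn by (simp add: Pg)
    then have "(eval B (case_sum q p') s, eval B (case_sum q q') s) \<in> \<delta>"
      using \<delta>[unfolded centralizes_def, rule_format, of s p q p' q'] wf pq(5) pq'(5) by blast
    then show "(eval F (case_sum b a') s, eval F (case_sum b b') s) \<in> P \<delta>"
      unfolding fn by (simp add: Pg)
  qed
  have dF: "tern F m (g x) (g x) (g y) = g y \<and>
      (tern F m (g x) (g y) (g y), g x) \<in> commutator \<tau> F (P \<theta>) (P \<theta>)"
    using d FV cong[OF \<theta>] Pg[OF xS, of \<theta>] xy
    unfolding difference_term_def difference_term_on_def by blast
  have "tern B m x x y = y"
  proof (rule inj_onD[OF inj])
    show "g (tern B m x x y) = g y" using dF t(2)[OF xS(1) xS] by simp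
  qed (use t(1) xS in auto)
  moreover have "(tern B m x y y, x) \<in> \<delta>"
    if "congruence \<tau> B \<delta>" "centralizes \<tau> B \<theta> \<theta> \<delta>" for \<delta>
  proof -
    have "(tern F m (g x) (g y) (g y), g x) \<in> P \<delta>"
      using dF cong[OF that(1)] central[OF that(2)] unfolding commutator_def by blast
    then show ?thesis using t[OF xS xS(2)] Pg[OF t(1)[OF xS xS(2)] xS(1)] by simp
  qed
  ultimately show "tern B m x x y = y \<and> (tern B m x y y, x) \<in> commutator \<tau> B \<theta> \<theta>"
    by (auto simp: commutator_def)
qed


section \<open>Quotient, zero class and action\<close>

definition quotient_alg :: "('f, 'a) alg \<Rightarrow> ('a \<times> 'a) set \<Rightarrow> ('f, 'a set) alg" where
  "quotient_alg A \<alpha> =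
     \<lparr>carrier = carrier A // \<alpha>,
      interp = \<lambda>f Xs. \<Union>xs\<in>listset Xs. \<alpha> `` {interp A f xs}\<rparr>"

definition is_section ::
  "('f, 'a) alg \<Rightarrow> ('a \<times> 'a) set \<Rightarrow> 'a \<Rightarrow> ('a set \<Rightarrow> 'a) \<Rightarrow> bool" where
  "is_section A \<alpha> u l \<longleftrightarrow>
     (\<forall>X\<in>carrier (quotient_alg A \<alpha>). l X \<in> carrier A \<and> \<alpha> `` {l X} = X) \<and> l (\<alpha> `` {u}) = u"

definition class_alg :: "('f, 'a) alg \<Rightarrow> ('a \<times> 'a) set \<Rightarrow> 'a \<Rightarrow> ('f, 'a) alg" where
  "class_alg A \<alpha> u = A\<lparr>carrier := \<alpha> `` {u}\<rparr>"

text \<open>The group structure $+_u$ on the class of \<open>u\<close>, written multiplicatively as usual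
  in HOL-Algebra.\<close>

definition class_group ::
  "('f, 'a) alg \<Rightarrow> ('f, nat) trm \<Rightarrow> ('a \<times> 'a) set \<Rightarrow> 'a \<Rightarrow> 'a monoid" where
  "class_group A m \<alpha> u =
     \<lparr>carrier = \<alpha> `` {u}, mult = \<lambda>x y. tern A m x u y, one = u\<rparr>"

text \<open>The operations $a(f,i)$, with positions \<open>i\<close> counted from 0.\<close>

definition action :: "('f, 'a) alg \<Rightarrow> ('f, nat) trm \<Rightarrow> 'a \<Rightarrow> ('a set \<Rightarrow> 'a) \<Rightarrow>
    'f \<Rightarrow> nat \<Rightarrow> 'a set list \<Rightarrow> 'a list \<Rightarrow> 'a" where
  "action A m u l f i xs as =
     tern A m (interp A f ((map l xs)[i := tern A m (as ! i) u (l (xs ! i))]))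
              (interp A f (map l xs)) u"

definition section_cocycle :: "'f signature \<Rightarrow> ('f, 'a) alg \<Rightarrow> ('f, nat) trm \<Rightarrow> ('a \<times> 'a) set \<Rightarrow>
    'a \<Rightarrow> ('a set \<Rightarrow> 'a) \<Rightarrow> 'f \<Rightarrow> 'a set list \<Rightarrow> 'a" where
  "section_cocycle \<tau> A m \<alpha> u l =
     (\<lambda>f\<in>symbols \<tau>. \<lambda>xs\<in>tuples (carrier (quotient_alg A \<alpha>)) (arity \<tau> f).
        tern A m (interp A f (map l xs)) (l (interp (quotient_alg A \<alpha>) f xs)) u)"

definition representation_map :: "('f, 'a) alg \<Rightarrow> ('f, nat) trm \<Rightarrow> ('a \<times> 'a) set \<Rightarrow> 'a \<Rightarrow>
    ('a set \<Rightarrow> 'a) \<Rightarrow> 'a \<Rightarrow> 'a \<times> 'a set" where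
  "representation_map A m \<alpha> u l a = (tern A m a (l (\<alpha> `` {a})) u, \<alpha> `` {a})"


section \<open>Semidirect products, derivations and second cohomology\<close>

text \<open>Below, \<open>G\<close> is the group on the zero class, \<open>Q\<close> the quotient and \<open>act f i\<close> the action.
  Since equality of functions is equality on the whole type, maps and cocycles are taken to be
  extensional, that is \<open>undefined\<close> outside their domain.\<close>

definition act_sum :: "'f signature \<Rightarrow> ('a, 'm) monoid_scheme \<Rightarrow>
    ('f \<Rightarrow> nat \<Rightarrow> 'q list \<Rightarrow> 'a list \<Rightarrow> 'a) \<Rightarrow> 'f \<Rightarrow> 'q list \<Rightarrow> 'a list \<Rightarrow> 'a" where
  "act_sum \<tau> G act f xs as = (\<Otimes>\<^bsub>G\<^esub>i\<in>{..<arity \<tau> f}. act f i xs as)"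

definition semidirect :: "'f signature \<Rightarrow> ('a, 'm) monoid_scheme \<Rightarrow> ('f, 'q) alg \<Rightarrow>
    ('f \<Rightarrow> nat \<Rightarrow> 'q list \<Rightarrow> 'a list \<Rightarrow> 'a) \<Rightarrow> ('f \<Rightarrow> 'q list \<Rightarrow> 'a) \<Rightarrow> ('f, 'a \<times> 'q) alg" where
  "semidirect \<tau> G Q act T =
     \<lparr>carrier = carrier G \<times> carrier Q,
      interp = \<lambda>f ps. (act_sum \<tau> G act f (map snd ps) (map fst ps) \<otimes>\<^bsub>G\<^esub> T f (map snd ps),
                       interp Q f (map snd ps))\<rparr>"

definition cocycles :: "'f signature \<Rightarrow> ('a, 'm) monoid_scheme \<Rightarrow> ('f, 'q) alg \<Rightarrow>
    ('f \<Rightarrow> 'q list \<Rightarrow> 'a) set" where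
  "cocycles \<tau> G Q =
     (\<Pi>\<^sub>E f\<in>symbols \<tau>. tuples (carrier Q) (arity \<tau> f) \<rightarrow>\<^sub>E carrier G)"

definition compatible_cocycles :: "'f signature \<Rightarrow> (('f, nat) trm \<times> ('f, nat) trm) set \<Rightarrow>
    ('a, 'm) monoid_scheme \<Rightarrow> ('f, 'q) alg \<Rightarrow> ('f \<Rightarrow> nat \<Rightarrow> 'q list \<Rightarrow> 'a list \<Rightarrow> 'a) \<Rightarrow>
    ('f \<Rightarrow> 'q list \<Rightarrow> 'a) set" where
  "compatible_cocycles \<tau> V G Q act =
     {T \<in> cocycles \<tau> G Q. in_variety \<tau> V (semidirect \<tau> G Q act T)}"

definition cohomologous :: "'f signature \<Rightarrow> ('a, 'm) monoid_scheme \<Rightarrow> ('f, 'q) alg \<Rightarrow>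
    ('f \<Rightarrow> nat \<Rightarrow> 'q list \<Rightarrow> 'a list \<Rightarrow> 'a) \<Rightarrow> ('f \<Rightarrow> 'q list \<Rightarrow> 'a) \<Rightarrow> ('f \<Rightarrow> 'q list \<Rightarrow> 'a) \<Rightarrow> bool" where
  "cohomologous \<tau> G Q act S T \<longleftrightarrow>
     (\<exists>h\<in>carrier Q \<rightarrow> carrier G. \<forall>f\<in>symbols \<tau>. \<forall>xs\<in>tuples (carrier Q) (arity \<tau> f).
        S f xs \<otimes>\<^bsub>G\<^esub> inv\<^bsub>G\<^esub> (T f xs) =
        act_sum \<tau> G act f xs (map h xs) \<otimes>\<^bsub>G\<^esub> inv\<^bsub>G\<^esub> (h (interp Q f xs)))"

definition cohomology_rel :: "'f signature \<Rightarrow> (('f, nat) trm \<times> ('f, nat) trm) set \<Rightarrow>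
    ('a, 'm) monoid_scheme \<Rightarrow> ('f, 'q) alg \<Rightarrow> ('f \<Rightarrow> nat \<Rightarrow> 'q list \<Rightarrow> 'a list \<Rightarrow> 'a) \<Rightarrow>
    (('f \<Rightarrow> 'q list \<Rightarrow> 'a) \<times> ('f \<Rightarrow> 'q list \<Rightarrow> 'a)) set" where
  "cohomology_rel \<tau> V G Q act =
     {(S, T). S \<in> compatible_cocycles \<tau> V G Q act \<and> T \<in> compatible_cocycles \<tau> V G Q act \<and>
              cohomologous \<tau> G Q act S T}"

definition cocycle_add :: "'f signature \<Rightarrow> ('a, 'm) monoid_scheme \<Rightarrow> ('f, 'q) alg \<Rightarrow>
    ('f \<Rightarrow> 'q list \<Rightarrow> 'a) \<Rightarrow> ('f \<Rightarrow> 'q list \<Rightarrow> 'a) \<Rightarrow> 'f \<Rightarrow> 'q list \<Rightarrow> 'a" where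
  "cocycle_add \<tau> G Q S T =
     (\<lambda>f\<in>symbols \<tau>. \<lambda>xs\<in>tuples (carrier Q) (arity \<tau> f). S f xs \<otimes>\<^bsub>G\<^esub> T f xs)"

definition cocycle_diff :: "'f signature \<Rightarrow> ('a, 'm) monoid_scheme \<Rightarrow> ('f, 'q) alg \<Rightarrow>
    ('f \<Rightarrow> 'q list \<Rightarrow> 'a) \<Rightarrow> ('f \<Rightarrow> 'q list \<Rightarrow> 'a) \<Rightarrow> 'f \<Rightarrow> 'q list \<Rightarrow> 'a" where
  "cocycle_diff \<tau> G Q S T =
     (\<lambda>f\<in>symbols \<tau>. \<lambda>xs\<in>tuples (carrier Q) (arity \<tau> f). S f xs \<otimes>\<^bsub>G\<^esub> inv\<^bsub>G\<^esub> (T f xs))"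

definition cocycle_zero :: "'f signature \<Rightarrow> ('a, 'm) monoid_scheme \<Rightarrow> ('f, 'q) alg \<Rightarrow>
    'f \<Rightarrow> 'q list \<Rightarrow> 'a" where
  "cocycle_zero \<tau> G Q =
     (\<lambda>f\<in>symbols \<tau>. \<lambda>xs\<in>tuples (carrier Q) (arity \<tau> f). \<one>\<^bsub>G\<^esub>)"

definition H2 :: "'f signature \<Rightarrow> (('f, nat) trm \<times> ('f, nat) trm) set \<Rightarrow>
    ('a, 'm) monoid_scheme \<Rightarrow> ('f, 'q) alg \<Rightarrow> ('f \<Rightarrow> nat \<Rightarrow> 'q list \<Rightarrow> 'a list \<Rightarrow> 'a) \<Rightarrow>
    ('f \<Rightarrow> 'q list \<Rightarrow> 'a) set monoid" where
  "H2 \<tau> V G Q act =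
     \<lparr>carrier = compatible_cocycles \<tau> V G Q act // cohomology_rel \<tau> V G Q act,
      mult = \<lambda>X Y. \<Union>S\<in>X. \<Union>T\<in>Y. cohomology_rel \<tau> V G Q act `` {cocycle_add \<tau> G Q S T},
      one = cohomology_rel \<tau> V G Q act `` {cocycle_zero \<tau> G Q}\<rparr>"

definition Der :: "'f signature \<Rightarrow> ('a, 'm) monoid_scheme \<Rightarrow> ('f, 'q) alg \<Rightarrow>
    ('f \<Rightarrow> nat \<Rightarrow> 'q list \<Rightarrow> 'a list \<Rightarrow> 'a) \<Rightarrow> ('q \<Rightarrow> 'a) monoid" where
  "Der \<tau> G Q act =
     \<lparr>carrier = {d \<in> carrier Q \<rightarrow>\<^sub>E carrier G.
         \<forall>f\<in>symbols \<tau>. \<forall>xs\<in>tuples (carrier Q) (arity \<tau> f).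
           d (interp Q f xs) = act_sum \<tau> G act f xs (map d xs)},
      mult = \<lambda>d e. \<lambda>x\<in>carrier Q. d x \<otimes>\<^bsub>G\<^esub> e x,
      one = \<lambda>x\<in>carrier Q. \<one>\<^bsub>G\<^esub>\<rparr>"


section \<open>The groups and maps of the exact sequence\<close>

definition stabilizer_aut_group :: "'f signature \<Rightarrow> ('f, 'a) alg \<Rightarrow> 'a set \<Rightarrow> ('a \<Rightarrow> 'a) monoid" where
  "stabilizer_aut_group \<tau> A I = (aut_group \<tau> A)\<lparr>carrier := {\<phi> \<in> Aut \<tau> A. \<phi> ` I = I}\<rparr>"

definition compatible_pairs :: "'f signature \<Rightarrow> ('f, 'a) alg \<Rightarrow> ('f, 'q) alg \<Rightarrow>
    ('f \<Rightarrow> nat \<Rightarrow> 'q list \<Rightarrow> 'a list \<Rightarrow> 'a) \<Rightarrow> (('a \<Rightarrow> 'a) \<times> ('q \<Rightarrow> 'q)) monoid" where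
  "compatible_pairs \<tau> I Q act =
     (aut_group \<tau> I \<times>\<times> aut_group \<tau> Q)
       \<lparr>carrier := {(\<sigma>, \<kappa>). \<sigma> \<in> Aut \<tau> I \<and> \<kappa> \<in> Aut \<tau> Q \<and>
          (\<forall>f\<in>symbols \<tau>. \<forall>i<arity \<tau> f.
             \<forall>xs\<in>tuples (carrier Q) (arity \<tau> f). \<forall>as\<in>tuples (carrier I) (arity \<tau> f).
               \<sigma> (act f i xs as) = act f i (map \<kappa> xs) (map \<sigma> as))}\<rparr>"

definition der_to_aut :: "('f, 'a) alg \<Rightarrow> ('a, 'm) monoid_scheme \<Rightarrow> ('a \<Rightarrow> 'a \<times> 'q) \<Rightarrow>
    ('q \<Rightarrow> 'a) \<Rightarrow> 'a \<Rightarrow> 'a" where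
  "der_to_aut A G \<iota> d =
     (\<lambda>a\<in>carrier A. inv_into (carrier A) \<iota> (case \<iota> a of (b, x) \<Rightarrow> (b \<otimes>\<^bsub>G\<^esub> d x, x)))"

definition restriction_pair :: "('f, 'a) alg \<Rightarrow> ('a \<times> 'a) set \<Rightarrow> 'a \<Rightarrow> ('a set \<Rightarrow> 'a) \<Rightarrow>
    ('a \<Rightarrow> 'a) \<Rightarrow> ('a \<Rightarrow> 'a) \<times> ('a set \<Rightarrow> 'a set)" where
  "restriction_pair A \<alpha> u l \<phi> =
     (restrict \<phi> (\<alpha> `` {u}), \<lambda>X\<in>carrier (quotient_alg A \<alpha>). \<alpha> `` {\<phi> (l X)})"

definition twisted_cocycle :: "'f signature \<Rightarrow> ('f, 'q) alg \<Rightarrow> ('f \<Rightarrow> 'q list \<Rightarrow> 'a) \<Rightarrow>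
    ('a \<Rightarrow> 'a) \<times> ('q \<Rightarrow> 'q) \<Rightarrow> 'f \<Rightarrow> 'q list \<Rightarrow> 'a" where
  "twisted_cocycle \<tau> Q T = (\<lambda>(\<sigma>, \<kappa>).
     \<lambda>f\<in>symbols \<tau>. \<lambda>xs\<in>tuples (carrier Q) (arity \<tau> f).
       \<sigma> (T f (map (inv_into (carrier Q) \<kappa>) xs)))"

definition wells_map :: "'f signature \<Rightarrow> (('f, nat) trm \<times> ('f, nat) trm) set \<Rightarrow>
    ('a, 'm) monoid_scheme \<Rightarrow> ('f, 'q) alg \<Rightarrow> ('f \<Rightarrow> nat \<Rightarrow> 'q list \<Rightarrow> 'a list \<Rightarrow> 'a) \<Rightarrow>
    ('f \<Rightarrow> 'q list \<Rightarrow> 'a) \<Rightarrow> ('a \<Rightarrow> 'a) \<times> ('q \<Rightarrow> 'q) \<Rightarrow> ('f \<Rightarrow> 'q list \<Rightarrow> 'a) set" where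
  "wells_map \<tau> V G Q act T p =
     cohomology_rel \<tau> V G Q act `` {cocycle_diff \<tau> G Q T (twisted_cocycle \<tau> Q T p)}"

end

theory Submission
  imports Defs
begin

text \<open>Since \<open>\<alpha>\<close> is abelian, term functions are affine on \<open>\<alpha>\<close>-classes. Hence the class \<open>I\<close> of \<open>u\<close> is an
  abelian group, the action is additive and depends only on classes modulo \<open>\<alpha>\<close>, and every
  automorphism \<open>\<phi>\<close> of \<open>A\<close> that preserves \<open>I\<close> reads
  \<open>(a, x) \<mapsto> (\<sigma> a + h x, \<kappa> x)\<close> in the coordinates \<open>A \<cong> I \<times> Q\<close>, where
  \<open>(\<sigma>, \<kappa>)\<close> is the image of \<open>\<phi>\<close> under \<open>\<psi>\<close>. Conversely, for a compatible pair
  \<open>(\<sigma>, \<kappa>)\<close> such a map is an automorphism iff \<open>T - T\<^sup>\<sigma>\<^sup>\<kappa>\<close> is the coboundary of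
  \<open>- h \<circ> \<kappa>\<^sup>-\<^sup>1\<close>; for \<open>\<sigma> = id\<close> and \<open>\<kappa> = id\<close> this says that \<open>h\<close> is a derivation. That the
  automorphism restricts to \<open>\<sigma>\<close> on \<open>I\<close> follows from \<open>u\<close> being fixed, which gives \<open>h 0 = 0\<close>.\<close>

text \<open>The difference term gives m(x,y,y) = x only for \<alpha>-related x and y, so
  \<open>m\<close> need not be a Maltsev operation on A. Weak associativity fills the gap: m(-,y,z)
  and m(-,z,y) are mutually inverse for arbitrary y and z. This yields inverses in the class group,
  recovers an element from its coordinates, and turns m(F,H,w) = w into F = H. Together with the
  term condition it gives one working principle: two term functions agree at a corner of an
  \<alpha>-square once they agree at the other three. Commutativity, associativity, additivity of
  the action and its independence of representatives are all instances, with squares chosen so that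
  three corners are trivial. A second obstacle is that u need not be named by a term. An
  automorphism of I preserves \<open>m\<close>, but +_u is m(-,u,-), so the first component of a
  compatible pair is known to be additive only after it is shown to fix u.\<close>

lemma map_tuples: "h \<in> X \<rightarrow> Y \<Longrightarrow> xs \<in> tuples X n \<Longrightarrow> map h xs \<in> tuples Y n"
  by (auto simp: tuples_def)

lemma tuples_nth: "xs \<in> tuples X n \<Longrightarrow> i < n \<Longrightarrow> xs ! i \<in> X"
  by (auto simp: tuples_def)

lemma length_tuples: "xs \<in> tuples X n \<Longrightarrow> length xs = n"
  by (simp add: tuples_def)

lemma is_alg_interp:
  "is_alg \<tau> A \<Longrightarrow> f \<in> symbols \<tau> \<Longrightarrow> xs \<in> tuples (carrier A) (arity \<tau> f) \<Longrightarrow> interp A f xs \<in> carrier A"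
  by (auto simp: is_alg_def)

section \<open>Isomorphisms and automorphism groups\<close>

lemma alg_iso_eval:
  assumes A: "is_alg \<tau> A" and g: "alg_iso \<tau> A B g"
    and \<rho>: "range \<rho> \<subseteq> carrier A" and t: "wf_trm \<tau> t"
  shows "g (eval A \<rho> t) = eval B (\<lambda>v. g (\<rho> v)) t"
  by (rule eval_transport[OF _ _ \<rho> t]) (use A g in \<open>auto simp: is_alg_def alg_iso_def\<close>)

lemma alg_iso_in_variety:
  assumes V: "variety \<tau> V" and A: "in_variety \<tau> V A" and B: "is_alg \<tau> B"
    and g: "alg_iso \<tau> A B g"
  shows "in_variety \<tau> V B"
  unfolding in_variety_def
proof (intro conjI B, clarify)
  fix s t and \<rho> :: "nat \<Rightarrow> _"
  assume st: "(s, t) \<in> V" and \<rho>: "range \<rho> \<subseteq> carrier B"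
  have Aalg: "is_alg \<tau> A" using A by (simp add: in_variety_def)
  have wf: "wf_trm \<tau> s" "wf_trm \<tau> t" using V st by (auto simp: variety_def)
  define \<eta> where "\<eta> v = inv_into (carrier A) g (\<rho> v)" for v
  have img: "g ` carrier A = carrier B" using g by (auto simp: alg_iso_def bij_betw_def)
  then have gB: "\<rho> v \<in> g ` carrier A" for v using \<rho> by auto
  have \<eta>: "range \<eta> \<subseteq> carrier A"
    using gB by (auto simp: \<eta>_def intro: inv_into_into)
  have eq: "(\<lambda>v. g (\<eta> v)) = \<rho>"
    using gB by (auto simp: \<eta>_def f_inv_into_f)
  have "eval A \<eta> s = eval A \<eta> t" using A st \<eta> by (auto simp: in_variety_def)
  then show "eval B \<rho> s = eval B \<rho> t"
    using alg_iso_eval[OF Aalg g \<eta> wf(1)] alg_iso_eval[OF Aalg g \<eta> wf(2)] by (simp add: eq)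
qed

lemma alg_iso_comp:
  assumes A: "is_alg \<tau> A" and g: "alg_iso \<tau> A B g" and h: "alg_iso \<tau> B C h"
  shows "alg_iso \<tau> A C (h \<circ> g)"
  unfolding alg_iso_def
proof (intro conjI ballI)
  show "bij_betw (h \<circ> g) (carrier A) (carrier C)"
    using g h by (auto simp: alg_iso_def intro: bij_betw_trans)
  fix f xs assume f: "f \<in> symbols \<tau>" and xs: "xs \<in> tuples (carrier A) (arity \<tau> f)"
  have "g \<in> carrier A \<rightarrow> carrier B" using g by (auto simp: alg_iso_def bij_betw_def)
  then have "map g xs \<in> tuples (carrier B) (arity \<tau> f)" using xs by (rule map_tuples)
  then show "(h \<circ> g) (interp A f xs) = interp C f (map (h \<circ> g) xs)"
    using g h f xs by (simp add: alg_iso_def)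
qed

lemma alg_iso_inv:
  assumes A: "is_alg \<tau> A" and g: "alg_iso \<tau> A B g"
  shows "alg_iso \<tau> B A (inv_into (carrier A) g)"
  unfolding alg_iso_def
proof (intro conjI ballI)
  let ?k = "inv_into (carrier A) g"
  have bij: "bij_betw g (carrier A) (carrier B)" using g by (simp add: alg_iso_def)
  then show "bij_betw ?k (carrier B) (carrier A)" by (rule bij_betw_inv_into)
  fix f ys assume f: "f \<in> symbols \<tau>" and ys: "ys \<in> tuples (carrier B) (arity \<tau> f)"
  have inj: "inj_on g (carrier A)" and img: "g ` carrier A = carrier B"
    using bij by (auto simp: bij_betw_def)
  have xs: "map ?k ys \<in> tuples (carrier A) (arity \<tau> f)"
    by (rule map_tuples[OF _ ys]) (use img in \<open>auto intro: inv_into_into\<close>)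
  have "map g (map ?k ys) = ys"
    using ys img by (auto simp: tuples_def f_inv_into_f subset_iff intro!: map_idI)
  then have "g (interp A f (map ?k ys)) = interp B f ys"
    using g f xs unfolding alg_iso_def by metis
  then show "?k (interp B f ys) = interp A f (map ?k ys)"
    using inv_into_f_f[OF inj is_alg_interp[OF A f xs]] by simp
qed

text \<open>Members of \<open>Aut\<close> are extensional, so composites and inverses belong to it
  only after restriction to the carrier. This carries the isomorphism property across that change of
  values.\<close>

lemma alg_iso_cong:
  assumes A: "is_alg \<tau> A" and g: "alg_iso \<tau> A B g" and eq: "\<And>x. x \<in> carrier A \<Longrightarrow> h x = g x"
  shows "alg_iso \<tau> A B h"
  unfolding alg_iso_def
proof (intro conjI ballI)
  show "bij_betw h (carrier A) (carrier B)"
    using g eq by (simp add: alg_iso_def cong: bij_betw_cong)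
  fix f xs assume f: "f \<in> symbols \<tau>" and xs: "xs \<in> tuples (carrier A) (arity \<tau> f)"
  have "map h xs = map g xs" using xs eq by (auto simp: tuples_def)
  then show "h (interp A f xs) = interp B f (map h xs)"
    using g f xs eq[OF is_alg_interp[OF A f xs]] unfolding alg_iso_def by metis
qed

lemma Aut_alg_iso: "\<phi> \<in> Aut \<tau> A \<Longrightarrow> alg_iso \<tau> A A \<phi>"
  by (simp add: Aut_def)

lemma restrict_in_Aut:
  "is_alg \<tau> A \<Longrightarrow> alg_iso \<tau> A A g \<Longrightarrow> restrict g (carrier A) \<in> Aut \<tau> A"
  unfolding Aut_def by (auto intro: alg_iso_cong)

lemma Aut_closed: "\<phi> \<in> Aut \<tau> A \<Longrightarrow> x \<in> carrier A \<Longrightarrow> \<phi> x \<in> carrier A"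
  by (auto simp: Aut_def alg_iso_def bij_betw_def)

lemma Aut_image: "\<phi> \<in> Aut \<tau> A \<Longrightarrow> \<phi> ` carrier A = carrier A"
  by (auto simp: Aut_def alg_iso_def bij_betw_def)

lemma Aut_inj: "\<phi> \<in> Aut \<tau> A \<Longrightarrow> inj_on \<phi> (carrier A)"
  by (auto simp: Aut_def alg_iso_def bij_betw_def)

lemma Aut_interp:
  "\<phi> \<in> Aut \<tau> A \<Longrightarrow> f \<in> symbols \<tau> \<Longrightarrow> xs \<in> tuples (carrier A) (arity \<tau> f) \<Longrightarrow>
    \<phi> (interp A f xs) = interp A f (map \<phi> xs)"
  by (auto simp: Aut_def alg_iso_def)

lemma Aut_eqI:
  "\<phi> \<in> Aut \<tau> A \<Longrightarrow> \<psi> \<in> Aut \<tau> A \<Longrightarrow> (\<And>x. x \<in> carrier A \<Longrightarrow> \<phi> x = \<psi> x) \<Longrightarrow> \<phi> = \<psi>"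
  by (auto simp: Aut_def intro: extensionalityI)

lemma Aut_subset_Bij: "Aut \<tau> A \<subseteq> Bij (carrier A)"
  by (auto simp: Aut_def Bij_def alg_iso_def)

lemma Aut_subgroup:
  assumes A: "is_alg \<tau> A"
  shows "subgroup (Aut \<tau> A) (BijGroup (carrier A))"
proof (rule group.subgroupI[OF group_BijGroup])
  show "Aut \<tau> A \<subseteq> carrier (BijGroup (carrier A))"
    using Aut_subset_Bij by (simp add: BijGroup_def)
  have "alg_iso \<tau> A A id" by (simp add: alg_iso_def)
  then show "Aut \<tau> A \<noteq> {}" using restrict_in_Aut[OF A] by blast
next
  fix \<phi> assume \<phi>: "\<phi> \<in> Aut \<tau> A"
  have "inv\<^bsub>BijGroup (carrier A)\<^esub> \<phi> = (\<lambda>x\<in>carrier A. inv_into (carrier A) \<phi> x)"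
    using \<phi> Aut_subset_Bij by (intro inv_BijGroup) auto
  then show "inv\<^bsub>BijGroup (carrier A)\<^esub> \<phi> \<in> Aut \<tau> A"
    using restrict_in_Aut[OF A alg_iso_inv[OF A Aut_alg_iso[OF \<phi>]]] by simp
next
  fix \<phi> \<psi> assume \<phi>: "\<phi> \<in> Aut \<tau> A" and \<psi>: "\<psi> \<in> Aut \<tau> A"
  have "\<phi> \<otimes>\<^bsub>BijGroup (carrier A)\<^esub> \<psi> = restrict (\<phi> \<circ> \<psi>) (carrier A)"
    using \<phi> \<psi> Aut_subset_Bij by (auto simp: BijGroup_def compose_def fun_eq_iff restrict_def)
  then show "\<phi> \<otimes>\<^bsub>BijGroup (carrier A)\<^esub> \<psi> \<in> Aut \<tau> A"
    using restrict_in_Aut[OF A alg_iso_comp[OF A Aut_alg_iso[OF \<psi>] Aut_alg_iso[OF \<phi>]]] by simp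
qed

lemma group_aut_group: "is_alg \<tau> A \<Longrightarrow> group (aut_group \<tau> A)"
  unfolding aut_group_def by (intro subgroup.subgroup_is_group Aut_subgroup group_BijGroup)

lemma carrier_aut_group [simp]: "carrier (aut_group \<tau> A) = Aut \<tau> A"
  by (simp add: aut_group_def)

lemma one_aut_group [simp]: "\<one>\<^bsub>aut_group \<tau> A\<^esub> = (\<lambda>x\<in>carrier A. x)"
  by (simp add: aut_group_def BijGroup_def)

lemma mult_aut_group:
  "\<phi> \<in> Aut \<tau> A \<Longrightarrow> \<psi> \<in> Aut \<tau> A \<Longrightarrow> \<phi> \<otimes>\<^bsub>aut_group \<tau> A\<^esub> \<psi> = (\<lambda>x\<in>carrier A. \<phi> (\<psi> x))"
  using Aut_subset_Bij[of \<tau> A] by (auto simp: aut_group_def BijGroup_def compose_def)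

lemma inv_aut_group:
  assumes A: "is_alg \<tau> A" and \<phi>: "\<phi> \<in> Aut \<tau> A"
  shows "inv\<^bsub>aut_group \<tau> A\<^esub> \<phi> = (\<lambda>x\<in>carrier A. inv_into (carrier A) \<phi> x)"
  using group.m_inv_consistent[OF group_BijGroup Aut_subgroup[OF A] \<phi>] \<phi>
    inv_BijGroup[OF subsetD[OF Aut_subset_Bij \<phi>]]
  by (simp add: aut_group_def)

section \<open>Cohomology of an additive action\<close>

text \<open>Additivity in the group argument is all that cocycles, coboundaries and derivations need
  from the action, so their theory is separated from the commutator arguments that later establish
  it for the zero class.\<close>

locale algebra_action = comm_group G
  for G :: "('a, 'm) monoid_scheme" (structure) +
  fixes \<tau> :: "'f signature" and Q :: "('f, 'q) alg"
    and act :: "'f \<Rightarrow> nat \<Rightarrow> 'q list \<Rightarrow> 'a list \<Rightarrow> 'a"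
  assumes Q_alg: "is_alg \<tau> Q"
    and act_closed: "\<And>f i xs as. f \<in> symbols \<tau> \<Longrightarrow> i < arity \<tau> f \<Longrightarrow>
      xs \<in> tuples (carrier Q) (arity \<tau> f) \<Longrightarrow> as \<in> tuples (carrier G) (arity \<tau> f) \<Longrightarrow>
      act f i xs as \<in> carrier G"
    and act_add: "\<And>f i xs as bs. f \<in> symbols \<tau> \<Longrightarrow> i < arity \<tau> f \<Longrightarrow>
      xs \<in> tuples (carrier Q) (arity \<tau> f) \<Longrightarrow> as \<in> tuples (carrier G) (arity \<tau> f) \<Longrightarrow>
      bs \<in> tuples (carrier G) (arity \<tau> f) \<Longrightarrow>
      act f i xs (map2 (\<otimes>) as bs) = act f i xs as \<otimes> act f i xs bs"
begin

abbreviation "asum \<equiv> act_sum \<tau> G act"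
abbreviation "sd \<equiv> semidirect \<tau> G Q act"
abbreviation "Z \<equiv> cocycles \<tau> G Q"
abbreviation "tup f \<equiv> tuples (carrier Q) (arity \<tau> f)"

lemma asum_closed:
  "f \<in> symbols \<tau> \<Longrightarrow> xs \<in> tup f \<Longrightarrow> as \<in> tuples (carrier G) (arity \<tau> f) \<Longrightarrow> asum f xs as \<in> carrier G"
  unfolding act_sum_def by (rule finprod_closed) (auto intro: act_closed)

lemma asum_map_closed:
  "f \<in> symbols \<tau> \<Longrightarrow> xs \<in> tup f \<Longrightarrow> length zs = arity \<tau> f \<Longrightarrow> (\<And>z. z \<in> set zs \<Longrightarrow> a z \<in> carrier G) \<Longrightarrow>
    asum f xs (map a zs) \<in> carrier G"
  by (rule asum_closed) (auto simp: tuples_def)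

text \<open>Both tuples are images of one arbitrary list \<open>zs\<close>, because the entries will
  come from terms, from elements of Q and from pairs of coordinates in turn.\<close>

lemma asum_add:
  assumes f: "f \<in> symbols \<tau>" and xs: "xs \<in> tup f" and zs: "length zs = arity \<tau> f"
    and a: "\<And>z. z \<in> set zs \<Longrightarrow> a z \<in> carrier G" and b: "\<And>z. z \<in> set zs \<Longrightarrow> b z \<in> carrier G"
  shows "asum f xs (map (\<lambda>z. a z \<otimes> b z) zs) = asum f xs (map a zs) \<otimes> asum f xs (map b zs)"
proof -
  have as: "map a zs \<in> tuples (carrier G) (arity \<tau> f)" and bs: "map b zs \<in> tuples (carrier G) (arity \<tau> f)"
    using a b zs by (auto simp: tuples_def)
  have "asum f xs (map (\<lambda>z. a z \<otimes> b z) zs) =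
      (\<Otimes>i\<in>{..<arity \<tau> f}. act f i xs (map a zs) \<otimes> act f i xs (map b zs))"
    unfolding act_sum_def
  proof (rule finprod_cong')
    fix i assume "i \<in> {..<arity \<tau> f}"
    then show "act f i xs (map (\<lambda>z. a z \<otimes> b z) zs) = act f i xs (map a zs) \<otimes> act f i xs (map b zs)"
      using act_add[OF f _ xs as bs] by (simp add: map2_map_map)
  qed (auto intro!: m_closed act_closed f xs as bs)
  also have "\<dots> = asum f xs (map a zs) \<otimes> asum f xs (map b zs)"
    unfolding act_sum_def by (rule finprod_multf) (auto intro: act_closed f xs as bs)
  finally show ?thesis .
qed

lemma asum_one:
  assumes f: "f \<in> symbols \<tau>" and xs: "xs \<in> tup f" and zs: "length zs = arity \<tau> f"
  shows "asum f xs (map (\<lambda>_. \<one>) zs) = \<one>"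
proof -
  let ?s = "asum f xs (map (\<lambda>_. \<one>) zs)"
  have "?s = ?s \<otimes> ?s" using asum_add[OF f xs zs, of "\<lambda>_. \<one>" "\<lambda>_. \<one>"] by simp
  moreover have "?s \<in> carrier G" by (rule asum_map_closed[OF f xs zs]) simp
  ultimately show ?thesis by (metis l_cancel_one')
qed

lemma cocycle_closed: "T \<in> Z \<Longrightarrow> f \<in> symbols \<tau> \<Longrightarrow> xs \<in> tup f \<Longrightarrow> T f xs \<in> carrier G"
  by (auto simp: cocycles_def PiE_def Pi_def)

lemma cocycle_eqI:
  assumes "S \<in> Z" "T \<in> Z" "\<And>f xs. f \<in> symbols \<tau> \<Longrightarrow> xs \<in> tup f \<Longrightarrow> S f xs = T f xs"
  shows "S = T"
proof (rule PiE_ext[of S _ "\<lambda>f. tup f \<rightarrow>\<^sub>E carrier G"])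
  fix f assume f: "f \<in> symbols \<tau>"
  show "S f = T f"
    by (rule PiE_ext[of _ "tup f" "\<lambda>_. carrier G"]) (use assms f in \<open>auto simp: cocycles_def\<close>)
qed (use assms in \<open>auto simp: cocycles_def\<close>)

lemma cocycleI: "(\<And>f xs. f \<in> symbols \<tau> \<Longrightarrow> xs \<in> tup f \<Longrightarrow> t f xs \<in> carrier G) \<Longrightarrow>
    (\<lambda>f\<in>symbols \<tau>. \<lambda>xs\<in>tup f. t f xs) \<in> Z"
  by (auto simp: cocycles_def)

lemma cocycle_add_closed: "S \<in> Z \<Longrightarrow> T \<in> Z \<Longrightarrow> cocycle_add \<tau> G Q S T \<in> Z"
  unfolding cocycle_add_def by (rule cocycleI) (auto intro: cocycle_closed)

lemma cocycle_diff_closed: "S \<in> Z \<Longrightarrow> T \<in> Z \<Longrightarrow> cocycle_diff \<tau> G Q S T \<in> Z"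
  unfolding cocycle_diff_def by (rule cocycleI) (auto intro: cocycle_closed)

lemma cocycle_zero_closed: "cocycle_zero \<tau> G Q \<in> Z"
  unfolding cocycle_zero_def by (rule cocycleI) auto

lemma cocycle_add_apply [simp]:
  "f \<in> symbols \<tau> \<Longrightarrow> xs \<in> tup f \<Longrightarrow> cocycle_add \<tau> G Q S T f xs = S f xs \<otimes> T f xs"
  by (simp add: cocycle_add_def)

lemma cocycle_diff_apply [simp]:
  "f \<in> symbols \<tau> \<Longrightarrow> xs \<in> tup f \<Longrightarrow> cocycle_diff \<tau> G Q S T f xs = S f xs \<otimes> inv (T f xs)"
  by (simp add: cocycle_diff_def)

lemma cocycle_zero_apply [simp]:
  "f \<in> symbols \<tau> \<Longrightarrow> xs \<in> tup f \<Longrightarrow> cocycle_zero \<tau> G Q f xs = \<one>"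
  by (simp add: cocycle_zero_def)

lemma cocycle_add_zero: "T \<in> Z \<Longrightarrow> cocycle_add \<tau> G Q T (cocycle_zero \<tau> G Q) = T"
  by (rule cocycle_eqI) (auto intro: cocycle_add_closed cocycle_zero_closed simp: cocycle_closed)

lemma cocycle_add_diff:
  assumes "S \<in> Z" "T \<in> Z"
  shows "cocycle_add \<tau> G Q T (cocycle_diff \<tau> G Q S T) = S"
proof (rule cocycle_eqI)
  fix f xs assume "f \<in> symbols \<tau>" "xs \<in> tup f"
  moreover from this have "S f xs \<in> carrier G" "T f xs \<in> carrier G"
    using assms by (auto intro: cocycle_closed)
  ultimately show "cocycle_add \<tau> G Q T (cocycle_diff \<tau> G Q S T) f xs = S f xs"
    by (simp add: m_lcomm)
qed (auto intro: cocycle_add_closed cocycle_diff_closed assms)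

section \<open>Extensions of Q by a cocycle, and compatibility with the variety\<close>

lemma sd_carrier: "carrier (sd T) = carrier G \<times> carrier Q"
  by (simp add: semidirect_def)

lemma sd_interp: "interp (sd T) f ps =
    (asum f (map snd ps) (map fst ps) \<otimes> T f (map snd ps), interp Q f (map snd ps))"
  by (simp add: semidirect_def)

lemma tuples_fst: "ps \<in> tuples (carrier G \<times> carrier Q) n \<Longrightarrow> map fst ps \<in> tuples (carrier G) n"
  by (erule map_tuples[rotated]) auto

lemma tuples_snd: "ps \<in> tuples (carrier G \<times> carrier Q) n \<Longrightarrow> map snd ps \<in> tuples (carrier Q) n"
  by (erule map_tuples[rotated]) auto

lemma sd_alg:
  assumes T: "T \<in> Z"
  shows "is_alg \<tau> (sd T)"
  unfolding is_alg_def sd_carrier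
proof (intro conjI ballI Pi_I)
  show "carrier G \<times> carrier Q \<noteq> {}" using Q_alg one_closed by (auto simp: is_alg_def)
  fix f ps assume f: "f \<in> symbols \<tau>" and ps: "ps \<in> tuples (carrier G \<times> carrier Q) (arity \<tau> f)"
  show "interp (sd T) f ps \<in> carrier G \<times> carrier Q"
    using asum_closed[OF f tuples_snd[OF ps] tuples_fst[OF ps]] cocycle_closed[OF T f tuples_snd[OF ps]]
      is_alg_interp[OF Q_alg f tuples_snd[OF ps]] by (simp add: sd_interp)
qed

lemma sd_eval_snd: "snd (eval (sd T) \<rho> t) = eval Q (\<lambda>v. snd (\<rho> v)) t"
proof (induction t)
  case (App f ts)
  then show ?case by (simp add: sd_interp comp_def cong: map_cong)
qed simp

lemma sd_eval_closed:
  assumes "T \<in> Z" "wf_trm \<tau> t" "\<And>v. a v \<in> carrier G" "\<And>v. x v \<in> carrier Q"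
  shows "fst (eval (sd T) (\<lambda>v. (a v, x v)) t) \<in> carrier G" "eval Q x t \<in> carrier Q"
proof -
  have "eval (sd T) (\<lambda>v. (a v, x v)) t \<in> carrier G \<times> carrier Q"
    unfolding sd_carrier[of T, symmetric]
    by (rule eval_closed[OF is_alg_interp[OF sd_alg]]) (use assms in \<open>auto simp: sd_carrier\<close>)
  then show "fst (eval (sd T) (\<lambda>v. (a v, x v)) t) \<in> carrier G" "eval Q x t \<in> carrier Q"
    using sd_eval_snd[of T "\<lambda>v. (a v, x v)" t] by auto
qed

text \<open>Addition of first components is a homomorphism from the fibre product of two extensions over
  \<open>Q\<close> to the extension of the sum of the two cocycles. Compatibility of any two of \<open>S\<close>, \<open>T\<close> and
  \<open>S + T\<close> therefore implies that of the third.\<close>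

lemma sd_eval_add:
  assumes S: "S \<in> Z" and T: "T \<in> Z" and t: "wf_trm \<tau> t"
    and a: "\<And>v. a v \<in> carrier G" and b: "\<And>v. b v \<in> carrier G" and x: "\<And>v. x v \<in> carrier Q"
  shows "fst (eval (sd (cocycle_add \<tau> G Q S T)) (\<lambda>v. (a v \<otimes> b v, x v)) t) =
    fst (eval (sd S) (\<lambda>v. (a v, x v)) t) \<otimes> fst (eval (sd T) (\<lambda>v. (b v, x v)) t)"
  using t
proof (induction t)
  case (App f ts)
  let ?p = "\<lambda>t. fst (eval (sd S) (\<lambda>v. (a v, x v)) t)"
  let ?q = "\<lambda>t. fst (eval (sd T) (\<lambda>v. (b v, x v)) t)"
  let ?xs = "map (eval Q x) ts"
  have f: "f \<in> symbols \<tau>" and len: "length ts = arity \<tau> f"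
    and ts: "\<And>t. t \<in> set ts \<Longrightarrow> wf_trm \<tau> t" using App.prems by auto
  have xs: "?xs \<in> tup f" using len sd_eval_closed(2)[OF S ts a x] by (auto simp: tuples_def)
  have p: "?p t \<in> carrier G" and q: "?q t \<in> carrier G" if "t \<in> set ts" for t
    using sd_eval_closed(1)[where x = x, OF S ts[OF that] a x]
      sd_eval_closed(1)[where x = x, OF T ts[OF that] b x] by auto
  have ST: "S f ?xs \<in> carrier G" "T f ?xs \<in> carrier G"
    using S T f xs by (auto intro: cocycle_closed)
  have cl: "asum f ?xs (map ?p ts) \<in> carrier G" "asum f ?xs (map ?q ts) \<in> carrier G"
    using asum_map_closed[OF f xs len] p q by auto
  have m: "map (\<lambda>t. fst (eval (sd (cocycle_add \<tau> G Q S T)) (\<lambda>v. (a v \<otimes> b v, x v)) t)) ts =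
      map (\<lambda>t. ?p t \<otimes> ?q t) ts" using App.IH ts by simp
  show ?case
    using asum_add[OF f xs len p q] f xs ST cl
    by (simp add: sd_interp comp_def sd_eval_snd m m_ac)
qed simp

lemma sd_eval_fst:
  assumes V: "in_variety \<tau> V (sd T)" and st: "(s, t) \<in> V"
    and a: "\<And>v. a v \<in> carrier G" and x: "\<And>v. x v \<in> carrier Q"
  shows "eval (sd T) (\<lambda>v. (a v, x v)) s = eval (sd T) (\<lambda>v. (a v, x v)) t"
proof -
  have "range (\<lambda>v. (a v, x v)) \<subseteq> carrier (sd T)" using a x by (auto simp: sd_carrier)
  with V st show ?thesis unfolding in_variety_def by blast
qed

text \<open>Second coordinates are evaluated in Q whatever the cocycle is, so their half of each
  identity is borrowed from the extension by S. Only first coordinates remain to be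
  compared.\<close>

lemma sd_in_varietyI:
  assumes T: "T \<in> Z" and V: "in_variety \<tau> V (sd S)"
    and eq: "\<And>s t (a :: nat \<Rightarrow> 'a) (x :: nat \<Rightarrow> 'q). (s, t) \<in> V \<Longrightarrow> (\<And>v. a v \<in> carrier G) \<Longrightarrow> (\<And>v. x v \<in> carrier Q) \<Longrightarrow>
      fst (eval (sd T) (\<lambda>v. (a v, x v)) s) = fst (eval (sd T) (\<lambda>v. (a v, x v)) t)"
  shows "in_variety \<tau> V (sd T)"
  unfolding in_variety_def
proof (intro conjI sd_alg T, clarify)
  fix s t and \<rho> :: "nat \<Rightarrow> _"
  assume st: "(s, t) \<in> V" and \<rho>: "range \<rho> \<subseteq> carrier (sd T)"
  have v: "fst (\<rho> v) \<in> carrier G" "snd (\<rho> v) \<in> carrier Q" for v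
    using subsetD[OF \<rho> rangeI[of \<rho> v]] by (auto simp: sd_carrier mem_Times_iff)
  have "snd (eval (sd T) \<rho> s) = snd (eval (sd T) \<rho> t)"
    using arg_cong[where f = snd, OF sd_eval_fst[OF V st, of "\<lambda>v. fst (\<rho> v)" "\<lambda>v. snd (\<rho> v)", OF v]]
    by (simp add: sd_eval_snd)
  then show "eval (sd T) \<rho> s = eval (sd T) \<rho> t"
    using eq[of s t "\<lambda>v. fst (\<rho> v)" "\<lambda>v. snd (\<rho> v)", OF st v] by (simp add: prod_eq_iff)
qed

context
  fixes V :: "(('f, nat) trm \<times> ('f, nat) trm) set"
  assumes V: "variety \<tau> V"
begin

abbreviation "ZV \<equiv> compatible_cocycles \<tau> V G Q act"

lemma compatible_cocycle: "T \<in> ZV \<Longrightarrow> T \<in> Z"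
  by (simp add: compatible_cocycles_def)

lemma compatible_add:
  assumes S: "S \<in> ZV" and T: "T \<in> ZV"
  shows "cocycle_add \<tau> G Q S T \<in> ZV"
proof -
  have SZ: "S \<in> Z" and TZ: "T \<in> Z" and SV: "in_variety \<tau> V (sd S)" and TV: "in_variety \<tau> V (sd T)"
    using S T by (auto simp: compatible_cocycles_def)
  have "in_variety \<tau> V (sd (cocycle_add \<tau> G Q S T))"
  proof (rule sd_in_varietyI[OF cocycle_add_closed[OF SZ TZ] SV])
    fix s t and a :: "nat \<Rightarrow> 'a" and x :: "nat \<Rightarrow> 'q"
    assume st: "(s, t) \<in> V" and a: "\<And>v. a v \<in> carrier G" and x: "\<And>v. x v \<in> carrier Q"
    have wf: "wf_trm \<tau> s" "wf_trm \<tau> t" using V st by (auto simp: variety_def)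
    \<comment> \<open>The assignment is split as \<open>a\<close> for S plus zero for T, so that one
      identity in each extension gives the identity in the extension by the sum.\<close>
    have o: "\<one> \<in> carrier G" by simp
    show "fst (eval (sd (cocycle_add \<tau> G Q S T)) (\<lambda>v. (a v, x v)) s) =
        fst (eval (sd (cocycle_add \<tau> G Q S T)) (\<lambda>v. (a v, x v)) t)"
      using sd_eval_add[OF SZ TZ wf(1) a o x] sd_eval_add[OF SZ TZ wf(2) a o x]
        sd_eval_fst[OF SV st a x] sd_eval_fst[OF TV st o x] a by simp
  qed
  then show ?thesis using cocycle_add_closed[OF SZ TZ] by (simp add: compatible_cocycles_def)
qed

text \<open>In first coordinates an identity for S + T is the sum of the identities for S and T, and
  the part of S, taken at the zero assignment, cancels. Applied to T + (S - T) = S and to T + 0 = T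
  this makes differences and the zero cocycle compatible.\<close>

lemma compatible_cancel:
  assumes S: "S \<in> ZV" and TZ: "T \<in> Z" and ST: "cocycle_add \<tau> G Q S T \<in> ZV"
  shows "T \<in> ZV"
proof -
  have SZ: "S \<in> Z" and SV: "in_variety \<tau> V (sd S)"
    and STV: "in_variety \<tau> V (sd (cocycle_add \<tau> G Q S T))"
    using S ST by (auto simp: compatible_cocycles_def)
  have "in_variety \<tau> V (sd T)"
  proof (rule sd_in_varietyI[OF TZ SV])
    fix s t and a :: "nat \<Rightarrow> 'a" and x :: "nat \<Rightarrow> 'q"
    assume st: "(s, t) \<in> V" and a: "\<And>v. a v \<in> carrier G" and x: "\<And>v. x v \<in> carrier Q"
    have wf: "wf_trm \<tau> s" "wf_trm \<tau> t" using V st by (auto simp: variety_def)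
    have o: "\<one> \<in> carrier G" by simp
    have "fst (eval (sd S) (\<lambda>v. (\<one>, x v)) t) \<otimes> fst (eval (sd T) (\<lambda>v. (a v, x v)) s) =
        fst (eval (sd S) (\<lambda>v. (\<one>, x v)) t) \<otimes> fst (eval (sd T) (\<lambda>v. (a v, x v)) t)"
      using sd_eval_add[OF SZ TZ wf(1) o a x] sd_eval_add[OF SZ TZ wf(2) o a x]
        sd_eval_fst[OF SV st o x] sd_eval_fst[OF STV st a x] a by simp
    then show "fst (eval (sd T) (\<lambda>v. (a v, x v)) s) = fst (eval (sd T) (\<lambda>v. (a v, x v)) t)"
      using sd_eval_closed(1)[OF SZ wf(2) o x] sd_eval_closed(1)[OF TZ wf(1) a x]
        sd_eval_closed(1)[OF TZ wf(2) a x] by simp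
  qed
  then show ?thesis using TZ by (simp add: compatible_cocycles_def)
qed

lemma compatible_diff: "S \<in> ZV \<Longrightarrow> T \<in> ZV \<Longrightarrow> cocycle_diff \<tau> G Q S T \<in> ZV"
  by (rule compatible_cancel[of T]) (auto simp: cocycle_add_diff cocycle_diff_closed compatible_cocycle)

lemma compatible_zero: "T \<in> ZV \<Longrightarrow> cocycle_zero \<tau> G Q \<in> ZV"
  by (rule compatible_cancel[of T]) (auto simp: cocycle_add_zero cocycle_zero_closed compatible_cocycle)

end

section \<open>Coboundaries and the second cohomology group\<close>

definition coboundary :: "'f \<Rightarrow> 'q list \<Rightarrow> ('q \<Rightarrow> 'a) \<Rightarrow> 'a" where
  "coboundary f xs h = asum f xs (map h xs) \<otimes> inv (h (interp Q f xs))"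

lemma asum_fun_closed:
  "f \<in> symbols \<tau> \<Longrightarrow> xs \<in> tup f \<Longrightarrow> h \<in> carrier Q \<rightarrow> carrier G \<Longrightarrow> asum f xs (map h xs) \<in> carrier G"
  by (rule asum_map_closed) (auto simp: tuples_def)

lemma fun_interp_closed:
  "f \<in> symbols \<tau> \<Longrightarrow> xs \<in> tup f \<Longrightarrow> h \<in> carrier Q \<rightarrow> carrier G \<Longrightarrow> h (interp Q f xs) \<in> carrier G"
  using is_alg_interp[OF Q_alg] by auto

lemma asum_inv:
  assumes f: "f \<in> symbols \<tau>" and xs: "xs \<in> tup f" and zs: "length zs = arity \<tau> f"
    and a: "\<And>z. z \<in> set zs \<Longrightarrow> a z \<in> carrier G"
  shows "asum f xs (map (\<lambda>z. inv (a z)) zs) = inv (asum f xs (map a zs))"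
proof -
  have cl: "asum f xs (map (\<lambda>z. inv (a z)) zs) \<in> carrier G" "asum f xs (map a zs) \<in> carrier G"
    using a by (auto intro!: asum_map_closed f xs zs)
  have "asum f xs (map (\<lambda>z. inv (a z)) zs) \<otimes> asum f xs (map a zs) =
      asum f xs (map (\<lambda>z. inv (a z) \<otimes> a z) zs)"
    using a by (intro asum_add[OF f xs zs, symmetric]) auto
  also have "\<dots> = asum f xs (map (\<lambda>_. \<one>) zs)" using a by (simp cong: map_cong)
  also have "\<dots> = \<one>" by (rule asum_one[OF f xs zs])
  finally show ?thesis using cl by (simp add: inv_equality)
qed

text \<open>Because a coboundary is additive in its cochain, the cochains 0, -h and h + k witness
  reflexivity, symmetry and transitivity of \<open>cohomologous\<close>, and h + k also its
  compatibility with sums of cocycles.\<close>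

lemma coboundary_mult:
  assumes f: "f \<in> symbols \<tau>" and xs: "xs \<in> tup f"
    and h: "h \<in> carrier Q \<rightarrow> carrier G" and k: "k \<in> carrier Q \<rightarrow> carrier G"
  shows "coboundary f xs (\<lambda>x. h x \<otimes> k x) = coboundary f xs h \<otimes> coboundary f xs k"
proof -
  have "asum f xs (map (\<lambda>x. h x \<otimes> k x) xs) = asum f xs (map h xs) \<otimes> asum f xs (map k xs)"
    by (rule asum_add[OF f xs]) (use xs h k in \<open>auto simp: tuples_def\<close>)
  then show ?thesis
    using asum_fun_closed[OF f xs h] asum_fun_closed[OF f xs k]
      fun_interp_closed[OF f xs h] fun_interp_closed[OF f xs k]
    by (simp add: coboundary_def inv_mult m_ac)
qed

lemma coboundary_one:
  assumes f: "f \<in> symbols \<tau>" and xs: "xs \<in> tup f"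
  shows "coboundary f xs (\<lambda>_. \<one>) = \<one>"
  unfolding coboundary_def using asum_one[OF f xs, of xs] xs by (simp add: tuples_def)

lemma coboundary_inv:
  assumes f: "f \<in> symbols \<tau>" and xs: "xs \<in> tup f" and h: "h \<in> carrier Q \<rightarrow> carrier G"
  shows "coboundary f xs (\<lambda>x. inv (h x)) = inv (coboundary f xs h)"
proof -
  have "asum f xs (map (\<lambda>x. inv (h x)) xs) = inv (asum f xs (map h xs))"
    by (rule asum_inv[OF f xs]) (use xs h in \<open>auto simp: tuples_def\<close>)
  then show ?thesis
    using asum_fun_closed[OF f xs h] fun_interp_closed[OF f xs h]
    by (simp add: coboundary_def inv_mult)
qed

lemma cohomologous_iff:
  "cohomologous \<tau> G Q act S T \<longleftrightarrow> (\<exists>h\<in>carrier Q \<rightarrow> carrier G. \<forall>f\<in>symbols \<tau>. \<forall>xs\<in>tup f.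
     S f xs \<otimes> inv (T f xs) = coboundary f xs h)"
  by (simp add: cohomologous_def coboundary_def)

lemma cohomologous_refl:
  assumes "T \<in> Z" shows "cohomologous \<tau> G Q act T T"
  unfolding cohomologous_iff
  by (rule bexI[of _ "\<lambda>_. \<one>"]) (use assms in \<open>auto simp: coboundary_one cocycle_closed\<close>)

lemma cohomologous_sym:
  assumes S: "S \<in> Z" and T: "T \<in> Z" and ST: "cohomologous \<tau> G Q act S T"
  shows "cohomologous \<tau> G Q act T S"
proof -
  obtain h where h: "h \<in> carrier Q \<rightarrow> carrier G"
    and eq: "\<And>f xs. f \<in> symbols \<tau> \<Longrightarrow> xs \<in> tup f \<Longrightarrow> S f xs \<otimes> inv (T f xs) = coboundary f xs h"
    using ST by (auto simp: cohomologous_iff)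
  show ?thesis
    unfolding cohomologous_iff
  proof (intro bexI ballI)
    fix f xs assume f: "f \<in> symbols \<tau>" and xs: "xs \<in> tup f"
    have "T f xs \<otimes> inv (S f xs) = inv (S f xs \<otimes> inv (T f xs))"
      using cocycle_closed[OF S f xs] cocycle_closed[OF T f xs] by (simp add: inv_mult m_comm)
    also have "\<dots> = coboundary f xs (\<lambda>x. inv (h x))" by (simp add: eq f xs h coboundary_inv)
    finally show "T f xs \<otimes> inv (S f xs) = coboundary f xs (\<lambda>x. inv (h x))" .
  qed (use h in auto)
qed

lemma cohomologous_trans:
  assumes S: "S \<in> Z" and T: "T \<in> Z" and U: "U \<in> Z"
    and ST: "cohomologous \<tau> G Q act S T" and TU: "cohomologous \<tau> G Q act T U"
  shows "cohomologous \<tau> G Q act S U"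
proof -
  obtain h where h: "h \<in> carrier Q \<rightarrow> carrier G"
    and eqh: "\<And>f xs. f \<in> symbols \<tau> \<Longrightarrow> xs \<in> tup f \<Longrightarrow> S f xs \<otimes> inv (T f xs) = coboundary f xs h"
    using ST by (auto simp: cohomologous_iff)
  obtain k where k: "k \<in> carrier Q \<rightarrow> carrier G"
    and eqk: "\<And>f xs. f \<in> symbols \<tau> \<Longrightarrow> xs \<in> tup f \<Longrightarrow> T f xs \<otimes> inv (U f xs) = coboundary f xs k"
    using TU by (auto simp: cohomologous_iff)
  show ?thesis
    unfolding cohomologous_iff
  proof (intro bexI ballI)
    fix f xs assume f: "f \<in> symbols \<tau>" and xs: "xs \<in> tup f"
    have "S f xs \<otimes> inv (U f xs) = (S f xs \<otimes> inv (T f xs)) \<otimes> (T f xs \<otimes> inv (U f xs))"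
      using cocycle_closed[OF S f xs] cocycle_closed[OF T f xs] cocycle_closed[OF U f xs]
      by (metis inv_closed l_inv m_assoc m_closed r_one)
    then show "S f xs \<otimes> inv (U f xs) = coboundary f xs (\<lambda>x. h x \<otimes> k x)"
      by (simp add: eqh eqk f xs h k coboundary_mult)
  qed (use h k in auto)
qed

lemma cohomologous_add:
  assumes S: "S \<in> Z" and T: "T \<in> Z" and S': "S' \<in> Z" and T': "T' \<in> Z"
    and SS: "cohomologous \<tau> G Q act S S'" and TT: "cohomologous \<tau> G Q act T T'"
  shows "cohomologous \<tau> G Q act (cocycle_add \<tau> G Q S T) (cocycle_add \<tau> G Q S' T')"
proof -
  obtain h where h: "h \<in> carrier Q \<rightarrow> carrier G"
    and eqh: "\<And>f xs. f \<in> symbols \<tau> \<Longrightarrow> xs \<in> tup f \<Longrightarrow> S f xs \<otimes> inv (S' f xs) = coboundary f xs h"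
    using SS by (auto simp: cohomologous_iff)
  obtain k where k: "k \<in> carrier Q \<rightarrow> carrier G"
    and eqk: "\<And>f xs. f \<in> symbols \<tau> \<Longrightarrow> xs \<in> tup f \<Longrightarrow> T f xs \<otimes> inv (T' f xs) = coboundary f xs k"
    using TT by (auto simp: cohomologous_iff)
  show ?thesis
    unfolding cohomologous_iff
  proof (intro bexI ballI)
    fix f xs assume f: "f \<in> symbols \<tau>" and xs: "xs \<in> tup f"
    have "(S f xs \<otimes> T f xs) \<otimes> inv (S' f xs \<otimes> T' f xs) =
        (S f xs \<otimes> inv (S' f xs)) \<otimes> (T f xs \<otimes> inv (T' f xs))"
      using assms(1-4) f xs by (simp add: cocycle_closed inv_mult m_ac)
    then show "cocycle_add \<tau> G Q S T f xs \<otimes> inv (cocycle_add \<tau> G Q S' T' f xs) =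
        coboundary f xs (\<lambda>x. h x \<otimes> k x)"
      by (simp add: eqh eqk f xs h k coboundary_mult)
  qed (use h k in auto)
qed

lemma equiv_cohomology_rel:
  "equiv (compatible_cocycles \<tau> V G Q act) (cohomology_rel \<tau> V G Q act)"
proof (rule equivI)
  show "sym (cohomology_rel \<tau> V G Q act)"
    by (auto intro!: symI cohomologous_sym simp: cohomology_rel_def compatible_cocycles_def)
  show "trans (cohomology_rel \<tau> V G Q act)"
  proof (rule transI)
    fix S T U assume "(S, T) \<in> cohomology_rel \<tau> V G Q act" "(T, U) \<in> cohomology_rel \<tau> V G Q act"
    then show "(S, U) \<in> cohomology_rel \<tau> V G Q act"
      using cohomologous_trans[of S T U] by (auto simp: cohomology_rel_def compatible_cocycles_def)
  qed
qed (auto intro!: refl_onI cohomologous_refl simp: cohomology_rel_def compatible_cocycles_def)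

text \<open>\<open>H2\<close> multiplies two classes through all their representatives at once.
  Since \<open>cohomologous\<close> respects sums, all these results are the same class, and any one
  pair of representatives computes it.\<close>

lemma H2_mult:
  assumes V: "variety \<tau> V"
    and S: "S \<in> compatible_cocycles \<tau> V G Q act" and T: "T \<in> compatible_cocycles \<tau> V G Q act"
  shows "cohomology_rel \<tau> V G Q act `` {S} \<otimes>\<^bsub>H2 \<tau> V G Q act\<^esub> cohomology_rel \<tau> V G Q act `` {T} =
    cohomology_rel \<tau> V G Q act `` {cocycle_add \<tau> G Q S T}"
proof -
  let ?R = "cohomology_rel \<tau> V G Q act"
  have "congruent2 ?R ?R (\<lambda>S T. ?R `` {cocycle_add \<tau> G Q S T})"
  proof (rule congruent2I')
    fix S S' T T' assume 1: "(S, S') \<in> ?R" and 2: "(T, T') \<in> ?R"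
    have "(cocycle_add \<tau> G Q S T, cocycle_add \<tau> G Q S' T') \<in> ?R"
      using 1 2 compatible_add[OF V]
      by (auto simp: cohomology_rel_def intro!: cohomologous_add compatible_cocycle[OF V])
    then show "?R `` {cocycle_add \<tau> G Q S T} = ?R `` {cocycle_add \<tau> G Q S' T'}"
      by (rule equiv_class_eq[OF equiv_cohomology_rel])
  qed
  then show ?thesis
    using UN_equiv_class2[OF equiv_cohomology_rel equiv_cohomology_rel _ S T] by (simp add: H2_def)
qed

text \<open>The cocycle \<open>T0\<close> guarantees that the zero cocycle is compatible, so that
  the neutral element is a class of the quotient. Inverses come from 0 - S, and the group laws hold
  already for cocycles.\<close>

lemma H2_comm_group:
  assumes V: "variety \<tau> V" and T0: "T0 \<in> compatible_cocycles \<tau> V G Q act"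
  shows "comm_group (H2 \<tau> V G Q act)"
proof -
  let ?R = "cohomology_rel \<tau> V G Q act" and ?ZV = "compatible_cocycles \<tau> V G Q act"
    and ?H = "H2 \<tau> V G Q act"
  have car: "carrier ?H = ?ZV // ?R" and one: "\<one>\<^bsub>?H\<^esub> = ?R `` {cocycle_zero \<tau> G Q}"
    by (auto simp: H2_def)
  note mult = H2_mult[OF V] and add = compatible_add[OF V] and zero = compatible_zero[OF V T0]
    and coc = compatible_cocycle[OF V]
  show ?thesis
  proof (rule comm_groupI; unfold car one)
    fix X Y assume "X \<in> ?ZV // ?R" "Y \<in> ?ZV // ?R"
    then show "X \<otimes>\<^bsub>?H\<^esub> Y \<in> ?ZV // ?R"
      by (auto elim!: quotientE simp: mult intro!: quotientI add)
  next
    show "?R `` {cocycle_zero \<tau> G Q} \<in> ?ZV // ?R" by (rule quotientI[OF zero])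
  next
    fix X Y W assume "X \<in> ?ZV // ?R" "Y \<in> ?ZV // ?R" "W \<in> ?ZV // ?R"
    then obtain S T U where X: "X = ?R `` {S}" "S \<in> ?ZV" and Y: "Y = ?R `` {T}" "T \<in> ?ZV"
      and W: "W = ?R `` {U}" "U \<in> ?ZV" by (auto elim!: quotientE)
    have "cocycle_add \<tau> G Q (cocycle_add \<tau> G Q S T) U = cocycle_add \<tau> G Q S (cocycle_add \<tau> G Q T U)"
      by (rule cocycle_eqI)
        (use X Y W in \<open>auto simp: coc cocycle_closed m_assoc intro!: cocycle_add_closed\<close>)
    then show "X \<otimes>\<^bsub>?H\<^esub> Y \<otimes>\<^bsub>?H\<^esub> W = X \<otimes>\<^bsub>?H\<^esub> (Y \<otimes>\<^bsub>?H\<^esub> W)"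
      using X Y W by (simp add: mult add)
  next
    fix X Y assume "X \<in> ?ZV // ?R" "Y \<in> ?ZV // ?R"
    then obtain S T where X: "X = ?R `` {S}" "S \<in> ?ZV" and Y: "Y = ?R `` {T}" "T \<in> ?ZV"
      by (auto elim!: quotientE)
    have "cocycle_add \<tau> G Q S T = cocycle_add \<tau> G Q T S"
      by (rule cocycle_eqI)
        (use X Y in \<open>auto simp: coc cocycle_closed m_comm intro!: cocycle_add_closed\<close>)
    then show "X \<otimes>\<^bsub>?H\<^esub> Y = Y \<otimes>\<^bsub>?H\<^esub> X" using X Y by (simp add: mult)
  next
    fix X assume "X \<in> ?ZV // ?R"
    then obtain S where X: "X = ?R `` {S}" "S \<in> ?ZV" by (auto elim!: quotientE)
    have "cocycle_add \<tau> G Q (cocycle_zero \<tau> G Q) S = S"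
      by (rule cocycle_eqI)
        (use X in \<open>auto simp: coc cocycle_closed intro!: cocycle_add_closed cocycle_zero_closed\<close>)
    then show "?R `` {cocycle_zero \<tau> G Q} \<otimes>\<^bsub>?H\<^esub> X = X" using X zero by (simp add: mult)
  next
    fix X assume "X \<in> ?ZV // ?R"
    then obtain S where X: "X = ?R `` {S}" "S \<in> ?ZV" by (auto elim!: quotientE)
    let ?S' = "cocycle_diff \<tau> G Q (cocycle_zero \<tau> G Q) S"
    have S': "?S' \<in> ?ZV" by (rule compatible_diff[OF V zero X(2)])
    have "cocycle_add \<tau> G Q ?S' S = cocycle_zero \<tau> G Q"
      by (rule cocycle_eqI)
        (use X S' in \<open>auto simp: coc cocycle_closed intro!: cocycle_add_closed cocycle_zero_closed\<close>)
    then have "?R `` {?S'} \<otimes>\<^bsub>?H\<^esub> X = ?R `` {cocycle_zero \<tau> G Q}" using X S' by (simp add: mult)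
    then show "\<exists>Y\<in>?ZV // ?R. Y \<otimes>\<^bsub>?H\<^esub> X = ?R `` {cocycle_zero \<tau> G Q}"
      using quotientI[OF S'] by blast
  qed
qed

section \<open>The group of derivations\<close>

lemma Der_iff: "d \<in> carrier (Der \<tau> G Q act) \<longleftrightarrow> d \<in> carrier Q \<rightarrow>\<^sub>E carrier G \<and>
    (\<forall>f\<in>symbols \<tau>. \<forall>xs\<in>tup f. d (interp Q f xs) = asum f xs (map d xs))"
  by (simp add: Der_def)

text \<open>Derivations are extensional, but their law is more easily checked for an unrestricted
  function. Restriction keeps the law because the operations of Q stay in its carrier.\<close>

lemma restrict_in_Der:
  assumes d: "d \<in> carrier Q \<rightarrow> carrier G"
    and eq: "\<And>f xs. f \<in> symbols \<tau> \<Longrightarrow> xs \<in> tup f \<Longrightarrow> d (interp Q f xs) = asum f xs (map d xs)"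
  shows "restrict d (carrier Q) \<in> carrier (Der \<tau> G Q act)"
  unfolding Der_iff
proof (intro conjI ballI)
  show "restrict d (carrier Q) \<in> carrier Q \<rightarrow>\<^sub>E carrier G" using d by auto
  fix f xs assume f: "f \<in> symbols \<tau>" and xs: "xs \<in> tup f"
  have m: "map (restrict d (carrier Q)) xs = map d xs" using xs by (auto simp: tuples_def)
  show "restrict d (carrier Q) (interp Q f xs) = asum f xs (map (restrict d (carrier Q)) xs)"
    unfolding m using eq[OF f xs] is_alg_interp[OF Q_alg f xs] by simp
qed

lemma Der_comm_group: "comm_group (Der \<tau> G Q act)"
proof -
  let ?D = "Der \<tau> G Q act"
  have mult: "d \<otimes>\<^bsub>?D\<^esub> e = (\<lambda>x\<in>carrier Q. d x \<otimes> e x)" for d e by (simp add: Der_def)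
  have one: "\<one>\<^bsub>?D\<^esub> = (\<lambda>x\<in>carrier Q. \<one>)" by (simp add: Der_def)
  have fn: "d \<in> carrier Q \<rightarrow> carrier G" and ext: "d \<in> extensional (carrier Q)"
    and eq: "\<And>f xs. f \<in> symbols \<tau> \<Longrightarrow> xs \<in> tup f \<Longrightarrow> d (interp Q f xs) = asum f xs (map d xs)"
    if "d \<in> carrier ?D" for d
    using that unfolding Der_iff by (auto simp: PiE_def)
  have add: "asum f xs (map (\<lambda>x. d x \<otimes> e x) xs) = asum f xs (map d xs) \<otimes> asum f xs (map e xs)"
    if "f \<in> symbols \<tau>" "xs \<in> tup f" "d \<in> carrier Q \<rightarrow> carrier G" "e \<in> carrier Q \<rightarrow> carrier G" for f xs d e
    using that by (intro asum_add) (auto simp: tuples_def)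
  show ?thesis
  proof (rule comm_groupI)
    fix d e assume d: "d \<in> carrier ?D" and e: "e \<in> carrier ?D"
    show "d \<otimes>\<^bsub>?D\<^esub> e \<in> carrier ?D"
      unfolding mult
      by (rule restrict_in_Der) (use fn[OF d] fn[OF e] in \<open>auto simp: add eq d e\<close>)
    show "d \<otimes>\<^bsub>?D\<^esub> e = e \<otimes>\<^bsub>?D\<^esub> d"
      unfolding mult by (rule restrict_ext) (use fn[OF d] fn[OF e] in \<open>auto intro: m_comm\<close>)
  next
    show "\<one>\<^bsub>?D\<^esub> \<in> carrier ?D"
      unfolding one by (rule restrict_in_Der) (auto simp: asum_one tuples_def)
  next
    fix d e k assume "d \<in> carrier ?D" "e \<in> carrier ?D" "k \<in> carrier ?D"
    note fn = this[THEN fn]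
    show "d \<otimes>\<^bsub>?D\<^esub> e \<otimes>\<^bsub>?D\<^esub> k = d \<otimes>\<^bsub>?D\<^esub> (e \<otimes>\<^bsub>?D\<^esub> k)"
      unfolding mult by (rule restrict_ext) (use fn in \<open>auto intro!: m_assoc\<close>)
  next
    fix d assume d: "d \<in> carrier ?D"
    show "\<one>\<^bsub>?D\<^esub> \<otimes>\<^bsub>?D\<^esub> d = d"
      unfolding mult one
      by (rule extensionalityI[OF _ ext[OF d]]) (use fn[OF d] in \<open>auto simp: Pi_iff\<close>)
    let ?e = "\<lambda>x\<in>carrier Q. inv (d x)"
    have "?e \<in> carrier ?D"
    proof (rule restrict_in_Der)
      fix f xs assume f: "f \<in> symbols \<tau>" and xs: "xs \<in> tup f"
      have "asum f xs (map (\<lambda>x. inv (d x)) xs) = inv (asum f xs (map d xs))"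
        by (rule asum_inv[OF f xs]) (use xs fn[OF d] in \<open>auto simp: tuples_def\<close>)
      then show "inv (d (interp Q f xs)) = asum f xs (map (\<lambda>x. inv (d x)) xs)"
        by (simp add: eq[OF d f xs])
    qed (use fn[OF d] in auto)
    moreover have "?e \<otimes>\<^bsub>?D\<^esub> d = \<one>\<^bsub>?D\<^esub>"
      unfolding mult one by (rule restrict_ext) (use fn[OF d] in \<open>auto simp: Pi_iff\<close>)
    ultimately show "\<exists>e\<in>carrier ?D. e \<otimes>\<^bsub>?D\<^esub> d = \<one>\<^bsub>?D\<^esub>" by blast
  qed
qed

end

section \<open>Shifts and the Wells map\<close>

context algebra_action
begin

text \<open>The value of \<open>h\<close> is attached to the source point x although the result lies
  over \<kappa> x. A cochain in \<open>cohomologous\<close> lives at the target, whence the change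
  of variable by the inverse of \<kappa> below.\<close>

definition shift :: "('a \<Rightarrow> 'a) \<Rightarrow> ('q \<Rightarrow> 'q) \<Rightarrow> ('q \<Rightarrow> 'a) \<Rightarrow> 'a \<times> 'q \<Rightarrow> 'a \<times> 'q" where
  "shift \<sigma> \<kappa> h = (\<lambda>(a, x). (\<sigma> a \<otimes> h x, \<kappa> x))"

text \<open>These are the properties of a compatible pair that matter for lifting: \<sigma> enters
  as an additive bijection of the group rather than as an algebra automorphism.
  \<open>C_facts\<close> supplies them for compatible pairs. For the identity pair they are
  immediate, and that case yields derivations.\<close>

context
  fixes \<sigma> \<kappa>
  assumes \<sigma>_bij: "bij_betw \<sigma> (carrier G) (carrier G)"
    and \<sigma>_add: "\<And>a b. a \<in> carrier G \<Longrightarrow> b \<in> carrier G \<Longrightarrow> \<sigma> (a \<otimes> b) = \<sigma> a \<otimes> \<sigma> b"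
    and \<kappa>: "alg_iso \<tau> Q Q \<kappa>"
    and equivariant: "\<And>f i xs as. f \<in> symbols \<tau> \<Longrightarrow> i < arity \<tau> f \<Longrightarrow> xs \<in> tup f \<Longrightarrow>
      as \<in> tuples (carrier G) (arity \<tau> f) \<Longrightarrow> \<sigma> (act f i xs as) = act f i (map \<kappa> xs) (map \<sigma> as)"
begin

lemma \<sigma>_closed: "a \<in> carrier G \<Longrightarrow> \<sigma> a \<in> carrier G"
  using \<sigma>_bij by (auto simp: bij_betw_def)

lemma \<kappa>_closed: "x \<in> carrier Q \<Longrightarrow> \<kappa> x \<in> carrier Q"
  using \<kappa> by (auto simp: alg_iso_def bij_betw_def)

lemma map_\<kappa>: "xs \<in> tuples (carrier Q) n \<Longrightarrow> map \<kappa> xs \<in> tuples (carrier Q) n"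
  by (rule map_tuples) (auto intro: \<kappa>_closed)

lemma \<kappa>_interp: "f \<in> symbols \<tau> \<Longrightarrow> xs \<in> tup f \<Longrightarrow> \<kappa> (interp Q f xs) = interp Q f (map \<kappa> xs)"
  using \<kappa> by (simp add: alg_iso_def)

lemma \<sigma>_one: "\<sigma> \<one> = \<one>"
  using \<sigma>_add[of \<one> \<one>] \<sigma>_closed[of \<one>] by (metis l_one one_closed l_cancel_one')

lemma \<sigma>_finprod:
  assumes "finite J" "g \<in> J \<rightarrow> carrier G"
  shows "\<sigma> (finprod G g J) = finprod G (\<lambda>j. \<sigma> (g j)) J"
  using assms
proof (induction J)
  case (insert j J)
  then have "g j \<in> carrier G" "g \<in> J \<rightarrow> carrier G" by auto
  moreover from this have "(\<lambda>j. \<sigma> (g j)) \<in> J \<rightarrow> carrier G" using \<sigma>_closed by auto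
  ultimately show ?case using insert \<sigma>_closed by (simp add: \<sigma>_add)
qed (simp add: \<sigma>_one)

lemma asum_equivariant:
  assumes f: "f \<in> symbols \<tau>" and xs: "xs \<in> tup f" and as: "as \<in> tuples (carrier G) (arity \<tau> f)"
  shows "\<sigma> (asum f xs as) = asum f (map \<kappa> xs) (map \<sigma> as)"
proof -
  have "\<sigma> (asum f xs as) = (\<Otimes>i\<in>{..<arity \<tau> f}. \<sigma> (act f i xs as))"
    unfolding act_sum_def by (rule \<sigma>_finprod) (auto intro: act_closed f xs as)
  also have "\<dots> = asum f (map \<kappa> xs) (map \<sigma> as)"
    unfolding act_sum_def
    by (rule finprod_cong')
      (auto intro!: act_closed f xs as equivariant map_\<kappa> map_tuples \<sigma>_closed)
  finally show ?thesis .
qed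

lemma shift_bij:
  assumes h: "h \<in> carrier Q \<rightarrow> carrier G"
  shows "bij_betw (shift \<sigma> \<kappa> h) (carrier G \<times> carrier Q) (carrier G \<times> carrier Q)"
proof -
  have \<sigma>: "inj_on \<sigma> (carrier G)" "\<sigma> ` carrier G = carrier G"
    and k: "inj_on \<kappa> (carrier Q)" "\<kappa> ` carrier Q = carrier Q"
    using \<sigma>_bij \<kappa> by (auto simp: bij_betw_def alg_iso_def)
  have "inj_on (shift \<sigma> \<kappa> h) (carrier G \<times> carrier Q)"
  proof (rule inj_onI, clarify)
    fix a x b y assume ab: "a \<in> carrier G" "b \<in> carrier G" and xy: "x \<in> carrier Q" "y \<in> carrier Q"
      and eq: "shift \<sigma> \<kappa> h (a, x) = shift \<sigma> \<kappa> h (b, y)"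
    then have "x = y" using k(1) by (auto simp: shift_def dest: inj_onD)
    moreover from this have "\<sigma> a = \<sigma> b" using eq h ab xy \<sigma>_closed by (auto simp: shift_def Pi_iff)
    ultimately show "a = b \<and> x = y" using \<sigma>(1) ab by (auto dest: inj_onD)
  qed
  moreover have "(b, y) \<in> shift \<sigma> \<kappa> h ` (carrier G \<times> carrier Q)"
    if b: "b \<in> carrier G" and y: "y \<in> carrier Q" for b y
  proof -
    obtain x where x: "x \<in> carrier Q" "\<kappa> x = y" using k(2) y by (metis imageE)
    have hx: "h x \<in> carrier G" using h x by auto
    then have "b \<otimes> inv (h x) \<in> \<sigma> ` carrier G" using \<sigma>(2) b by simp
    then obtain a where a: "a \<in> carrier G" "\<sigma> a = b \<otimes> inv (h x)" by (metis imageE)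
    have "shift \<sigma> \<kappa> h (a, x) = (b, y)" using a x b hx by (simp add: shift_def m_assoc)
    then show ?thesis using a x by (metis SigmaI image_eqI)
  qed
  ultimately show ?thesis
    using h \<sigma>_closed \<kappa>_closed by (auto simp: bij_betw_def shift_def Pi_iff)
qed

text \<open>By additivity and equivariance both sides contain the same summand, namely the
  contribution of the first coordinates of \<open>ps\<close>. Cancelling it leaves a condition on
  the second coordinates alone.\<close>

lemma shift_hom_iff:
  assumes T: "T \<in> Z" and h: "h \<in> carrier Q \<rightarrow> carrier G" and f: "f \<in> symbols \<tau>"
    and ps: "ps \<in> tuples (carrier G \<times> carrier Q) (arity \<tau> f)" and xs: "xs = map snd ps"
  shows "shift \<sigma> \<kappa> h (interp (sd T) f ps) = interp (sd T) f (map (shift \<sigma> \<kappa> h) ps) \<longleftrightarrow>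
    \<sigma> (T f xs) \<otimes> h (interp Q f xs) = asum f (map \<kappa> xs) (map h xs) \<otimes> T f (map \<kappa> xs)"
proof -
  have xsT: "xs \<in> tup f" and as: "map fst ps \<in> tuples (carrier G) (arity \<tau> f)"
    using tuples_snd[OF ps] tuples_fst[OF ps] xs by auto
  note kxs = map_\<kappa>[OF xsT]
  have len: "length ps = arity \<tau> f" using ps by (simp add: tuples_def)
  have p: "fst p \<in> carrier G" "snd p \<in> carrier Q" if "p \<in> set ps" for p
    using ps that by (auto simp: tuples_def mem_Times_iff)
  have m: "map fst (map (shift \<sigma> \<kappa> h) ps) = map (\<lambda>p. \<sigma> (fst p) \<otimes> h (snd p)) ps"
    "map snd (map (shift \<sigma> \<kappa> h) ps) = map \<kappa> xs"
    by (auto simp: shift_def xs split: prod.splits)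
  have s: "asum f (map \<kappa> xs) (map (\<lambda>p. \<sigma> (fst p) \<otimes> h (snd p)) ps) =
      asum f (map \<kappa> xs) (map (\<lambda>p. \<sigma> (fst p)) ps) \<otimes> asum f (map \<kappa> xs) (map (\<lambda>p. h (snd p)) ps)"
    by (rule asum_add[OF f kxs len]) (use p \<sigma>_closed h in auto)
  have hs: "map (\<lambda>p. h (snd p)) ps = map h xs" by (simp add: xs)
  have \<sigma>s: "\<sigma> (asum f xs (map fst ps)) = asum f (map \<kappa> xs) (map (\<lambda>p. \<sigma> (fst p)) ps)"
    using asum_equivariant[OF f xsT as] by (simp add: comp_def)
  have cl: "asum f (map \<kappa> xs) (map (\<lambda>p. \<sigma> (fst p)) ps) \<in> carrier G"
    "asum f (map \<kappa> xs) (map h xs) \<in> carrier G" "asum f xs (map fst ps) \<in> carrier G"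
    using asum_map_closed[OF f kxs len] p \<sigma>_closed funcset_mem[OF h] asum_closed[OF f xsT as]
    by (auto simp: hs[symmetric])
  have cl': "T f xs \<in> carrier G" "T f (map \<kappa> xs) \<in> carrier G" "h (interp Q f xs) \<in> carrier G"
    "\<sigma> (T f xs) \<in> carrier G"
    using cocycle_closed[OF T f] xsT kxs fun_interp_closed[OF f xsT h] \<sigma>_closed by auto
  have "shift \<sigma> \<kappa> h (interp (sd T) f ps) = interp (sd T) f (map (shift \<sigma> \<kappa> h) ps) \<longleftrightarrow>
      \<sigma> (asum f xs (map fst ps) \<otimes> T f xs) \<otimes> h (interp Q f xs) =
        asum f (map \<kappa> xs) (map (\<lambda>p. \<sigma> (fst p) \<otimes> h (snd p)) ps) \<otimes> T f (map \<kappa> xs)"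
    unfolding sd_interp m xs[symmetric] using \<kappa>_interp[OF f xsT] by (simp add: shift_def)
  also have "\<dots> \<longleftrightarrow> asum f (map \<kappa> xs) (map (\<lambda>p. \<sigma> (fst p)) ps) \<otimes> (\<sigma> (T f xs) \<otimes> h (interp Q f xs)) =
      asum f (map \<kappa> xs) (map (\<lambda>p. \<sigma> (fst p)) ps) \<otimes> (asum f (map \<kappa> xs) (map h xs) \<otimes> T f (map \<kappa> xs))"
    unfolding s hs \<sigma>_add[OF cl(3) cl'(1)] \<sigma>s using cl cl' by (simp add: m_assoc)
  also have "\<dots> \<longleftrightarrow> \<sigma> (T f xs) \<otimes> h (interp Q f xs) = asum f (map \<kappa> xs) (map h xs) \<otimes> T f (map \<kappa> xs)"
    using cl cl' by simp
  finally show ?thesis .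
qed

lemma shift_alg_iso_iff:
  assumes T: "T \<in> Z" and h: "h \<in> carrier Q \<rightarrow> carrier G"
  shows "alg_iso \<tau> (sd T) (sd T) (shift \<sigma> \<kappa> h) \<longleftrightarrow> (\<forall>f\<in>symbols \<tau>. \<forall>xs\<in>tup f.
    \<sigma> (T f xs) \<otimes> h (interp Q f xs) = asum f (map \<kappa> xs) (map h xs) \<otimes> T f (map \<kappa> xs))"
    (is "_ \<longleftrightarrow> (\<forall>f\<in>_. \<forall>xs\<in>_. ?E f xs)")
proof
  assume iso: "alg_iso \<tau> (sd T) (sd T) (shift \<sigma> \<kappa> h)"
  show "\<forall>f\<in>symbols \<tau>. \<forall>xs\<in>tup f. ?E f xs"
  proof (intro ballI)
    fix f xs assume f: "f \<in> symbols \<tau>" and xs: "xs \<in> tup f"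
    \<comment> \<open>The condition sees only second coordinates, so any tuple lying over
      \<open>xs\<close> tests it; first coordinates are set to zero.\<close>
    let ?ps = "map (\<lambda>x. (\<one>, x)) xs"
    have ps: "?ps \<in> tuples (carrier G \<times> carrier Q) (arity \<tau> f)"
      by (rule map_tuples[OF _ xs]) auto
    have "xs = map snd ?ps" by (simp add: comp_def)
    from shift_hom_iff[OF T h f ps this] show "?E f xs"
      using iso f ps unfolding alg_iso_def sd_carrier by blast
  qed
next
  assume E: "\<forall>f\<in>symbols \<tau>. \<forall>xs\<in>tup f. ?E f xs"
  show "alg_iso \<tau> (sd T) (sd T) (shift \<sigma> \<kappa> h)"
    unfolding alg_iso_def sd_carrier
    using shift_bij[OF h] shift_hom_iff[OF T h _ _ refl] E tuples_snd by simp
qed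

section \<open>Twisting a cocycle by a pair, and the vanishing of the Wells map\<close>

abbreviation "\<kappa>\<^sub>i \<equiv> inv_into (carrier Q) \<kappa>"

lemma \<kappa>\<^sub>i_\<kappa>: "x \<in> carrier Q \<Longrightarrow> \<kappa>\<^sub>i (\<kappa> x) = x"
  using \<kappa> by (auto simp: alg_iso_def bij_betw_def)

lemma \<kappa>_\<kappa>\<^sub>i: "x \<in> carrier Q \<Longrightarrow> \<kappa> (\<kappa>\<^sub>i x) = x"
  using \<kappa> by (auto simp: alg_iso_def bij_betw_def f_inv_into_f)

lemma \<kappa>\<^sub>i_closed: "x \<in> carrier Q \<Longrightarrow> \<kappa>\<^sub>i x \<in> carrier Q"
  using \<kappa> by (auto simp: alg_iso_def bij_betw_def intro: inv_into_into)

lemma map_\<kappa>\<^sub>i: "xs \<in> tuples (carrier Q) n \<Longrightarrow> map \<kappa>\<^sub>i xs \<in> tuples (carrier Q) n"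
  by (rule map_tuples) (auto intro: \<kappa>\<^sub>i_closed)

lemma map_\<kappa>_\<kappa>\<^sub>i: "xs \<in> tuples (carrier Q) n \<Longrightarrow> map \<kappa> (map \<kappa>\<^sub>i xs) = xs"
  by (auto simp: tuples_def \<kappa>_\<kappa>\<^sub>i subset_iff intro!: map_idI)

lemma map_\<kappa>\<^sub>i_\<kappa>: "xs \<in> tuples (carrier Q) n \<Longrightarrow> map \<kappa>\<^sub>i (map \<kappa> xs) = xs"
  by (auto simp: tuples_def \<kappa>\<^sub>i_\<kappa> subset_iff intro!: map_idI)

lemma twisted_closed: "T \<in> Z \<Longrightarrow> twisted_cocycle \<tau> Q T (\<sigma>, \<kappa>) \<in> Z"
  unfolding twisted_cocycle_def case_prod_conv
  by (rule cocycleI) (auto intro!: \<sigma>_closed cocycle_closed map_\<kappa>\<^sub>i)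

lemma twisted_apply: "f \<in> symbols \<tau> \<Longrightarrow> xs \<in> tup f \<Longrightarrow>
    twisted_cocycle \<tau> Q T (\<sigma>, \<kappa>) f xs = \<sigma> (T f (map \<kappa>\<^sub>i xs))"
  by (simp add: twisted_cocycle_def)

text \<open>The map (a, x) to (\<sigma> a, \<kappa> x) is an isomorphism from the extension by T
  onto the extension by the twisted cocycle; the inverse of \<kappa> in the twist is what makes it
  one. Membership in the variety passes along it.\<close>

lemma twisted_compatible:
  assumes V: "variety \<tau> V" and T: "T \<in> compatible_cocycles \<tau> V G Q act"
  shows "twisted_cocycle \<tau> Q T (\<sigma>, \<kappa>) \<in> compatible_cocycles \<tau> V G Q act"
proof -
  have TZ: "T \<in> Z" and TV: "in_variety \<tau> V (sd T)" using T by (auto simp: compatible_cocycles_def)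
  have "alg_iso \<tau> (sd T) (sd (twisted_cocycle \<tau> Q T (\<sigma>, \<kappa>))) (map_prod \<sigma> \<kappa>)"
    unfolding alg_iso_def sd_carrier
  proof (intro conjI ballI)
    show "bij_betw (map_prod \<sigma> \<kappa>) (carrier G \<times> carrier Q) (carrier G \<times> carrier Q)"
      using \<sigma>_bij \<kappa> by (simp add: alg_iso_def bij_betw_map_prod)
    fix f ps assume f: "f \<in> symbols \<tau>" and ps: "ps \<in> tuples (carrier G \<times> carrier Q) (arity \<tau> f)"
    let ?xs = "map snd ps" and ?as = "map fst ps"
    have xs: "?xs \<in> tup f" and as: "?as \<in> tuples (carrier G) (arity \<tau> f)"
      by (rule tuples_snd[OF ps], rule tuples_fst[OF ps])
    have m: "map fst (map (map_prod \<sigma> \<kappa>) ps) = map \<sigma> ?as" "map snd (map (map_prod \<sigma> \<kappa>) ps) = map \<kappa> ?xs"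
      by auto
    show "map_prod \<sigma> \<kappa> (interp (sd T) f ps) =
        interp (sd (twisted_cocycle \<tau> Q T (\<sigma>, \<kappa>))) f (map (map_prod \<sigma> \<kappa>) ps)"
      unfolding sd_interp m twisted_apply[OF f map_\<kappa>[OF xs]] map_\<kappa>\<^sub>i_\<kappa>[OF xs]
      by (simp add: \<sigma>_add asum_closed f xs as cocycle_closed[OF TZ] asum_equivariant \<kappa>_interp del: map_map)
  qed
  then have "in_variety \<tau> V (sd (twisted_cocycle \<tau> Q T (\<sigma>, \<kappa>)))"
    by (rule alg_iso_in_variety[OF V TV sd_alg[OF twisted_closed[OF TZ]]])
  then show ?thesis using twisted_closed[OF TZ] by (simp add: compatible_cocycles_def)
qed

lemma diff_twisted_cohomologous_zero_iff:
  assumes T: "T \<in> Z"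
  shows "cohomologous \<tau> G Q act (cocycle_diff \<tau> G Q T (twisted_cocycle \<tau> Q T (\<sigma>, \<kappa>))) (cocycle_zero \<tau> G Q)
    \<longleftrightarrow> (\<exists>h\<in>carrier Q \<rightarrow> carrier G. alg_iso \<tau> (sd T) (sd T) (shift \<sigma> \<kappa> h))"
    (is "?L \<longleftrightarrow> ?R")
proof -
  \<comment> \<open>The coboundary is that of \<open>k y = - h (\<kappa>\<^sup>-\<^sup>1 y)\<close>.\<close>
  have key: "T f (map \<kappa> xs) \<otimes> inv (\<sigma> (T f xs)) = coboundary f (map \<kappa> xs) k \<longleftrightarrow>
      \<sigma> (T f xs) \<otimes> h (interp Q f xs) = asum f (map \<kappa> xs) (map h xs) \<otimes> T f (map \<kappa> xs)"
    if f: "f \<in> symbols \<tau>" and xs: "xs \<in> tup f" and h: "h \<in> carrier Q \<rightarrow> carrier G"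
      and hk: "\<And>x. x \<in> carrier Q \<Longrightarrow> k (\<kappa> x) = inv (h x)" for f xs h k
  proof -
    note kxs = map_\<kappa>[OF xs]
    have "map k (map \<kappa> xs) = map (\<lambda>x. inv (h x)) xs" using xs hk by (auto simp: tuples_def)
    moreover have "asum f (map \<kappa> xs) (map (\<lambda>x. inv (h x)) xs) = inv (asum f (map \<kappa> xs) (map h xs))"
      by (rule asum_inv[OF f kxs]) (use xs h in \<open>auto simp: tuples_def\<close>)
    moreover have "k (interp Q f (map \<kappa> xs)) = inv (h (interp Q f xs))"
      using hk[OF is_alg_interp[OF Q_alg f xs]] \<kappa>_interp[OF f xs] by simp
    ultimately have c: "coboundary f (map \<kappa> xs) k =
        inv (asum f (map \<kappa> xs) (map h xs)) \<otimes> inv (inv (h (interp Q f xs)))"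
      by (simp only: coboundary_def)
    \<comment> \<open>With the four values named, the coboundary equation p - q = -s + r and the
      isomorphism condition q + r = s + p differ only by moving terms across in an abelian
      group.\<close>
    define p q r s where "p = T f (map \<kappa> xs)" and "q = \<sigma> (T f xs)" and "r = h (interp Q f xs)"
      and "s = asum f (map \<kappa> xs) (map h xs)"
    have "s \<in> carrier G"
      unfolding s_def by (rule asum_map_closed[OF f kxs]) (use xs h in \<open>auto simp: tuples_def\<close>)
    moreover have "p \<in> carrier G" "q \<in> carrier G" "r \<in> carrier G"
      using cocycle_closed[OF T f] xs kxs \<sigma>_closed fun_interp_closed[OF f xs h]
      by (auto simp: p_def q_def r_def)
    ultimately have "p \<otimes> inv q = inv s \<otimes> r \<longleftrightarrow> q \<otimes> r = s \<otimes> p"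
      using inv_solve_left[of "p \<otimes> inv q" s r] inv_solve_right[of r "s \<otimes> p" q]
      by (auto simp: m_assoc m_comm[of r q])
    then show ?thesis unfolding c p_def q_def r_def s_def using fun_interp_closed[OF f xs h] by simp
  qed
  have zero: "?L \<longleftrightarrow> (\<exists>k\<in>carrier Q \<rightarrow> carrier G. \<forall>f\<in>symbols \<tau>. \<forall>ys\<in>tup f.
      T f ys \<otimes> inv (\<sigma> (T f (map \<kappa>\<^sub>i ys))) = coboundary f ys k)"
  proof -
    have "cocycle_diff \<tau> G Q T (twisted_cocycle \<tau> Q T (\<sigma>, \<kappa>)) f ys \<otimes> inv (cocycle_zero \<tau> G Q f ys) =
        T f ys \<otimes> inv (\<sigma> (T f (map \<kappa>\<^sub>i ys)))" if "f \<in> symbols \<tau>" "ys \<in> tup f" for f ys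
      using that by (simp add: twisted_apply \<sigma>_closed cocycle_closed[OF T] map_\<kappa>\<^sub>i)
    then show ?thesis by (simp add: cohomologous_iff)
  qed
  show ?thesis
  proof
    assume ?L
    then obtain k where k: "k \<in> carrier Q \<rightarrow> carrier G"
      and eq: "\<And>f ys. f \<in> symbols \<tau> \<Longrightarrow> ys \<in> tup f \<Longrightarrow>
        T f ys \<otimes> inv (\<sigma> (T f (map \<kappa>\<^sub>i ys))) = coboundary f ys k" unfolding zero by blast
    define h where "h x = inv (k (\<kappa> x))" for x
    have kc: "k (\<kappa> x) \<in> carrier G" if "x \<in> carrier Q" for x using k \<kappa>_closed[OF that] by auto
    then have h: "h \<in> carrier Q \<rightarrow> carrier G" by (auto simp: h_def)
    have hk: "k (\<kappa> x) = inv (h x)" if "x \<in> carrier Q" for x using kc[OF that] by (simp add: h_def)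
    have "alg_iso \<tau> (sd T) (sd T) (shift \<sigma> \<kappa> h)"
      unfolding shift_alg_iso_iff[OF T h]
    proof (intro ballI)
      fix f xs assume f: "f \<in> symbols \<tau>" and xs: "xs \<in> tup f"
      show "\<sigma> (T f xs) \<otimes> h (interp Q f xs) = asum f (map \<kappa> xs) (map h xs) \<otimes> T f (map \<kappa> xs)"
        using key[OF f xs h hk] eq[OF f map_\<kappa>[OF xs]] map_\<kappa>\<^sub>i_\<kappa>[OF xs] by simp
    qed
    with h show ?R by blast
  next
    assume ?R
    then obtain h where h: "h \<in> carrier Q \<rightarrow> carrier G" and iso: "alg_iso \<tau> (sd T) (sd T) (shift \<sigma> \<kappa> h)"
      by blast
    define k where "k y = inv (h (\<kappa>\<^sub>i y))" for y
    have "h (\<kappa>\<^sub>i y) \<in> carrier G" if "y \<in> carrier Q" for y using h \<kappa>\<^sub>i_closed[OF that] by auto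
    then have k: "k \<in> carrier Q \<rightarrow> carrier G" by (auto simp: k_def)
    have hk: "k (\<kappa> x) = inv (h x)" if "x \<in> carrier Q" for x by (simp add: k_def \<kappa>\<^sub>i_\<kappa> that)
    have "T f ys \<otimes> inv (\<sigma> (T f (map \<kappa>\<^sub>i ys))) = coboundary f ys k"
      if f: "f \<in> symbols \<tau>" and ys: "ys \<in> tup f" for f ys
      using key[OF f map_\<kappa>\<^sub>i[OF ys] h hk] iso f map_\<kappa>\<^sub>i[OF ys] map_\<kappa>_\<kappa>\<^sub>i[OF ys]
      unfolding shift_alg_iso_iff[OF T h] by simp
    with k show ?L unfolding zero by blast
  qed
qed

lemma wells_map_closed:
  assumes V: "variety \<tau> V" and T: "T \<in> compatible_cocycles \<tau> V G Q act"
  shows "wells_map \<tau> V G Q act T (\<sigma>, \<kappa>) \<in> carrier (H2 \<tau> V G Q act)"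
  using compatible_diff[OF V T twisted_compatible[OF V T]]
  by (simp add: wells_map_def H2_def quotientI)

lemma wells_map_eq_one_iff:
  assumes V: "variety \<tau> V" and T: "T \<in> compatible_cocycles \<tau> V G Q act"
  shows "wells_map \<tau> V G Q act T (\<sigma>, \<kappa>) = \<one>\<^bsub>H2 \<tau> V G Q act\<^esub> \<longleftrightarrow>
    (\<exists>h\<in>carrier Q \<rightarrow> carrier G. alg_iso \<tau> (sd T) (sd T) (shift \<sigma> \<kappa> h))"
proof -
  let ?D = "cocycle_diff \<tau> G Q T (twisted_cocycle \<tau> Q T (\<sigma>, \<kappa>))"
  have D: "?D \<in> compatible_cocycles \<tau> V G Q act"
    by (rule compatible_diff[OF V T twisted_compatible[OF V T]])
  have "wells_map \<tau> V G Q act T (\<sigma>, \<kappa>) = \<one>\<^bsub>H2 \<tau> V G Q act\<^esub> \<longleftrightarrow>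
      (?D, cocycle_zero \<tau> G Q) \<in> cohomology_rel \<tau> V G Q act"
    using eq_equiv_class_iff[OF equiv_cohomology_rel D compatible_zero[OF V T]]
    by (simp add: wells_map_def H2_def)
  also have "\<dots> \<longleftrightarrow> cohomologous \<tau> G Q act ?D (cocycle_zero \<tau> G Q)"
    using D compatible_zero[OF V T] by (simp add: cohomology_rel_def)
  finally show ?thesis
    unfolding diff_twisted_cohomologous_zero_iff[OF compatible_cocycle[OF V T]] .
qed

end

end

section \<open>Term functions and the term condition\<close>

text \<open>The difference term is a term rather than a basic operation, so composing it with term
  functions requires substitution.\<close>

fun subst :: "('v \<Rightarrow> ('f, 'w) trm) \<Rightarrow> ('f, 'v) trm \<Rightarrow> ('f, 'w) trm" where
  "subst s (Var v) = s v"
| "subst s (App f ts) = App f (map (subst s) ts)"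

lemma eval_subst: "eval A \<rho> (subst s t) = eval A (\<lambda>v. eval A \<rho> (s v)) t"
  by (induction t) (auto simp: comp_def cong: map_cong)

lemma wf_subst: "(\<And>v. wf_trm \<tau> (s v)) \<Longrightarrow> wf_trm \<tau> t \<Longrightarrow> wf_trm \<tau> (subst s t)"
  by (induction t) auto

definition term_fun ::
  "'f signature \<Rightarrow> ('f, 'a) alg \<Rightarrow> ((nat \<Rightarrow> 'a) \<Rightarrow> (nat \<Rightarrow> 'a) \<Rightarrow> 'a) \<Rightarrow> bool" where
  "term_fun \<tau> A F \<longleftrightarrow> (\<exists>t. wf_trm \<tau> t \<and> (\<forall>a c. F a c = eval A (case_sum a c) t))"

lemma term_fun_left: "term_fun \<tau> A (\<lambda>a c. a i)"
  unfolding term_fun_def by (rule exI[of _ "Var (Inl i)"]) simp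

lemma term_fun_right: "term_fun \<tau> A (\<lambda>a c. c i)"
  unfolding term_fun_def by (rule exI[of _ "Var (Inr i)"]) simp

lemma term_fun_interp:
  assumes f: "f \<in> symbols \<tau>" and F: "\<And>j. j < arity \<tau> f \<Longrightarrow> term_fun \<tau> A (F j)"
  shows "term_fun \<tau> A (\<lambda>a c. interp A f (map (\<lambda>j. F j a c) [0..<arity \<tau> f]))"
proof -
  obtain t where t: "\<And>j. j < arity \<tau> f \<Longrightarrow> wf_trm \<tau> (t j)"
    "\<And>j a c. j < arity \<tau> f \<Longrightarrow> F j a c = eval A (case_sum a c) (t j)"
    using F unfolding term_fun_def by metis
  have "map (\<lambda>j. F j a c) [0..<arity \<tau> f] = map (eval A (case_sum a c)) (map t [0..<arity \<tau> f])" for a c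
    using t(2) by simp
  then show ?thesis
    unfolding term_fun_def using f t(1)
    by (intro exI[of _ "App f (map t [0..<arity \<tau> f])"]) (simp del: map_map)
qed

lemma term_fun_tern:
  assumes m: "wf_trm \<tau> m" and "term_fun \<tau> A F" "term_fun \<tau> A G" "term_fun \<tau> A H"
  shows "term_fun \<tau> A (\<lambda>a c. tern A m (F a c) (G a c) (H a c))"
proof -
  obtain r s t where wf: "wf_trm \<tau> r" "wf_trm \<tau> s" "wf_trm \<tau> t"
    and eq: "\<And>a c. F a c = eval A (case_sum a c) r" "\<And>a c. G a c = eval A (case_sum a c) s"
      "\<And>a c. H a c = eval A (case_sum a c) t"
    using assms(2-) unfolding term_fun_def by metis
  let ?q = "\<lambda>i :: nat. if i = 0 then r else if i = 1 then s else t"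
  have "(\<lambda>i. eval A \<rho> (?q i)) = (\<lambda>i. if i = 0 then eval A \<rho> r else if i = 1 then eval A \<rho> s else eval A \<rho> t)"
    for \<rho> by auto
  then show ?thesis
    unfolding term_fun_def tern_def eq
    by (intro exI[of _ "subst ?q m"] conjI wf_subst m) (auto simp: wf eval_subst)
qed

lemma congruence_eval:
  assumes \<theta>: "congruence \<tau> A \<theta>" and \<rho>: "\<And>v. (\<rho> v, \<rho>' v) \<in> \<theta>" and t: "wf_trm \<tau> t"
  shows "(eval A \<rho> t, eval A \<rho>' t) \<in> \<theta>"
  using t
proof (induction t)
  case (App f ts)
  have sub: "\<theta> \<subseteq> carrier A \<times> carrier A" using \<theta> by (simp add: congruence_def equiv_def)
  have "list_all2 (\<lambda>x y. (x, y) \<in> \<theta>) (map (eval A \<rho>) ts) (map (eval A \<rho>') ts)"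
    using App by (auto simp: list_all2_conv_all_nth)
  moreover have "map (eval A \<rho>) ts \<in> tuples (carrier A) (arity \<tau> f)"
      "map (eval A \<rho>') ts \<in> tuples (carrier A) (arity \<tau> f)"
    using App sub by (auto simp: tuples_def)
  ultimately show ?case using \<theta> App.prems by (simp add: congruence_def)
qed (simp add: \<rho>)

text \<open>The commutator is an intersection of congruences \<delta>, here equal to equality. A
  first-row equality puts the pair into every such \<delta>, centrality modulo each \<delta> moves
  it to the second row, and intersecting again gives equality.\<close>

lemma abelian_term_condition:
  assumes ab: "abelian_congruence \<tau> A \<alpha>" and F: "term_fun \<tau> A F"
    and a: "\<And>i. (a i, a' i) \<in> \<alpha>" and c: "\<And>i. (c i, c' i) \<in> \<alpha>" and eq: "F a c = F a c'"
  shows "F a' c = F a' c'"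
proof -
  let ?D = "{\<delta>. congruence \<tau> A \<delta> \<and> centralizes \<tau> A \<alpha> \<alpha> \<delta>}"
  obtain t where t: "wf_trm \<tau> t" "\<And>a c. F a c = eval A (case_sum a c) t"
    using F by (auto simp: term_fun_def)
  have \<alpha>: "congruence \<tau> A \<alpha>" and id: "\<Inter>?D = Id_on (carrier A)"
    using ab by (auto simp: abelian_congruence_def commutator_def)
  have sub: "\<alpha> \<subseteq> carrier A \<times> carrier A" and sym: "sym \<alpha>" and trans: "trans \<alpha>"
    using \<alpha> by (auto simp: congruence_def equiv_def)
  have aa: "(a i, a i) \<in> \<alpha>" "(c i, c i) \<in> \<alpha>" for i
    using a c sym trans by (meson symD transD)+
  \<comment> \<open>This serves to place F a c in the carrier, since
    \<open>Id_on (carrier A)\<close> contains only pairs from there.\<close>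
  have "(F a c, F a c) \<in> \<alpha>"
    unfolding t(2) by (rule congruence_eval[OF \<alpha> _ t(1)]) (auto split: sum.split simp: aa)
  then have "(F a c, F a c') \<in> Id_on (carrier A)" using sub eq by auto
  then have row: "(F a c, F a c') \<in> \<Inter>?D" by (simp only: id)
  have "(F a' c, F a' c') \<in> \<Inter>?D"
  proof (rule InterI)
    fix \<delta> assume \<delta>: "\<delta> \<in> ?D"
    then have "centralizes \<tau> A \<alpha> \<alpha> \<delta>" by simp
    then show "(F a' c, F a' c') \<in> \<delta>"
      using InterD[OF row \<delta>] a c t(1) unfolding t(2) centralizes_def by metis
  qed
  then have "(F a' c, F a' c') \<in> Id_on (carrier A)" by (simp only: id)
  then show ?thesis by auto
qed

section \<open>The zero class of an abelian congruence\<close>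

locale abelian_difference_algebra =
  fixes \<tau> :: "'f signature" and V :: "(('f, nat) trm \<times> ('f, nat) trm) set"
    and m :: "('f, nat) trm" and A :: "('f, 'a) alg" and \<alpha> :: "('a \<times> 'a) set"
    and u :: 'a and l :: "'a set \<Rightarrow> 'a"
  assumes V: "variety \<tau> V" and diff: "difference_term \<tau> V m" and wassoc: "weakly_associative \<tau> V m"
    and AV: "in_variety \<tau> V A" and idem: "idempotent_elt \<tau> A u"
    and ab: "abelian_congruence \<tau> A \<alpha>" and sec: "is_section A \<alpha> u l"
begin

abbreviation "M \<equiv> tern A m"
abbreviation "I \<equiv> \<alpha> `` {u}"
abbreviation "Q \<equiv> quotient_alg A \<alpha>"
abbreviation "G \<equiv> class_group A m \<alpha> u"
abbreviation "\<pi> x \<equiv> \<alpha> `` {x}"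

lemma A_alg: "is_alg \<tau> A"
  using AV by (simp add: in_variety_def)

lemma wf_m: "wf_trm \<tau> m" and m: "ternary_term \<tau> m"
  using diff by (auto simp: difference_term_def ternary_term_def)

lemma cong: "congruence \<tau> A \<alpha>"
  using ab by (simp add: abelian_congruence_def)

lemma equiv: "equiv (carrier A) \<alpha>"
  using cong by (simp add: congruence_def)

lemma rel_closed: "(x, y) \<in> \<alpha> \<Longrightarrow> x \<in> carrier A" "(x, y) \<in> \<alpha> \<Longrightarrow> y \<in> carrier A"
  using equiv by (auto simp: equiv_def)

lemma rel_refl: "x \<in> carrier A \<Longrightarrow> (x, x) \<in> \<alpha>"
  using equiv by (auto simp: equiv_def refl_on_def)

lemma rel_sym: "(x, y) \<in> \<alpha> \<Longrightarrow> (y, x) \<in> \<alpha>"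
  using equiv by (meson equivE symD)

lemma u_closed: "u \<in> carrier A"
  using idem by (simp add: idempotent_elt_def)

lemma u_I: "u \<in> I"
  using rel_refl[OF u_closed] by simp

lemma I_closed: "x \<in> I \<Longrightarrow> x \<in> carrier A"
  using rel_closed by auto

lemma M_closed: "x \<in> carrier A \<Longrightarrow> y \<in> carrier A \<Longrightarrow> z \<in> carrier A \<Longrightarrow> M x y z \<in> carrier A"
  unfolding tern_def by (rule eval_closed[OF is_alg_interp[OF A_alg] _ wf_m]) auto

lemma M_rel: "(x, x') \<in> \<alpha> \<Longrightarrow> (y, y') \<in> \<alpha> \<Longrightarrow> (z, z') \<in> \<alpha> \<Longrightarrow> (M x y z, M x' y' z') \<in> \<alpha>"
  unfolding tern_def by (rule congruence_eval[OF cong _ wf_m]) auto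

text \<open>The difference term condition speaks of related pairs only; applied to the full
  congruence it covers all pairs of elements.\<close>

lemma M_left:
  assumes "x \<in> carrier A" "y \<in> carrier A"
  shows "M x x y = y"
proof -
  have "congruence \<tau> A (carrier A \<times> carrier A)"
    unfolding congruence_def using is_alg_interp[OF A_alg]
    by (auto intro!: equivI refl_onI symI transI)
  then show ?thesis
    using difference_term_every_type[OF V diff, where 'b = 'a] AV assms
    unfolding difference_term_on_def by blast
qed

text \<open>The condition gives m(x,y,y) only modulo the commutator of the congruence relating x and
  y. For \<alpha> this commutator is trivial, so the equation is exact, but it is tied to
  \<alpha>-related elements.\<close>

lemma M_right:
  assumes "(x, y) \<in> \<alpha>"
  shows "M x y y = x"
proof -
  have "(M x y y, x) \<in> commutator \<tau> A \<alpha> \<alpha>"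
    using difference_term_every_type[OF V diff, where 'b = 'a] AV cong assms
    unfolding difference_term_on_def by blast
  then show ?thesis using ab by (auto simp: abelian_congruence_def)
qed

lemma M_weak_assoc:
  "x \<in> carrier A \<Longrightarrow> y \<in> carrier A \<Longrightarrow> z \<in> carrier A \<Longrightarrow> M (M x y z) z y = x"
  using weakly_associative_every_type[OF V wassoc, where 'b = 'a] AV
  unfolding weakly_associative_on_def by metis

text \<open>The affine nature of \<open>\<alpha>\<close>: the function \<open>m(F, H, a\<^sub>0)\<close> is constant on the first row of the
  square, hence on the second row by the term condition, and \<open>m(F, H, w) = w\<close> forces \<open>F = H\<close> by
  weak associativity.\<close>

lemma term_funs_agree:
  assumes F: "term_fun \<tau> A F" and H: "term_fun \<tau> A H"
    and a: "\<And>i. (a i, a' i) \<in> \<alpha>" and c: "\<And>i. (c i, c' i) \<in> \<alpha>"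
    and eq: "F a c = H a c" "F a c' = H a c'" "F a' c = H a' c"
  shows "F a' c' = H a' c'"
proof -
  have cl: "K b d \<in> carrier A" if K: "term_fun \<tau> A K" and b: "\<And>i. b i \<in> carrier A"
    and d: "\<And>i. d i \<in> carrier A" for K b d
  proof -
    obtain t where "wf_trm \<tau> t" "K b d = eval A (case_sum b d) t" using K by (auto simp: term_fun_def)
    moreover have "range (case_sum b d) \<subseteq> carrier A" using b d by (auto split: sum.splits)
    ultimately show ?thesis using eval_closed[OF is_alg_interp[OF A_alg]] by simp
  qed
  let ?D = "\<lambda>a c. M (F a c) (H a c) (a 0)"
  have D: "term_fun \<tau> A ?D" by (intro term_fun_tern wf_m F H term_fun_left)
  note A = rel_closed[OF a] rel_closed[OF c]
  have diag: "?D b d = b 0" if "F b d = H b d" "\<And>i. b i \<in> carrier A" "\<And>i. d i \<in> carrier A" for b d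
    using that cl[OF H] by (simp add: M_left)
  have "?D a' c = ?D a' c'"
    by (rule abelian_term_condition[OF ab D a c]) (simp only: diag[OF eq(1) A(1,3)] diag[OF eq(2) A(1,4)])
  then have "M (F a' c') (H a' c') (a' 0) = a' 0" using diag[OF eq(3)] A by simp
  moreover have FA: "F a' c' \<in> carrier A" "H a' c' \<in> carrier A" by (rule cl[OF F A(2,4)], rule cl[OF H A(2,4)])
  ultimately show ?thesis using M_weak_assoc[OF FA A(2)[of 0]] A by (simp add: M_left)
qed

lemma M_I: "x \<in> I \<Longrightarrow> y \<in> I \<Longrightarrow> z \<in> I \<Longrightarrow> M x y z \<in> I"
  using M_rel[of u x u y u z] u_closed by (simp add: M_left)

lemmas term_fun_intros = term_fun_tern[OF wf_m] term_fun_left term_fun_right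

text \<open>x is moved away from u in the first block and y in the second. At the three corners
  where x or y is still u, both sides reduce by \<open>M_left\<close> and \<open>M_right\<close>.
  The middle argument u is entry 1 of the first block, with the same value in both rows.\<close>

lemma M_comm:
  assumes x: "x \<in> I" and y: "y \<in> I"
  shows "M x u y = M y u x"
proof -
  let ?a = "\<lambda>i. if i = (0::nat) then x else u" and ?c = "\<lambda>i::nat. y"
  have "M (?a 0) (?a 1) (?c 0) = M (?c 0) (?a 1) (?a 0)"
    by (rule term_funs_agree[where a = "\<lambda>_. u" and c = "\<lambda>_. u" and a' = ?a and c' = ?c and
          F = "\<lambda>a c. M (a 0) (a 1) (c 0)" and H = "\<lambda>a c. M (c 0) (a 1) (a 0)"])
      (use x y u_closed I_closed rel_refl[OF u_closed] in
        \<open>auto intro!: term_fun_intros simp: M_left M_right rel_sym\<close>)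
  then show ?thesis by simp
qed

text \<open>As for commutativity, with z held fixed in the second block: when x or y equals u, both
  bracketings collapse to a sum of at most two terms.\<close>

lemma M_assoc:
  assumes x: "x \<in> I" and y: "y \<in> I" and z: "z \<in> I"
  shows "M (M x u y) u z = M x u (M y u z)"
proof -
  let ?a = "\<lambda>i. if i = (0::nat) then x else u" and ?c = "\<lambda>i. if i = (0::nat) then y else z"
    and ?c' = "\<lambda>i. if i = (0::nat) then u else z"
  have "M (M (?a 0) (?a 1) (?c 0)) (?a 1) (?c 1) = M (?a 0) (?a 1) (M (?c 0) (?a 1) (?c 1))"
    by (rule term_funs_agree[where a = "\<lambda>_. u" and c = ?c' and a' = ?a and c' = ?c and
          F = "\<lambda>a c. M (M (a 0) (a 1) (c 0)) (a 1) (c 1)" and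
          H = "\<lambda>a c. M (a 0) (a 1) (M (c 0) (a 1) (c 1))"])
      (use x y z I_closed[OF x] I_closed[OF y] I_closed[OF z] u_closed rel_refl[OF u_closed]
          rel_refl[OF I_closed[OF z]] in
        \<open>auto intro!: term_fun_intros simp: M_left M_right[OF rel_sym] M_closed\<close>)
  then show ?thesis by simp
qed

text \<open>This lets a translation by b pass through the difference to a base point z, also outside
  the class of u. The square starts at b = u and y = z; for y = z the left side is b by weak
  associativity and the right side by \<open>M_right\<close>.\<close>

lemma M_shift:
  assumes b: "b \<in> I" and yz: "(y, z) \<in> \<alpha>"
  shows "M (M b u y) z u = M b u (M y z u)"
proof -
  let ?a = "\<lambda>i. if i = (0::nat) then b else u" and ?c = "\<lambda>i. if i = (0::nat) then y else z"
  note cl = I_closed[OF b] u_closed rel_closed[OF yz]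
  have "M (M (?a 0) (?a 1) (?c 0)) (?c 1) (?a 1) = M (?a 0) (?a 1) (M (?c 0) (?c 1) (?a 1))"
    by (rule term_funs_agree[where a = "\<lambda>_. u" and c = "\<lambda>_. z" and a' = ?a and c' = ?c and
          F = "\<lambda>a c. M (M (a 0) (a 1) (c 0)) (c 1) (a 1)" and
          H = "\<lambda>a c. M (a 0) (a 1) (M (c 0) (c 1) (a 1))"])
      (use b yz cl rel_refl in
        \<open>auto intro!: term_fun_intros simp: M_left M_right M_weak_assoc rel_sym M_closed\<close>)
  then show ?thesis by simp
qed

lemma G_simps [simp]: "carrier G = I" "x \<otimes>\<^bsub>G\<^esub> y = M x u y" "\<one>\<^bsub>G\<^esub> = u"
  by (auto simp: class_group_def)

lemma G_comm_group: "comm_group G"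
proof (rule comm_groupI)
  fix x assume x: "x \<in> carrier G"
  \<comment> \<open>The inverse of x is m(u,x,u): weak associativity for the triple u, x, u states
    exactly that their sum is u.\<close>
  have "M u x u \<otimes>\<^bsub>G\<^esub> x = \<one>\<^bsub>G\<^esub>" using x u_closed by (simp add: M_weak_assoc I_closed)
  moreover have "M u x u \<in> carrier G" using x u_I M_I by simp
  ultimately show "\<exists>y\<in>carrier G. y \<otimes>\<^bsub>G\<^esub> x = \<one>\<^bsub>G\<^esub>" by blast
  show "\<one>\<^bsub>G\<^esub> \<otimes>\<^bsub>G\<^esub> x = x" using x u_closed by (simp add: M_left I_closed)
qed (use u_I M_I M_assoc M_comm in auto)

text \<open>The class of u determines all of \<alpha> through differences. Backwards, replacing
  m(x,y,u) by the related u turns m(m(x,y,u),u,y), which is x, into m(u,u,y), which is y.\<close>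

lemma rel_iff_M:
  assumes "x \<in> carrier A" "y \<in> carrier A"
  shows "(x, y) \<in> \<alpha> \<longleftrightarrow> M x y u \<in> I"
proof
  assume "(x, y) \<in> \<alpha>"
  then have "(M y y u, M x y u) \<in> \<alpha>" by (intro M_rel) (auto intro: rel_sym rel_refl assms u_closed)
  then show "M x y u \<in> I" using assms u_closed by (simp add: M_left)
next
  assume "M x y u \<in> I"
  then have "(M (M x y u) u y, M u u y) \<in> \<alpha>"
    by (intro M_rel) (auto intro: rel_sym rel_refl assms u_closed)
  then show "(x, y) \<in> \<alpha>" using assms u_closed by (simp add: M_weak_assoc M_left)
qed

section \<open>The action on the zero class\<close>

lemma interp_rel:
  assumes "f \<in> symbols \<tau>" "length xs = arity \<tau> f" "length ys = arity \<tau> f"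
    and "\<And>j. j < arity \<tau> f \<Longrightarrow> (xs ! j, ys ! j) \<in> \<alpha>"
  shows "(interp A f xs, interp A f ys) \<in> \<alpha>"
proof -
  have "xs \<in> tuples (carrier A) (arity \<tau> f)" "ys \<in> tuples (carrier A) (arity \<tau> f)"
    using assms rel_closed by (fastforce simp: tuples_def in_set_conv_nth)+
  moreover have "list_all2 (\<lambda>x y. (x, y) \<in> \<alpha>) xs ys"
    using assms by (simp add: list_all2_conv_all_nth)
  ultimately show ?thesis using cong assms(1) by (simp add: congruence_def)
qed

text \<open>The action at arbitrary base points of A instead of section values. An automorphism
  sends l(x) to a point that need not be a section value, so the action has to be defined there
  before it can be compared.\<close>

definition act_at :: "'f \<Rightarrow> nat \<Rightarrow> 'a list \<Rightarrow> 'a \<Rightarrow> 'a" where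
  "act_at f i ys b = M (interp A f (ys[i := M b u (ys ! i)])) (interp A f ys) u"

lemma action_eq_act_at:
  "i < length xs \<Longrightarrow> action A m u l f i xs as = act_at f i (map l xs) (as ! i)"
  by (simp add: action_def act_at_def)

context
  fixes f i
  assumes f: "f \<in> symbols \<tau>" and i: "i < arity \<tau> f"
begin

lemma act_at_u:
  assumes ys: "ys \<in> tuples (carrier A) (arity \<tau> f)"
  shows "act_at f i ys u = u"
  using tuples_nth[OF ys i] is_alg_interp[OF A_alg f ys] u_closed by (simp add: act_at_def M_left)

lemma act_at_closed:
  assumes ys: "ys \<in> tuples (carrier A) (arity \<tau> f)" and b: "b \<in> I"
  shows "act_at f i ys b \<in> I"
proof -
  have "(M u u (ys ! i), M b u (ys ! i)) \<in> \<alpha>"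
    using b tuples_nth[OF ys i] by (intro M_rel) (auto intro: rel_refl u_closed)
  then have "(ys ! i, M b u (ys ! i)) \<in> \<alpha>" using tuples_nth[OF ys i] u_closed by (simp add: M_left)
  then have "(interp A f (ys[i := M b u (ys ! i)]), interp A f ys) \<in> \<alpha>"
    using i by (intro interp_rel[OF f])
      (auto simp: nth_list_update length_tuples[OF ys] rel_sym rel_refl tuples_nth[OF ys])
  then show ?thesis
    unfolding act_at_def using rel_iff_M rel_closed by blast
qed

text \<open>A list update is not visibly a term function. Over the index list
  \<open>[0..<arity \<tau> f]\<close> every argument becomes a function of j, which is the shape
  \<open>term_fun_interp\<close> builds.\<close>

lemma act_at_map: "act_at f i (map y [0..<arity \<tau> f]) b =
    M (interp A f (map (\<lambda>j. if j = i then M b u (y j) else y j) [0..<arity \<tau> f]))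
      (interp A f (map y [0..<arity \<tau> f])) u"
proof -
  have "(map y [0..<arity \<tau> f])[i := M b u (map y [0..<arity \<tau> f] ! i)] =
      map (\<lambda>j. if j = i then M b u (y j) else y j) [0..<arity \<tau> f]"
    using i by (auto simp: list_eq_iff_nth_eq nth_list_update)
  then show ?thesis by (simp add: act_at_def)
qed

lemma tuples_as_map:
  assumes ys: "ys \<in> tuples (carrier A) (arity \<tau> f)"
  obtains y where "ys = map y [0..<arity \<tau> f]" "\<And>j. y j \<in> carrier A"
proof
  \<comment> \<open>Blocks of variables are infinite, so entries beyond the arity also need values
    in the carrier; u is the default.\<close>
  let ?y = "\<lambda>j. if j < arity \<tau> f then ys ! j else u"
  show "ys = map ?y [0..<arity \<tau> f]" using ys by (auto simp: tuples_def list_eq_iff_nth_eq)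
  show "?y j \<in> carrier A" for j using tuples_nth[OF ys] u_closed by auto
qed

text \<open>The test \<open>j = i\<close> stands outside the abstractions, so that for each \<open>j\<close> a single term is
  chosen.\<close>

lemma term_fun_act:
  assumes y: "\<And>j. term_fun \<tau> A (y j)" and "term_fun \<tau> A b" "term_fun \<tau> A z"
  shows "term_fun \<tau> A (\<lambda>a c. M (interp A f (map (\<lambda>j. (if j = i then \<lambda>a c. M (b a c) (z a c) (y j a c) else y j) a c)
      [0..<arity \<tau> f])) (interp A f (map (\<lambda>j. y j a c) [0..<arity \<tau> f])) (z a c))"
  by (intro term_fun_tern wf_m term_fun_interp f assms) (auto intro!: term_fun_tern wf_m assms)

lemma act_at_eq:
  "(\<And>j. y j a c = y' j) \<Longrightarrow> z a c = u \<Longrightarrow>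
    M (interp A f (map (\<lambda>j. (if j = i then \<lambda>a c. M (b a c) (z a c) (y j a c) else y j) a c)
      [0..<arity \<tau> f])) (interp A f (map (\<lambda>j. y j a c) [0..<arity \<tau> f])) (z a c) =
    act_at f i (map y' [0..<arity \<tau> f]) (b a c)"
  unfolding act_at_map by (simp add: if_distribR cong: if_cong)

text \<open>b varies in the first block and b' in the second, from u in both cases. The base points
  occupy the second block from index 1 on and stay fixed. Wherever b or b' is u, the action
  contributes u by \<open>act_at_u\<close> and both sides agree.\<close>

lemma act_at_add:
  assumes ys: "ys \<in> tuples (carrier A) (arity \<tau> f)" and b: "b \<in> I" and b': "b' \<in> I"
  shows "act_at f i ys (M b u b') = M (act_at f i ys b) u (act_at f i ys b')"
proof -
  obtain y where y: "ys = map y [0..<arity \<tau> f]" "\<And>j. y j \<in> carrier A"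
    by (rule tuples_as_map[OF ys]) (rule that)
  let ?P = "\<lambda>b a c. M (interp A f (map (\<lambda>j. (if j = i then \<lambda>a c. M (b a c) (a 1) (c (Suc j)) else (\<lambda>a c. c (Suc j))) a c)
      [0..<arity \<tau> f])) (interp A f (map (\<lambda>j. c (Suc j)) [0..<arity \<tau> f])) (a 1)"
  let ?F = "\<lambda>a c. ?P (\<lambda>a c. M (a 0) (a 1) (c 0)) a c"
  let ?H = "\<lambda>a c. M (?P (\<lambda>a c. a 0) a c) (a 1) (?P (\<lambda>a c. c 0) a c)"
  define a c where "a x = (\<lambda>k. if k = (0::nat) then x else u)"
    and "c x = (\<lambda>k. if k = (0::nat) then x else y (k - 1))" for x
  have P: "?P d (a x) (c x') = act_at f i ys (d (a x) (c x'))" for d x x'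
    unfolding y(1) by (rule act_at_eq) (auto simp: a_def c_def)
  have F: "?F (a x) (c x') = act_at f i ys (M x u x')" and
    H: "?H (a x) (c x') = M (act_at f i ys x) u (act_at f i ys x')" for x x'
    unfolding P by (simp_all add: a_def c_def)
  have cl: "act_at f i ys x \<in> carrier A" "M (act_at f i ys x) u u = act_at f i ys x" if "x \<in> I" for x
    using act_at_closed[OF ys that] I_closed by (auto intro: M_right rel_sym)
  have "?F (a b) (c b') = ?H (a b) (c b')"
  proof (rule term_funs_agree[where F = ?F and H = ?H and a = "a u" and c = "c u"])
    show "term_fun \<tau> A ?F" by (rule term_fun_act) (auto intro!: term_fun_intros)
    show "term_fun \<tau> A ?H"
      by (rule term_fun_tern[OF wf_m]) (rule term_fun_act term_fun_left term_fun_right)+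
    show "(a u k, a b k) \<in> \<alpha>" "(c u k, c b' k) \<in> \<alpha>" for k
      using b b' y(2) rel_refl u_closed by (auto simp: a_def c_def)
  qed (unfold F H, use b b' cl u_I u_closed I_closed in
    \<open>auto simp: M_left M_right act_at_u[OF ys] rel_sym\<close>)
  then show ?thesis unfolding F H .
qed

text \<open>One function reads its base points from the second block, which moves from
  \<open>ys\<close> to \<open>zs\<close>; the other has them frozen at \<open>ys\<close>, stored in
  the first block from index 2 on, after b and u. At b = u both give u, and at \<open>ys\<close>
  they coincide, so they also agree at the corner given by b and \<open>zs\<close>.\<close>

lemma act_at_rel:
  assumes ys: "ys \<in> tuples (carrier A) (arity \<tau> f)" and zs: "zs \<in> tuples (carrier A) (arity \<tau> f)"
    and rel: "\<And>j. j < arity \<tau> f \<Longrightarrow> (ys ! j, zs ! j) \<in> \<alpha>" and b: "b \<in> I"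
  shows "act_at f i ys b = act_at f i zs b"
proof -
  let ?y = "\<lambda>j. if j < arity \<tau> f then ys ! j else u" and ?z = "\<lambda>j. if j < arity \<tau> f then zs ! j else u"
  have yz: "ys = map ?y [0..<arity \<tau> f]" "zs = map ?z [0..<arity \<tau> f]"
    using ys zs by (auto simp: tuples_def list_eq_iff_nth_eq)
  have r: "(?y j, ?z j) \<in> \<alpha>" "?y j \<in> carrier A" for j
    using rel rel_refl u_closed tuples_nth[OF ys] by auto
  let ?P = "\<lambda>y a c. M (interp A f (map (\<lambda>j. (if j = i then \<lambda>a c. M (a 0) (a 1) (y j a c) else y j) a c)
      [0..<arity \<tau> f])) (interp A f (map (\<lambda>j. y j a c) [0..<arity \<tau> f])) (a 1)"
  let ?F = "?P (\<lambda>j a c. c j)" and ?H = "?P (\<lambda>j a c. a (j + 2))"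
  define a where "a x = (\<lambda>k. if k = (0::nat) then x else if k = 1 then u else ?y (k - 2))" for x
  have a: "a x 0 = x" "a x 1 = u" "a x (j + 2) = ?y j" for x j by (simp_all add: a_def)
  have F: "?F (a x) w = act_at f i (map w [0..<arity \<tau> f]) x" for x w
    using act_at_eq[where y = "\<lambda>j a c. c j" and b = "\<lambda>a c. a 0" and z = "\<lambda>a c. a 1" and
        a = "a x" and c = w, OF refl a(2)] by (simp only: a(1))
  have H: "?H (a x) w = act_at f i (map ?y [0..<arity \<tau> f]) x" for x w
    using act_at_eq[where y = "\<lambda>j a c. a (j + 2)" and b = "\<lambda>a c. a 0" and z = "\<lambda>a c. a 1" and
        a = "a x" and c = w, OF a(3) a(2)] by (simp only: a(1))
  have "?F (a b) ?z = ?H (a b) ?z"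
  proof (rule term_funs_agree[where F = ?F and H = ?H and a = "a u" and c = ?y])
    show "term_fun \<tau> A ?F" "term_fun \<tau> A ?H"
      by (rule term_fun_act term_fun_left term_fun_right)+
    show "(a u k, a b k) \<in> \<alpha>" for k using b r rel_refl u_closed by (auto simp: a_def)
    show "(?y k, ?z k) \<in> \<alpha>" for k by (rule r)
  qed (unfold F H, unfold yz[symmetric], simp_all add: act_at_u ys zs)
  then show ?thesis unfolding F H unfolding yz[symmetric] by simp
qed

end

section \<open>The quotient algebra and its section\<close>

lemma Q_carrier: "carrier Q = carrier A // \<alpha>"
  by (simp add: quotient_alg_def)

lemma \<pi>_closed: "x \<in> carrier A \<Longrightarrow> \<pi> x \<in> carrier Q"
  by (simp add: Q_carrier quotientI)

lemma \<pi>_eq_iff: "x \<in> carrier A \<Longrightarrow> y \<in> carrier A \<Longrightarrow> \<pi> x = \<pi> y \<longleftrightarrow> (x, y) \<in> \<alpha>"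
  by (rule eq_equiv_class_iff[OF equiv])

lemma l_closed: "X \<in> carrier Q \<Longrightarrow> l X \<in> carrier A"
  using sec by (simp add: is_section_def)

lemma \<pi>_l: "X \<in> carrier Q \<Longrightarrow> \<pi> (l X) = X"
  using sec by (simp add: is_section_def)

lemma l_u: "l I = u"
  using sec by (simp add: is_section_def)

lemma listset_map: "ys \<in> listset (map F xs) \<longleftrightarrow> list_all2 (\<lambda>y x. y \<in> F x) ys xs"
  by (induction xs arbitrary: ys) (auto simp: set_Cons_def list_all2_Cons2)

text \<open>The quotient operation is a union over all choices of representatives. Each choice
  yields the same class because \<alpha> is a congruence, and \<open>xs\<close> itself is one
  choice, so the union is that class.\<close>

lemma Q_interp:
  assumes f: "f \<in> symbols \<tau>" and xs: "xs \<in> tuples (carrier A) (arity \<tau> f)"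
  shows "interp Q f (map (\<lambda>x. \<pi> x) xs) = \<pi> (interp A f xs)"
proof -
  have "\<pi> (interp A f ys) = \<pi> (interp A f xs)" if "ys \<in> listset (map (\<lambda>x. \<pi> x) xs)" for ys
  proof -
    have "length ys = length xs" "\<And>j. j < length xs \<Longrightarrow> (xs ! j, ys ! j) \<in> \<alpha>"
      using that unfolding listset_map by (auto simp: list_all2_conv_all_nth)
    then have "(interp A f xs, interp A f ys) \<in> \<alpha>"
      using xs by (intro interp_rel[OF f]) (auto simp: tuples_def)
    then show ?thesis using equiv_class_eq[OF equiv] by blast
  qed
  moreover have "xs \<in> listset (map (\<lambda>x. \<pi> x) xs)"
    unfolding listset_map using xs rel_refl by (auto simp: list_all2_same tuples_def)
  ultimately have "(\<Union>ys\<in>listset (map (\<lambda>x. \<pi> x) xs). \<pi> (interp A f ys)) = \<pi> (interp A f xs)"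
    by (intro UN_constant_eq ballI)
  then show ?thesis by (simp add: quotient_alg_def)
qed

lemma map_l: "xs \<in> tuples (carrier Q) n \<Longrightarrow> map l xs \<in> tuples (carrier A) n"
  by (rule map_tuples) (auto intro: l_closed)

lemma map_\<pi>_l: "xs \<in> tuples (carrier Q) n \<Longrightarrow> map (\<lambda>x. \<pi> x) (map l xs) = xs"
  by (auto simp: tuples_def \<pi>_l subset_iff intro!: map_idI)

lemma Q_interp_l:
  "f \<in> symbols \<tau> \<Longrightarrow> xs \<in> tuples (carrier Q) (arity \<tau> f) \<Longrightarrow>
    interp Q f xs = \<pi> (interp A f (map l xs))"
  using Q_interp[OF _ map_l] map_\<pi>_l by metis

lemma Q_alg: "is_alg \<tau> Q"
  unfolding is_alg_def
  using \<pi>_closed[OF u_closed] by (auto simp: Q_interp_l intro!: \<pi>_closed is_alg_interp[OF A_alg] map_l)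

sublocale algebra_action G \<tau> Q "action A m u l"
proof (intro algebra_action.intro G_comm_group algebra_action_axioms.intro Q_alg)
  fix f i xs as
  assume f: "f \<in> symbols \<tau>" and i: "i < arity \<tau> f" and xs: "xs \<in> tuples (carrier Q) (arity \<tau> f)"
    and as: "as \<in> tuples (carrier G) (arity \<tau> f)"
  have ai: "as ! i \<in> I" using tuples_nth[OF as i] by simp
  have len: "i < length xs" using i xs by (simp add: tuples_def)
  show "action A m u l f i xs as \<in> carrier G"
    using act_at_closed[OF f i map_l[OF xs] ai] by (simp add: action_eq_act_at len)
  fix bs assume bs: "bs \<in> tuples (carrier G) (arity \<tau> f)"
  have bi: "bs ! i \<in> I" using tuples_nth[OF bs i] by simp
  have "map2 (\<otimes>\<^bsub>G\<^esub>) as bs ! i = M (as ! i) u (bs ! i)" using as bs i by (simp add: tuples_def)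
  then show "action A m u l f i xs (map2 (\<otimes>\<^bsub>G\<^esub>) as bs) =
      action A m u l f i xs as \<otimes>\<^bsub>G\<^esub> action A m u l f i xs bs"
    using act_at_add[OF f i map_l[OF xs] ai bi] by (simp add: action_eq_act_at len)
qed

end

section \<open>Automorphisms and the exact sequence\<close>

lemma DirProd_subgroupI:
  assumes "group G" "group H" "K \<subseteq> carrier G \<times> carrier H" "K \<noteq> {}"
    and "\<And>x y. (x, y) \<in> K \<Longrightarrow> (inv\<^bsub>G\<^esub> x, inv\<^bsub>H\<^esub> y) \<in> K"
    and "\<And>x y x' y'. (x, y) \<in> K \<Longrightarrow> (x', y') \<in> K \<Longrightarrow> (x \<otimes>\<^bsub>G\<^esub> x', y \<otimes>\<^bsub>H\<^esub> y') \<in> K"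
  shows "subgroup K (G \<times>\<times> H)"
proof (rule group.subgroupI[OF DirProd_group[OF assms(1,2)]])
  fix p assume "p \<in> K"
  then show "inv\<^bsub>G \<times>\<times> H\<^esub> p \<in> K"
    using assms(3,5) inv_DirProd[OF assms(1,2)] by (cases p) auto
qed (use assms in auto)

locale abelian_representation = abelian_difference_algebra \<tau> V m A \<alpha> u l
  for \<tau> :: "'f signature" and V m and A :: "('f, 'a) alg" and \<alpha> u l +
  assumes char: "characteristic_elt \<tau> A u"
    and iso: "alg_iso \<tau> A (semidirect \<tau> (class_group A m \<alpha> u) (quotient_alg A \<alpha>) (action A m u l)
      (section_cocycle \<tau> A m \<alpha> u l)) (representation_map A m \<alpha> u l)"
begin

abbreviation "T \<equiv> section_cocycle \<tau> A m \<alpha> u l"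
abbreviation "\<iota> \<equiv> representation_map A m \<alpha> u l"
abbreviation "act \<equiv> action A m u l"
abbreviation "IA \<equiv> class_alg A \<alpha> u"
abbreviation "D \<equiv> Der \<tau> G Q act"
abbreviation "S \<equiv> stabilizer_aut_group \<tau> A I"
abbreviation "C \<equiv> compatible_pairs \<tau> IA Q act"
abbreviation "\<delta> \<equiv> der_to_aut A G \<iota>"
abbreviation "\<psi> \<equiv> restriction_pair A \<alpha> u l"

section \<open>The section cocycle and the coordinates on A\<close>

lemma T_apply: "f \<in> symbols \<tau> \<Longrightarrow> xs \<in> tup f \<Longrightarrow>
    T f xs = M (interp A f (map l xs)) (l (interp Q f xs)) u"
  by (simp add: section_cocycle_def)

lemma T_cocycle: "T \<in> Z"
  unfolding section_cocycle_def
proof (rule cocycleI)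
  fix f xs assume f: "f \<in> symbols \<tau>" and xs: "xs \<in> tup f"
  have "interp A f (map l xs) \<in> carrier A" "l (interp Q f xs) \<in> carrier A"
    using is_alg_interp[OF A_alg f map_l[OF xs]] l_closed[OF is_alg_interp[OF Q_alg f xs]] by auto
  moreover from this have "(interp A f (map l xs), l (interp Q f xs)) \<in> \<alpha>"
    using \<pi>_l[OF is_alg_interp[OF Q_alg f xs]] Q_interp_l[OF f xs] by (simp add: \<pi>_eq_iff[symmetric])
  ultimately show "M (interp A f (map l xs)) (l (interp Q f xs)) u \<in> carrier G"
    using rel_iff_M by simp
qed

text \<open>The extension by T is a copy of A. This is also the cocycle that makes \<open>H2\<close>
  nonempty.\<close>

lemma T_compatible: "T \<in> compatible_cocycles \<tau> V G Q act"
  using alg_iso_in_variety[OF V AV sd_alg[OF T_cocycle] iso] T_cocycle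
  by (simp add: compatible_cocycles_def)

lemma \<iota>_eq: "\<iota> a = (M a (l (\<pi> a)) u, \<pi> a)"
  by (simp add: representation_map_def)

lemma \<iota>_closed: "a \<in> carrier A \<Longrightarrow> \<iota> a \<in> I \<times> carrier Q"
  using iso by (auto simp: alg_iso_def bij_betw_def sd_carrier)

lemma \<iota>_inj: "a \<in> carrier A \<Longrightarrow> b \<in> carrier A \<Longrightarrow> \<iota> a = \<iota> b \<Longrightarrow> a = b"
  using iso by (auto simp: alg_iso_def bij_betw_def dest: inj_onD)

lemma \<iota>_surj: "b \<in> I \<Longrightarrow> x \<in> carrier Q \<Longrightarrow> \<exists>a\<in>carrier A. \<iota> a = (b, x)"
proof -
  assume "b \<in> I" "x \<in> carrier Q"
  then have "(b, x) \<in> \<iota> ` carrier A"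
    using iso by (simp add: alg_iso_def bij_betw_def sd_carrier)
  then show ?thesis by (metis imageE)
qed

text \<open>The normalization l(I) = u makes the first coordinate of b equal to m(b,u,u), which is
  b.\<close>

lemma \<iota>_I: "b \<in> I \<Longrightarrow> \<iota> b = (b, I)"
proof -
  assume b: "b \<in> I"
  then have "\<pi> b = I" using \<pi>_eq_iff[OF u_closed I_closed[OF b]] by simp
  then show ?thesis using b by (simp add: \<iota>_eq l_u M_right[OF rel_sym])
qed

text \<open>Weak associativity undoes the formation of the first coordinate.\<close>

lemma \<iota>_decomp: "a \<in> carrier A \<Longrightarrow> a = M (fst (\<iota> a)) u (l (snd (\<iota> a)))"
  using l_closed[OF \<pi>_closed] u_closed by (simp add: \<iota>_eq M_weak_assoc)

lemma I_Q: "I \<in> carrier Q"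
  by (rule \<pi>_closed[OF u_closed])

lemma Aut_u: "\<phi> \<in> Aut \<tau> A \<Longrightarrow> \<phi> u = u"
  using char by (simp add: characteristic_elt_def)

lemma Aut_M:
  assumes \<phi>: "\<phi> \<in> Aut \<tau> A" and "x \<in> carrier A" "y \<in> carrier A" "z \<in> carrier A"
  shows "\<phi> (M x y z) = M (\<phi> x) (\<phi> y) (\<phi> z)"
  by (rule tern_transport(2)[where S = "carrier A" and \<tau> = \<tau>])
    (use assms m is_alg_interp[OF A_alg] Aut_interp[OF \<phi>] in auto)

definition lift :: "('a \<times> 'a set \<Rightarrow> 'a \<times> 'a set) \<Rightarrow> 'a \<Rightarrow> 'a" where
  "lift \<Phi> = (\<lambda>a\<in>carrier A. inv_into (carrier A) \<iota> (\<Phi> (\<iota> a)))"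

context
  fixes \<Phi>
  assumes \<Phi>: "alg_iso \<tau> (sd T) (sd T) \<Phi>"
begin

lemma lift_Aut: "lift \<Phi> \<in> Aut \<tau> A"
proof -
  have "alg_iso \<tau> A A (inv_into (carrier A) \<iota> \<circ> (\<Phi> \<circ> \<iota>))"
    by (rule alg_iso_comp[OF A_alg alg_iso_comp[OF A_alg iso \<Phi>] alg_iso_inv[OF A_alg iso]])
  from restrict_in_Aut[OF A_alg this] show ?thesis by (simp add: lift_def comp_def)
qed

lemma \<iota>_lift:
  assumes a: "a \<in> carrier A" shows "\<iota> (lift \<Phi> a) = \<Phi> (\<iota> a)"
proof -
  have "bij_betw \<Phi> (carrier (sd T)) (carrier (sd T))" using \<Phi> by (simp add: alg_iso_def)
  moreover have "\<iota> a \<in> carrier (sd T)" unfolding sd_carrier G_simps by (rule \<iota>_closed[OF a])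
  ultimately have "\<Phi> (\<iota> a) \<in> carrier (sd T)" by (rule bij_betw_apply)
  then have "\<Phi> (\<iota> a) \<in> \<iota> ` carrier A" using iso by (simp add: alg_iso_def bij_betw_def)
  then show ?thesis using a by (simp add: lift_def f_inv_into_f)
qed

end

section \<open>The stabilizer and the group of compatible pairs\<close>

lemma S_carrier: "carrier S = {\<phi> \<in> Aut \<tau> A. \<phi> ` I = I}"
  by (simp add: stabilizer_aut_group_def)

lemma S_mult: "\<phi> \<in> carrier S \<Longrightarrow> \<chi> \<in> carrier S \<Longrightarrow> \<phi> \<otimes>\<^bsub>S\<^esub> \<chi> = (\<lambda>x\<in>carrier A. \<phi> (\<chi> x))"
  using mult_aut_group[of \<phi> \<tau> A \<chi>] by (simp add: stabilizer_aut_group_def)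

lemma S_one: "\<one>\<^bsub>S\<^esub> = (\<lambda>x\<in>carrier A. x)"
  by (simp add: stabilizer_aut_group_def)

lemma S_group: "group S"
proof -
  have sub: "I \<subseteq> carrier A" using I_closed by auto
  interpret aut: group "aut_group \<tau> A" by (rule group_aut_group[OF A_alg])
  have "subgroup {\<phi> \<in> Aut \<tau> A. \<phi> ` I = I} (aut_group \<tau> A)"
  proof (rule aut.subgroupI)
    have "(\<lambda>x\<in>carrier A. x) ` I = I" using sub by (auto simp: image_iff)
    then have "(\<lambda>x\<in>carrier A. x) \<in> {\<phi> \<in> Aut \<tau> A. \<phi> ` I = I}"
      using aut.one_closed unfolding one_aut_group carrier_aut_group by (intro CollectI conjI)
    then show "{\<phi> \<in> Aut \<tau> A. \<phi> ` I = I} \<noteq> {}" by blast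
  next
    fix \<phi> assume "\<phi> \<in> {\<phi> \<in> Aut \<tau> A. \<phi> ` I = I}"
    then have \<phi>: "\<phi> \<in> Aut \<tau> A" and I: "\<phi> ` I = I" by auto
    have "(inv\<^bsub>aut_group \<tau> A\<^esub> \<phi>) ` I = inv_into (carrier A) \<phi> ` I"
      unfolding inv_aut_group[OF A_alg \<phi>] using sub by (intro image_cong) auto
    also have "\<dots> = inv_into (carrier A) \<phi> ` \<phi> ` I" by (simp only: I)
    also have "\<dots> = I" using inv_into_image_cancel[OF Aut_inj[OF \<phi>] sub] .
    finally show "inv\<^bsub>aut_group \<tau> A\<^esub> \<phi> \<in> {\<phi> \<in> Aut \<tau> A. \<phi> ` I = I}"
      using aut.inv_closed[of \<phi>] \<phi> by simp
  next
    fix \<phi> \<chi> assume *: "\<phi> \<in> {\<phi> \<in> Aut \<tau> A. \<phi> ` I = I}" "\<chi> \<in> {\<phi> \<in> Aut \<tau> A. \<phi> ` I = I}"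
    then have "(\<phi> \<otimes>\<^bsub>aut_group \<tau> A\<^esub> \<chi>) ` I = (\<lambda>x. \<phi> (\<chi> x)) ` I"
      using sub by (intro image_cong) (auto simp: mult_aut_group)
    also have "\<dots> = I" using * by (simp add: image_image[symmetric])
    finally have "(\<phi> \<otimes>\<^bsub>aut_group \<tau> A\<^esub> \<chi>) ` I = I" .
    then show "\<phi> \<otimes>\<^bsub>aut_group \<tau> A\<^esub> \<chi> \<in> {\<phi> \<in> Aut \<tau> A. \<phi> ` I = I}"
      using * aut.m_closed[of \<phi> \<chi>] by simp
  qed auto
  then show ?thesis
    unfolding stabilizer_aut_group_def by (rule subgroup.subgroup_is_group) (rule aut.group_axioms)
qed

lemma IA_simps [simp]: "carrier IA = I" "interp IA = interp A"
  by (auto simp: class_alg_def)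

text \<open>Idempotence of u is what closes its class under the operations: values on the class are
  related to the value at the constant tuple, which is u.\<close>

lemma IA_alg: "is_alg \<tau> IA"
  unfolding is_alg_def
proof (intro conjI ballI Pi_I)
  show "carrier IA \<noteq> {}" using u_I by auto
  fix f xs assume f: "f \<in> symbols \<tau>" and xs: "xs \<in> tuples (carrier IA) (arity \<tau> f)"
  have "(interp A f (replicate (arity \<tau> f) u), interp A f xs) \<in> \<alpha>"
    by (rule interp_rel[OF f]) (use tuples_nth[OF xs] length_tuples[OF xs] in auto)
  then show "interp IA f xs \<in> carrier IA" using idem f by (simp add: idempotent_elt_def)
qed

lemma C_carrier: "(\<sigma>, \<kappa>) \<in> carrier C \<longleftrightarrow> \<sigma> \<in> Aut \<tau> IA \<and> \<kappa> \<in> Aut \<tau> Q \<and>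
    (\<forall>f\<in>symbols \<tau>. \<forall>i<arity \<tau> f. \<forall>xs\<in>tup f. \<forall>as\<in>tuples I (arity \<tau> f).
      \<sigma> (act f i xs as) = act f i (map \<kappa> xs) (map \<sigma> as))"
  by (simp add: compatible_pairs_def)

lemma act_closed': "f \<in> symbols \<tau> \<Longrightarrow> i < arity \<tau> f \<Longrightarrow> xs \<in> tup f \<Longrightarrow>
    as \<in> tuples I (arity \<tau> f) \<Longrightarrow> act f i xs as \<in> I"
  using act_closed by simp

lemma C_mult: "(\<sigma>, \<kappa>) \<in> carrier C \<Longrightarrow> (\<sigma>', \<kappa>') \<in> carrier C \<Longrightarrow>
    (\<sigma>, \<kappa>) \<otimes>\<^bsub>C\<^esub> (\<sigma>', \<kappa>') = (\<lambda>a\<in>I. \<sigma> (\<sigma>' a), \<lambda>x\<in>carrier Q. \<kappa> (\<kappa>' x))"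
  unfolding C_carrier using mult_aut_group[of \<sigma> \<tau> IA \<sigma>'] mult_aut_group[of \<kappa> \<tau> Q \<kappa>']
  by (simp add: compatible_pairs_def)

lemma C_one: "\<one>\<^bsub>C\<^esub> = (\<lambda>a\<in>I. a, \<lambda>x\<in>carrier Q. x)"
  by (simp add: compatible_pairs_def)

lemma map_restrict: "xs \<in> tuples X n \<Longrightarrow> map (restrict g X) xs = map g xs"
  by (auto simp: tuples_def)

lemma C_group: "group C"
proof -
  let ?K = "{(\<sigma>, \<kappa>). \<sigma> \<in> Aut \<tau> IA \<and> \<kappa> \<in> Aut \<tau> Q \<and>
    (\<forall>f\<in>symbols \<tau>. \<forall>i<arity \<tau> f. \<forall>xs\<in>tup f. \<forall>as\<in>tuples (carrier IA) (arity \<tau> f).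
      \<sigma> (act f i xs as) = act f i (map \<kappa> xs) (map \<sigma> as))}"
  interpret autI: group "aut_group \<tau> IA" by (rule group_aut_group[OF IA_alg])
  interpret autQ: group "aut_group \<tau> Q" by (rule group_aut_group[OF Q_alg])
  have "subgroup ?K (aut_group \<tau> IA \<times>\<times> aut_group \<tau> Q)"
  proof (rule DirProd_subgroupI)
    show "group (aut_group \<tau> IA)" "group (aut_group \<tau> Q)" by unfold_locales
    have "(\<one>\<^bsub>aut_group \<tau> IA\<^esub>, \<one>\<^bsub>aut_group \<tau> Q\<^esub>) \<in> ?K"
      using autI.one_closed autQ.one_closed act_closed' by (simp add: map_restrict)
    then show "?K \<noteq> {}" by blast
  next
    fix \<sigma> \<kappa> assume "(\<sigma>, \<kappa>) \<in> ?K"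
    then have \<sigma>: "\<sigma> \<in> Aut \<tau> IA" and \<kappa>: "\<kappa> \<in> Aut \<tau> Q"
      and eq: "\<And>f i xs as. f \<in> symbols \<tau> \<Longrightarrow> i < arity \<tau> f \<Longrightarrow> xs \<in> tup f \<Longrightarrow>
        as \<in> tuples I (arity \<tau> f) \<Longrightarrow> \<sigma> (act f i xs as) = act f i (map \<kappa> xs) (map \<sigma> as)" by auto
    let ?s = "inv_into I \<sigma>" and ?k = "inv_into (carrier Q) \<kappa>"
    have "?s (act f i xs as) = act f i (map ?k xs) (map ?s as)"
      if f: "f \<in> symbols \<tau>" and i: "i < arity \<tau> f" and xs: "xs \<in> tup f"
        and as: "as \<in> tuples I (arity \<tau> f)" for f i xs as
    proof -
      have xs': "map ?k xs \<in> tup f" "map \<kappa> (map ?k xs) = xs"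
        using xs Aut_image[OF \<kappa>]
        by (auto simp: tuples_def subset_iff f_inv_into_f inv_into_into intro!: map_idI)
      have \<sigma>I: "\<sigma> ` I = I" using Aut_image[OF \<sigma>] by simp
      have "?s \<in> I \<rightarrow> I" by (rule Pi_I, rule inv_into_into) (simp only: \<sigma>I)
      then have as': "map ?s as \<in> tuples I (arity \<tau> f)" by (rule map_tuples[OF _ as])
      have "\<sigma> (?s a) = a" if "a \<in> set as" for a
        using as that \<sigma>I by (intro f_inv_into_f) (auto simp: tuples_def)
      then have \<sigma>as: "map \<sigma> (map ?s as) = as" by (auto intro!: map_idI)
      \<comment> \<open>Equivariance of the inverse pair is checked after applying \<sigma>, where
        it becomes equivariance of the pair itself; injectivity of \<sigma> then removes
        \<sigma>.\<close>
      have "\<sigma> (act f i (map ?k xs) (map ?s as)) = act f i xs as"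
        using eq[OF f i xs'(1) as'] by (simp only: xs'(2) \<sigma>as)
      then show ?thesis
        using inv_into_f_f[OF Aut_inj[OF \<sigma>]] act_closed'[OF f i xs'(1) as'] by (metis IA_simps(1))
    qed
    then show "(inv\<^bsub>aut_group \<tau> IA\<^esub> \<sigma>, inv\<^bsub>aut_group \<tau> Q\<^esub> \<kappa>) \<in> ?K"
      using \<sigma> \<kappa> autI.inv_closed[of \<sigma>] autQ.inv_closed[of \<kappa>]
      by (simp add: inv_aut_group[OF IA_alg] inv_aut_group[OF Q_alg] map_restrict act_closed'
          del: Image_singleton_iff)
  next
    fix \<sigma> \<kappa> \<sigma>' \<kappa>' assume *: "(\<sigma>, \<kappa>) \<in> ?K" "(\<sigma>', \<kappa>') \<in> ?K"
    have "\<sigma> (\<sigma>' (act f i xs as)) = act f i (map (\<lambda>x. \<kappa> (\<kappa>' x)) xs) (map (\<lambda>a. \<sigma> (\<sigma>' a)) as)"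
      if f: "f \<in> symbols \<tau>" and i: "i < arity \<tau> f" and xs: "xs \<in> tup f"
        and as: "as \<in> tuples I (arity \<tau> f)" for f i xs as
    proof -
      have "map \<kappa>' xs \<in> tup f" "map \<sigma>' as \<in> tuples I (arity \<tau> f)"
        using map_tuples[OF _ xs, of \<kappa>' "carrier Q"] map_tuples[OF _ as, of \<sigma>' I] *
          Aut_closed[of \<kappa>' \<tau> Q] Aut_closed[of \<sigma>' \<tau> IA] by auto
      then show ?thesis using * f i xs as by (simp add: comp_def)
    qed
    then show "(\<sigma> \<otimes>\<^bsub>aut_group \<tau> IA\<^esub> \<sigma>', \<kappa> \<otimes>\<^bsub>aut_group \<tau> Q\<^esub> \<kappa>') \<in> ?K"
      using * autI.m_closed[of \<sigma> \<sigma>'] autQ.m_closed[of \<kappa> \<kappa>']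
      by (simp add: mult_aut_group map_restrict act_closed' del: Image_singleton_iff)
  qed auto
  then show ?thesis
    unfolding compatible_pairs_def
    by (rule subgroup.subgroup_is_group) (rule DirProd_group[OF autI.group_axioms autQ.group_axioms])
qed

section \<open>Derivations as automorphisms, and the fixed point of a compatible pair\<close>

lemma shift_Der_iso:
  assumes d: "d \<in> carrier D"
  shows "alg_iso \<tau> (sd T) (sd T) (shift id id d)"
proof -
  have fn: "d \<in> carrier Q \<rightarrow> carrier G" and eq: "\<And>f xs. f \<in> symbols \<tau> \<Longrightarrow> xs \<in> tup f \<Longrightarrow>
      d (interp Q f xs) = asum f xs (map d xs)" using d unfolding Der_iff by (auto simp: PiE_def)
  have "alg_iso \<tau> Q Q id" by (simp add: alg_iso_def)
  then show ?thesis
    by (subst shift_alg_iso_iff[OF _ _ _ _ T_cocycle fn])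
      (auto simp: eq[symmetric] simp del: G_simps
        intro!: m_comm cocycle_closed[OF T_cocycle] fun_interp_closed fn)
qed

lemma \<delta>_eq: "\<delta> d = lift (shift id id d)"
  by (simp add: der_to_aut_def lift_def shift_def case_prod_unfold)

lemma \<delta>_Aut: "d \<in> carrier D \<Longrightarrow> \<delta> d \<in> Aut \<tau> A"
  unfolding \<delta>_eq by (rule lift_Aut[OF shift_Der_iso])

lemma \<iota>_\<delta>: "d \<in> carrier D \<Longrightarrow> a \<in> carrier A \<Longrightarrow> \<iota> (\<delta> d a) = (M (fst (\<iota> a)) u (d (snd (\<iota> a))), snd (\<iota> a))"
  unfolding \<delta>_eq by (subst \<iota>_lift[OF shift_Der_iso]) (auto simp: shift_def case_prod_unfold)

lemma D_closed: "d \<in> carrier D \<Longrightarrow> x \<in> carrier Q \<Longrightarrow> d x \<in> I"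
  unfolding Der_iff by auto

text \<open>The automorphism attached to \<open>d\<close> fixes \<open>u\<close>.\<close>

lemma D_u:
  assumes d: "d \<in> carrier D" shows "d I = u"
proof -
  have "M u u (d I) = u"
    using \<iota>_\<delta>[OF d u_closed] Aut_u[OF \<delta>_Aut[OF d]] \<iota>_I[OF u_I] by simp
  then show ?thesis using D_closed[OF d I_Q] I_closed u_closed by (simp add: M_left)
qed

lemma \<delta>_I:
  assumes d: "d \<in> carrier D" and b: "b \<in> I" shows "\<delta> d b = b"
proof (rule \<iota>_inj)
  show "\<iota> (\<delta> d b) = \<iota> b"
    using b by (simp add: \<iota>_\<delta>[OF d I_closed[OF b]] \<iota>_I D_u[OF d] M_right[OF rel_sym])
qed (use I_closed[OF b] Aut_closed[OF \<delta>_Aut[OF d]] in auto)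

lemma \<delta>_S: "d \<in> carrier D \<Longrightarrow> \<delta> d \<in> carrier S"
  unfolding S_carrier using \<delta>_Aut \<delta>_I by (auto simp: image_iff)

text \<open>The constant map with value \<open>\<sigma> u\<close> is a derivation, and derivations vanish at the class of \<open>u\<close>.
  That \<open>u\<close> is characteristic in \<open>A\<close> thus makes it fixed under automorphisms of \<open>I\<close> that belong
  to a compatible pair.\<close>

lemma C_u:
  assumes p: "(\<sigma>, \<kappa>) \<in> carrier C" shows "\<sigma> u = u"
proof -
  define c where "c = \<sigma> u"
  have \<sigma>: "\<sigma> \<in> Aut \<tau> IA" and \<kappa>: "\<kappa> \<in> Aut \<tau> Q" using p by (auto simp: C_carrier)
  have c: "c \<in> I" using Aut_closed[OF \<sigma>, of u] u_I by (simp add: c_def)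
  \<comment> \<open>Each action operation sends the constant tuple u to u; applying \<sigma> and
    equivariance turns u into c. The base points are pulled back along \<kappa> so that they arrive
    at \<open>ys\<close>.\<close>
  have actc: "act f i ys (replicate (arity \<tau> f) c) = c"
    if f: "f \<in> symbols \<tau>" and i: "i < arity \<tau> f" and ys: "ys \<in> tup f" for f i ys
  proof -
    let ?xs = "map (inv_into (carrier Q) \<kappa>) ys" and ?as = "replicate (arity \<tau> f) u"
    have xs: "?xs \<in> tup f" "map \<kappa> ?xs = ys"
      using ys Aut_image[OF \<kappa>]
      by (auto simp: tuples_def subset_iff f_inv_into_f inv_into_into intro!: map_idI)
    have as: "?as \<in> tuples I (arity \<tau> f)" using u_I by (auto simp: tuples_def)
    have "act f i ?xs ?as = u"
      using act_at_u[OF f i map_l[OF xs(1)]] i length_tuples[OF xs(1)]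
      by (simp add: action_eq_act_at del: map_map)
    moreover have "\<sigma> (act f i ?xs ?as) = act f i (map \<kappa> ?xs) (map \<sigma> ?as)"
      using p f i xs(1) as unfolding C_carrier by blast
    ultimately show ?thesis unfolding xs(2) by (simp add: c_def)
  qed
  have asumc: "asum f ys (replicate (arity \<tau> f) c) = c [^]\<^bsub>G\<^esub> arity \<tau> f"
    if f: "f \<in> symbols \<tau>" and ys: "ys \<in> tup f" for f ys
  proof -
    have "asum f ys (replicate (arity \<tau> f) c) = finprod G (\<lambda>_. c) {..<arity \<tau> f}"
      unfolding act_sum_def by (rule finprod_cong') (use c actc f ys in auto)
    also have "\<dots> = c [^]\<^bsub>G\<^esub> arity \<tau> f" using c finprod_const[of c "{..<arity \<tau> f}"] by simp
    finally show ?thesis .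
  qed
  \<comment> \<open>As the image of an idempotent under an automorphism of I, c is idempotent. In
    coordinates f(c,...,c) is the sum of arity-many copies of c plus the value of T at the zero
    tuple, and that value is u. This sum being c is the derivation law for the constant map
    c.\<close>
  have pow: "c [^]\<^bsub>G\<^esub> arity \<tau> f = c" if f: "f \<in> symbols \<tau>" for f
  proof -
    let ?n = "arity \<tau> f"
    have us: "replicate ?n u \<in> tuples I ?n" "replicate ?n u \<in> tuples (carrier A) ?n"
      and cs: "replicate ?n c \<in> tuples (carrier A) ?n" and ys: "replicate ?n I \<in> tup f"
      using u_I u_closed I_closed[OF c] I_Q by (auto simp: tuples_def)
    have fu: "interp A f (replicate ?n u) = u" using idem f by (simp add: idempotent_elt_def)
    have "interp A f (replicate ?n c) = c"
      using Aut_interp[OF \<sigma> f, of "replicate ?n u"] us(1) fu by (simp add: c_def)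
    then have "\<iota> c = interp (sd T) f (map \<iota> (replicate ?n c))"
      using iso f cs unfolding alg_iso_def by metis
    then have "c = asum f (replicate ?n I) (replicate ?n c) \<otimes>\<^bsub>G\<^esub> T f (replicate ?n I)"
      by (simp add: \<iota>_I[OF c] sd_interp)
    moreover have "T f (replicate ?n I) = u"
    proof -
      have "interp Q f (replicate ?n I) = I" using Q_interp[OF f us(2)] fu by simp
      then show ?thesis using T_apply[OF f ys] u_closed by (simp add: l_u fu M_left)
    qed
    moreover have "c [^]\<^bsub>G\<^esub> ?n \<in> carrier G" by (rule nat_pow_closed) (use c in simp)
    ultimately show ?thesis using asumc[OF f ys] r_one by (metis G_simps(3))
  qed
  have "restrict (\<lambda>_. c) (carrier Q) \<in> carrier D"
  proof (rule restrict_in_Der)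
    fix f ys assume f: "f \<in> symbols \<tau>" and ys: "ys \<in> tup f"
    have "map (\<lambda>_. c) ys = replicate (arity \<tau> f) c" using ys by (simp add: tuples_def map_replicate_const)
    then show "c = asum f ys (map (\<lambda>_. c) ys)" using asumc[OF f ys] pow[OF f] by simp
  qed (use c in auto)
  from D_u[OF this] show ?thesis using I_Q by (simp add: c_def)
qed

text \<open>\<sigma> preserves \<open>m\<close> as a term operation of I; since it also fixes u by
  \<open>C_u\<close>, it preserves +_u.\<close>

lemma C_facts:
  assumes p: "(\<sigma>, \<kappa>) \<in> carrier C"
  shows "bij_betw \<sigma> (carrier G) (carrier G)"
    "\<And>a b. a \<in> carrier G \<Longrightarrow> b \<in> carrier G \<Longrightarrow> \<sigma> (a \<otimes>\<^bsub>G\<^esub> b) = \<sigma> a \<otimes>\<^bsub>G\<^esub> \<sigma> b"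
    "alg_iso \<tau> Q Q \<kappa>"
    "\<And>f i xs as. f \<in> symbols \<tau> \<Longrightarrow> i < arity \<tau> f \<Longrightarrow> xs \<in> tup f \<Longrightarrow>
      as \<in> tuples (carrier G) (arity \<tau> f) \<Longrightarrow> \<sigma> (act f i xs as) = act f i (map \<kappa> xs) (map \<sigma> as)"
proof -
  have \<sigma>: "\<sigma> \<in> Aut \<tau> IA" and \<kappa>: "\<kappa> \<in> Aut \<tau> Q" using p by (auto simp: C_carrier)
  show "bij_betw \<sigma> (carrier G) (carrier G)" using \<sigma> by (simp add: Aut_def alg_iso_def)
  show "alg_iso \<tau> Q Q \<kappa>" by (rule Aut_alg_iso[OF \<kappa>])
  show "\<sigma> (a \<otimes>\<^bsub>G\<^esub> b) = \<sigma> a \<otimes>\<^bsub>G\<^esub> \<sigma> b" if "a \<in> carrier G" "b \<in> carrier G" for a b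
  proof -
    have "\<sigma> (M a u b) = M (\<sigma> a) (\<sigma> u) (\<sigma> b)"
      by (rule tern_transport(2)[where S = I and \<tau> = \<tau>])
        (use that u_I m is_alg_interp[OF IA_alg] Aut_interp[OF \<sigma>] in auto)
    then show ?thesis by (simp add: C_u[OF p])
  qed
  show "\<sigma> (act f i xs as) = act f i (map \<kappa> xs) (map \<sigma> as)" if "f \<in> symbols \<tau>" "i < arity \<tau> f"
    "xs \<in> tup f" "as \<in> tuples (carrier G) (arity \<tau> f)" for f i xs as
    using p that unfolding C_carrier by simp
qed

section \<open>Coordinates of an automorphism that preserves the zero class\<close>

definition quot_map :: "('a \<Rightarrow> 'a) \<Rightarrow> 'a set \<Rightarrow> 'a set" where
  "quot_map \<phi> = (\<lambda>x\<in>carrier Q. \<pi> (\<phi> (l x)))"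

text \<open>This measures how far \<phi> is from carrying the section to itself; it is the
  correction h belonging to \<phi>.\<close>

definition shift_part :: "('a \<Rightarrow> 'a) \<Rightarrow> 'a set \<Rightarrow> 'a" where
  "shift_part \<phi> x = M (\<phi> (l x)) (l (quot_map \<phi> x)) u"

context
  fixes \<phi>
  assumes \<phi>S: "\<phi> \<in> carrier S"
begin

lemma \<phi>: "\<phi> \<in> Aut \<tau> A" and \<phi>_I: "\<phi> ` I = I"
  using \<phi>S by (auto simp: S_carrier)

lemma \<psi>_eq: "\<psi> \<phi> = (restrict \<phi> I, quot_map \<phi>)"
  by (simp add: restriction_pair_def quot_map_def)

text \<open>\<phi> is assumed to preserve only one class, but fixing u it commutes with the
  difference m(x,y,u), and by \<open>rel_iff_M\<close> membership of these differences in that class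
  determines \<alpha>. This is why \<phi> descends to Q.\<close>

lemma \<phi>_rel_iff:
  assumes x: "x \<in> carrier A" and y: "y \<in> carrier A"
  shows "(\<phi> x, \<phi> y) \<in> \<alpha> \<longleftrightarrow> (x, y) \<in> \<alpha>"
proof -
  have cl: "M x y u \<in> carrier A" using M_closed x y u_closed by blast
  have "(\<phi> x, \<phi> y) \<in> \<alpha> \<longleftrightarrow> \<phi> (M x y u) \<in> I"
    using rel_iff_M[OF Aut_closed[OF \<phi> x] Aut_closed[OF \<phi> y]] Aut_M[OF \<phi> x y u_closed] Aut_u[OF \<phi>] by simp
  also have "\<dots> \<longleftrightarrow> M x y u \<in> I"
  proof -
    have "\<phi> (M x y u) \<in> \<phi> ` I \<longleftrightarrow> M x y u \<in> I"
      by (rule inj_on_image_mem_iff[OF Aut_inj[OF \<phi>] cl]) (use I_closed in blast)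
    then show ?thesis by (simp only: \<phi>_I)
  qed
  also have "\<dots> \<longleftrightarrow> (x, y) \<in> \<alpha>" by (rule rel_iff_M[OF x y, symmetric])
  finally show ?thesis .
qed

lemma quot_map_\<pi>:
  assumes a: "a \<in> carrier A" shows "quot_map \<phi> (\<pi> a) = \<pi> (\<phi> a)"
proof -
  note la = l_closed[OF \<pi>_closed[OF a]]
  have "(l (\<pi> a), a) \<in> \<alpha>" using \<pi>_l[OF \<pi>_closed[OF a]] \<pi>_eq_iff[OF la a] by simp
  then have "\<pi> (\<phi> (l (\<pi> a))) = \<pi> (\<phi> a)"
    using \<phi>_rel_iff[OF la a] \<pi>_eq_iff Aut_closed[OF \<phi>] la a by simp
  then show ?thesis using \<pi>_closed[OF a] by (simp add: quot_map_def)
qed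

lemma quot_map_l: "x \<in> carrier Q \<Longrightarrow> quot_map \<phi> x = \<pi> (\<phi> (l x))"
  by (simp add: quot_map_def)

lemma quot_map_Aut: "quot_map \<phi> \<in> Aut \<tau> Q"
proof -
  have cl: "quot_map \<phi> x \<in> carrier Q" if "x \<in> carrier Q" for x
    using that by (simp add: quot_map_l \<pi>_closed Aut_closed[OF \<phi>] l_closed)
  have "inj_on (quot_map \<phi>) (carrier Q)"
  proof (rule inj_onI)
    fix x y assume x: "x \<in> carrier Q" and y: "y \<in> carrier Q" and "quot_map \<phi> x = quot_map \<phi> y"
    then have "(\<phi> (l x), \<phi> (l y)) \<in> \<alpha>"
      by (simp add: quot_map_l \<pi>_eq_iff Aut_closed[OF \<phi>] l_closed)
    then have "\<pi> (l x) = \<pi> (l y)" using x y by (simp add: \<phi>_rel_iff \<pi>_eq_iff l_closed)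
    then show "x = y" using x y by (simp add: \<pi>_l)
  qed
  moreover have "x \<in> quot_map \<phi> ` carrier Q" if x: "x \<in> carrier Q" for x
  proof -
    obtain a where a: "a \<in> carrier A" "l x = \<phi> a"
      using Aut_image[OF \<phi>] l_closed[OF x] by (metis imageE)
    then have "quot_map \<phi> (\<pi> a) = x" using quot_map_\<pi>[OF a(1)] \<pi>_l[OF x] by simp
    then show ?thesis using \<pi>_closed[OF a(1)] by blast
  qed
  ultimately have bij: "bij_betw (quot_map \<phi>) (carrier Q) (carrier Q)"
    using cl by (auto simp: bij_betw_def)
  have "quot_map \<phi> (interp Q f xs) = interp Q f (map (quot_map \<phi>) xs)" if f: "f \<in> symbols \<tau>" and xs: "xs \<in> tup f" for f xs
  proof -
    have p: "map \<phi> (map l xs) \<in> tuples (carrier A) (arity \<tau> f)"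
      by (rule map_tuples[OF _ map_l[OF xs]]) (auto intro: Aut_closed[OF \<phi>])
    have m: "map (quot_map \<phi>) xs = map (\<lambda>x. \<pi> x) (map \<phi> (map l xs))"
      using xs by (auto simp: tuples_def quot_map_l)
    have "quot_map \<phi> (interp Q f xs) = \<pi> (interp A f (map \<phi> (map l xs)))"
      using Q_interp_l[OF f xs] quot_map_\<pi>[OF is_alg_interp[OF A_alg f map_l[OF xs]]]
        Aut_interp[OF \<phi> f map_l[OF xs]] by simp
    also have "\<dots> = interp Q f (map (quot_map \<phi>) xs)" unfolding m by (rule Q_interp[OF f p, symmetric])
    finally show ?thesis .
  qed
  then have "alg_iso \<tau> Q Q (quot_map \<phi>)" using bij by (simp add: alg_iso_def)
  then show ?thesis by (simp add: Aut_def quot_map_def)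
qed

lemma \<phi>_l_rel:
  assumes x: "x \<in> carrier Q" shows "(\<phi> (l x), l (quot_map \<phi> x)) \<in> \<alpha>"
proof -
  have "\<pi> (\<phi> (l x)) = \<pi> (l (quot_map \<phi> x))"
    using quot_map_l[OF x] \<pi>_l[OF Aut_closed[OF quot_map_Aut x]] by simp
  then show ?thesis
    using \<pi>_eq_iff[OF Aut_closed[OF \<phi> l_closed[OF x]] l_closed[OF Aut_closed[OF quot_map_Aut x]]] by simp
qed

lemma restrict_\<phi>_Aut: "restrict \<phi> I \<in> Aut \<tau> IA"
proof -
  have sub: "I \<subseteq> carrier A" using I_closed by auto
  have "alg_iso \<tau> IA IA \<phi>"
    unfolding alg_iso_def bij_betw_def
    using \<phi>_I inj_on_subset[OF Aut_inj[OF \<phi>] sub] Aut_interp[OF \<phi>] sub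
    by (simp add: tuples_def subset_iff)
  from restrict_in_Aut[OF IA_alg this] show ?thesis by simp
qed

text \<open>\<phi> carries the action at base points l(x) to the action at \<phi>(l(x)). These are
  \<alpha>-related to the section values over the image in Q, so \<open>act_at_rel\<close> allows
  the exchange.\<close>

lemma \<phi>_act:
  assumes f: "f \<in> symbols \<tau>" and i: "i < arity \<tau> f" and xs: "xs \<in> tup f"
    and as: "as \<in> tuples I (arity \<tau> f)"
  shows "\<phi> (act f i xs as) = act f i (map (quot_map \<phi>) xs) (map \<phi> as)"
proof -
  let ?ys = "map l xs"
  have ys: "?ys \<in> tuples (carrier A) (arity \<tau> f)" by (rule map_l[OF xs])
  have pys: "map \<phi> ?ys \<in> tuples (carrier A) (arity \<tau> f)"
    by (rule map_tuples[OF _ ys]) (auto intro: Aut_closed[OF \<phi>])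
  have kxs: "map (quot_map \<phi>) xs \<in> tup f"
    by (rule map_tuples[OF _ xs]) (auto intro: Aut_closed[OF quot_map_Aut])
  have ai: "as ! i \<in> I" by (rule tuples_nth[OF as i])
  then have pai: "\<phi> (as ! i) \<in> I" using \<phi>_I by blast
  have len: "length xs = arity \<tau> f" "length as = arity \<tau> f" using xs as by (auto simp: tuples_def)
  have yi: "?ys ! i \<in> carrier A" by (rule tuples_nth[OF ys i])
  have Mi: "M (as ! i) u (?ys ! i) \<in> carrier A" using M_closed I_closed[OF ai] u_closed yi by blast
  have up: "?ys[i := M (as ! i) u (?ys ! i)] \<in> tuples (carrier A) (arity \<tau> f)"
    using ys Mi set_update_subset_insert[of ?ys i] by (fastforce simp: tuples_def)
  have "\<phi> (act f i xs as) = \<phi> (act_at f i ?ys (as ! i))" using i len by (simp add: action_eq_act_at)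
  also have "\<dots> = act_at f i (map \<phi> ?ys) (\<phi> (as ! i))"
    unfolding act_at_def
    using Aut_M[OF \<phi>] is_alg_interp[OF A_alg f up] is_alg_interp[OF A_alg f ys] u_closed
      Aut_interp[OF \<phi> f up] Aut_interp[OF \<phi> f ys] Aut_u[OF \<phi>] I_closed[OF ai] yi i len
    by (simp add: map_update del: map_map)
  also have "\<dots> = act_at f i (map l (map (quot_map \<phi>) xs)) (\<phi> (as ! i))"
  proof (rule act_at_rel[OF f i pys map_l[OF kxs] _ pai])
    fix j assume j: "j < arity \<tau> f"
    have xj: "xs ! j \<in> carrier Q" by (rule tuples_nth[OF xs j])
    show "(map \<phi> ?ys ! j, map l (map (quot_map \<phi>) xs) ! j) \<in> \<alpha>"
      using j len \<phi>_l_rel[OF xj] by simp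
  qed
  also have "\<dots> = act f i (map (quot_map \<phi>) xs) (map \<phi> as)"
    using i len by (simp add: action_eq_act_at)
  finally show ?thesis .
qed

lemma \<psi>_C: "\<psi> \<phi> \<in> carrier C"
  unfolding \<psi>_eq C_carrier
proof (intro conjI ballI allI impI restrict_\<phi>_Aut quot_map_Aut)
  fix f i xs as
  assume f: "f \<in> symbols \<tau>" and i: "i < arity \<tau> f" and xs: "xs \<in> tup f" and as: "as \<in> tuples I (arity \<tau> f)"
  show "restrict \<phi> I (act f i xs as) = act f i (map (quot_map \<phi>) xs) (map (restrict \<phi> I) as)"
    unfolding map_restrict[OF as] restrict_apply'[OF act_closed'[OF f i xs as]]
    by (rule \<phi>_act[OF f i xs as])
qed

lemma shift_part_closed: "shift_part \<phi> \<in> carrier Q \<rightarrow> carrier G"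
proof
  fix x assume x: "x \<in> carrier Q"
  show "shift_part \<phi> x \<in> carrier G"
    using rel_iff_M \<phi>_l_rel[OF x] rel_closed[OF \<phi>_l_rel[OF x]] by (simp add: shift_part_def)
qed

text \<open>With coordinates (b, x), the element is m(b,u,l(x)), and \<phi> fixes u, so its image is
  \<phi>(l(x)) translated by \<phi>(b). \<open>M_shift\<close> extracts the translation from the
  difference to the new section value.\<close>

lemma \<iota>_\<phi>:
  assumes a: "a \<in> carrier A"
  shows "\<iota> (\<phi> a) = shift (restrict \<phi> I) (quot_map \<phi>) (shift_part \<phi>) (\<iota> a)"
proof -
  obtain b x where \<iota>a: "\<iota> a = (b, x)" by (cases "\<iota> a")
  then have b: "b \<in> I" and x: "x \<in> carrier Q" using \<iota>_closed[OF a] by auto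
  have kx: "quot_map \<phi> x = \<pi> (\<phi> a)" using quot_map_\<pi>[OF a] \<iota>a by (simp add: \<iota>_eq)
  have "\<phi> a = M (\<phi> b) u (\<phi> (l x))"
    using \<iota>_decomp[OF a] \<iota>a Aut_M[OF \<phi> I_closed[OF b] u_closed l_closed[OF x]] Aut_u[OF \<phi>] by simp
  moreover have "(\<phi> (l x), l (quot_map \<phi> x)) \<in> \<alpha>" by (rule \<phi>_l_rel[OF x])
  moreover have "\<phi> b \<in> I" using b \<phi>_I by blast
  ultimately have "M (\<phi> a) (l (quot_map \<phi> x)) u = M (\<phi> b) u (shift_part \<phi> x)"
    unfolding shift_part_def by (simp add: M_shift)
  then show ?thesis using b by (simp add: \<iota>_eq[of "\<phi> a"] \<iota>a kx shift_def)
qed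

lemma shift_part_iso: "alg_iso \<tau> (sd T) (sd T) (shift (restrict \<phi> I) (quot_map \<phi>) (shift_part \<phi>))"
proof (rule alg_iso_cong[OF sd_alg[OF T_cocycle]])
  note sdT = sd_alg[OF T_cocycle]
  show "alg_iso \<tau> (sd T) (sd T) (\<iota> \<circ> (\<phi> \<circ> inv_into (carrier A) \<iota>))"
    by (rule alg_iso_comp[OF sdT alg_iso_comp[OF sdT alg_iso_inv[OF A_alg iso] Aut_alg_iso[OF \<phi>]] iso])
  fix p assume "p \<in> carrier (sd T)"
  then obtain a where a: "a \<in> carrier A" "\<iota> a = p" using \<iota>_surj by (auto simp: sd_carrier)
  have "inv_into (carrier A) \<iota> p = a"
    using a iso by (auto simp: alg_iso_def bij_betw_def)
  then show "shift (restrict \<phi> I) (quot_map \<phi>) (shift_part \<phi>) p = (\<iota> \<circ> (\<phi> \<circ> inv_into (carrier A) \<iota>)) p"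
    using \<iota>_\<phi>[OF a(1)] a(2) by simp
qed

end

section \<open>Homomorphisms and exactness\<close>

lemma \<delta>_hom: "\<delta> \<in> hom D S"
proof (rule homI)
  fix d e assume d: "d \<in> carrier D" and e: "e \<in> carrier D"
  have mult: "d \<otimes>\<^bsub>D\<^esub> e = (\<lambda>x\<in>carrier Q. M (d x) u (e x))" by (simp add: Der_def)
  interpret D: comm_group D by (rule Der_comm_group)
  interpret S: group S by (rule S_group)
  have de: "d \<otimes>\<^bsub>D\<^esub> e \<in> carrier D" using d e by simp
  show "\<delta> (d \<otimes>\<^bsub>D\<^esub> e) = \<delta> d \<otimes>\<^bsub>S\<^esub> \<delta> e"
  proof (rule Aut_eqI[OF \<delta>_Aut[OF de]])
    show "\<delta> d \<otimes>\<^bsub>S\<^esub> \<delta> e \<in> Aut \<tau> A" using S.m_closed[OF \<delta>_S[OF d] \<delta>_S[OF e]] by (simp add: S_carrier)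
    fix a assume a: "a \<in> carrier A"
    obtain b x where \<iota>a: "\<iota> a = (b, x)" by (cases "\<iota> a")
    then have b: "b \<in> I" and x: "x \<in> carrier Q" using \<iota>_closed[OF a] by auto
    note cl = Aut_closed[OF \<delta>_Aut]
    show "\<delta> (d \<otimes>\<^bsub>D\<^esub> e) a = (\<delta> d \<otimes>\<^bsub>S\<^esub> \<delta> e) a"
    proof (rule \<iota>_inj)
      have "\<iota> (\<delta> d (\<delta> e a)) = (M (M b u (e x)) u (d x), x)"
        by (simp add: \<iota>_\<delta> d e a cl \<iota>a)
      \<comment> \<open>Composition applies e first; commutativity restores the order of the sum in
        \<open>Der\<close>.\<close>
      also have "M (M b u (e x)) u (d x) = M b u (M (d x) u (e x))"
        using M_assoc[OF b D_closed[OF e x] D_closed[OF d x]] M_comm[OF D_closed[OF d x] D_closed[OF e x]] by simp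
      finally show "\<iota> (\<delta> (d \<otimes>\<^bsub>D\<^esub> e) a) = \<iota> ((\<delta> d \<otimes>\<^bsub>S\<^esub> \<delta> e) a)"
        using \<iota>_\<delta>[OF de a] a x by (simp add: S_mult \<delta>_S d e \<iota>a mult)
    qed (use a d e de cl in \<open>auto simp: S_mult \<delta>_S\<close>)
  qed
qed (rule \<delta>_S)

lemma \<psi>_hom: "\<psi> \<in> hom S C"
proof (rule homI)
  fix \<phi> \<chi> assume \<phi>S: "\<phi> \<in> carrier S" and \<chi>S: "\<chi> \<in> carrier S"
  have \<chi>: "\<chi> \<in> Aut \<tau> A" and \<chi>I: "\<chi> ` I = I" using \<chi>S by (auto simp: S_carrier)
  have "restrict (\<phi> \<otimes>\<^bsub>S\<^esub> \<chi>) I = (\<lambda>a\<in>I. restrict \<phi> I (restrict \<chi> I a))"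
    unfolding S_mult[OF \<phi>S \<chi>S] using I_closed \<chi>I by (intro restrict_ext) auto
  moreover have "quot_map (\<phi> \<otimes>\<^bsub>S\<^esub> \<chi>) = (\<lambda>x\<in>carrier Q. quot_map \<phi> (quot_map \<chi> x))"
  proof -
    have "(\<phi> \<otimes>\<^bsub>S\<^esub> \<chi>) (l x) = \<phi> (\<chi> (l x))" if "x \<in> carrier Q" for x
      unfolding S_mult[OF \<phi>S \<chi>S] using l_closed[OF that] by simp
    then have "\<pi> ((\<phi> \<otimes>\<^bsub>S\<^esub> \<chi>) (l x)) = quot_map \<phi> (quot_map \<chi> x)" if "x \<in> carrier Q" for x
      using that quot_map_l[OF \<chi>S that] quot_map_\<pi>[OF \<phi>S Aut_closed[OF \<chi> l_closed[OF that]]] by simp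
    then show ?thesis unfolding quot_map_def[of "\<phi> \<otimes>\<^bsub>S\<^esub> \<chi>"] by (rule restrict_ext)
  qed
  ultimately show "\<psi> (\<phi> \<otimes>\<^bsub>S\<^esub> \<chi>) = \<psi> \<phi> \<otimes>\<^bsub>C\<^esub> \<psi> \<chi>"
    using C_mult[of "restrict \<phi> I" "quot_map \<phi>" "restrict \<chi> I" "quot_map \<chi>"] \<psi>_C[OF \<phi>S] \<psi>_C[OF \<chi>S]
    by (simp add: restriction_pair_def quot_map_def)
qed (rule \<psi>_C)

lemma kernel_\<delta>: "kernel D S \<delta> = {\<one>\<^bsub>D\<^esub>}"
proof -
  interpret D: comm_group D by (rule Der_comm_group)
  have hom: "group_hom D S \<delta>"
    by (intro group_hom.intro group_hom_axioms.intro D.group_axioms S_group \<delta>_hom)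
  have "d = \<one>\<^bsub>D\<^esub>" if d: "d \<in> carrier D" and one: "\<delta> d = \<one>\<^bsub>S\<^esub>" for d
  proof (rule extensionalityI[of _ "carrier Q"])
    show "d \<in> extensional (carrier Q)" using d unfolding Der_iff by (auto simp: PiE_def)
    show "\<one>\<^bsub>D\<^esub> \<in> extensional (carrier Q)" by (simp add: Der_def)
    fix x assume x: "x \<in> carrier Q"
    \<comment> \<open>The point over x with zero first coordinate is moved to first coordinate d x,
      so being fixed forces d x to be zero.\<close>
    obtain a where a: "a \<in> carrier A" "\<iota> a = (u, x)" using \<iota>_surj[OF u_I x] by blast
    have "M u u (d x) = u" using \<iota>_\<delta>[OF d a(1)] a one by (simp add: S_one)
    then show "d x = \<one>\<^bsub>D\<^esub> x"
      using x D_closed[OF d x] I_closed u_closed by (simp add: M_left Der_def)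
  qed
  then show ?thesis using D.one_closed group_hom.hom_one[OF hom] by (auto simp: kernel_def)
qed

lemma image_\<delta>: "\<delta> ` carrier D = kernel S C \<psi>"
proof (intro equalityI subsetI)
  fix \<phi> assume "\<phi> \<in> \<delta> ` carrier D"
  then obtain d where d: "d \<in> carrier D" and \<phi>: "\<phi> = \<delta> d" by blast
  have S: "\<delta> d \<in> carrier S" by (rule \<delta>_S[OF d])
  have "restrict (\<delta> d) I = (\<lambda>a\<in>I. a)" using \<delta>_I[OF d] by (intro restrict_ext) auto
  moreover have "quot_map (\<delta> d) = (\<lambda>x\<in>carrier Q. x)"
  proof (rule extensionalityI[of _ "carrier Q"])
    fix x assume x: "x \<in> carrier Q"
    have "\<pi> (\<delta> d (l x)) = \<pi> (l x)"
      using \<iota>_\<delta>[OF d l_closed[OF x]] by (simp add: \<iota>_eq)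
    then show "quot_map (\<delta> d) x = (\<lambda>x\<in>carrier Q. x) x" using x quot_map_l[OF S x] \<pi>_l[OF x] by simp
  qed (auto simp: quot_map_def)
  ultimately have "\<psi> (\<delta> d) = \<one>\<^bsub>C\<^esub>" by (simp add: \<psi>_eq[OF S] C_one)
  then show "\<phi> \<in> kernel S C \<psi>" using S by (simp add: kernel_def \<phi>)
next
  fix \<phi> assume "\<phi> \<in> kernel S C \<psi>"
  then have S: "\<phi> \<in> carrier S" and one: "\<psi> \<phi> = \<one>\<^bsub>C\<^esub>" by (auto simp: kernel_def)
  have \<phi>: "\<phi> \<in> Aut \<tau> A" using S by (simp add: S_carrier)
  let ?h = "shift_part \<phi>" and ?\<sigma> = "restrict \<phi> I" and ?\<kappa> = "quot_map \<phi>"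
  have \<sigma>: "?\<sigma> = (\<lambda>a\<in>I. a)" and \<kappa>: "?\<kappa> = (\<lambda>x\<in>carrier Q. x)"
    using one unfolding \<psi>_eq[OF S] C_one by auto
  note h = shift_part_closed[OF S]
  \<comment> \<open>Both components are restrictions of the identity, not \<open>id\<close> itself,
    so the lifting criterion is instantiated through membership in \<open>C\<close>.\<close>
  have C: "(?\<sigma>, ?\<kappa>) \<in> carrier C" using \<psi>_C[OF S] unfolding \<psi>_eq[OF S] by simp
  have der: "?h (interp Q f xs) = asum f xs (map ?h xs)" if f: "f \<in> symbols \<tau>" and xs: "xs \<in> tup f" for f xs
  proof -
    have Tf: "T f xs \<in> carrier G" by (rule cocycle_closed[OF T_cocycle f xs])
    have "?\<sigma> (T f xs) \<otimes>\<^bsub>G\<^esub> ?h (interp Q f xs) =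
        asum f (map ?\<kappa> xs) (map ?h xs) \<otimes>\<^bsub>G\<^esub> T f (map ?\<kappa> xs)"
      using iffD1[OF shift_alg_iso_iff[OF C_facts[OF C] T_cocycle h] shift_part_iso[OF S]] f xs by blast
    moreover have "map ?\<kappa> xs = xs" unfolding \<kappa> using xs by (simp add: map_restrict)
    moreover have "?\<sigma> (T f xs) = T f xs" unfolding \<sigma> using Tf by simp
    ultimately have "T f xs \<otimes>\<^bsub>G\<^esub> ?h (interp Q f xs) = T f xs \<otimes>\<^bsub>G\<^esub> asum f xs (map ?h xs)"
      using m_comm[OF asum_fun_closed[OF f xs h] Tf] by metis
    then show ?thesis
      using Units_l_cancel[OF Tf[folded Units_eq] fun_interp_closed[OF f xs h] asum_fun_closed[OF f xs h]] by blast
  qed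
  let ?d = "restrict ?h (carrier Q)"
  have d: "?d \<in> carrier D" by (rule restrict_in_Der[OF h der])
  have "\<delta> ?d = \<phi>"
  proof (rule Aut_eqI[OF \<delta>_Aut[OF d] \<phi>])
    fix a assume a: "a \<in> carrier A"
    obtain b x where \<iota>a: "\<iota> a = (b, x)" by (cases "\<iota> a")
    then have b: "b \<in> I" and x: "x \<in> carrier Q" using \<iota>_closed[OF a] by auto
    show "\<delta> ?d a = \<phi> a"
    proof (rule \<iota>_inj)
      show "\<iota> (\<delta> ?d a) = \<iota> (\<phi> a)"
        unfolding \<iota>_\<delta>[OF d a] \<iota>_\<phi>[OF S a] \<sigma> \<kappa> using b x by (simp add: \<iota>a shift_def)
    qed (use Aut_closed[OF \<delta>_Aut[OF d] a] Aut_closed[OF \<phi> a] in auto)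
  qed
  then show "\<phi> \<in> \<delta> ` carrier D" by (rule image_eqI[OF sym d])
qed

abbreviation "W \<equiv> wells_map \<tau> V G Q act T"

lemma W_eq_one_iff: "(\<sigma>, \<kappa>) \<in> carrier C \<Longrightarrow> W (\<sigma>, \<kappa>) = \<one>\<^bsub>H2 \<tau> V G Q act\<^esub> \<longleftrightarrow>
    (\<exists>h\<in>carrier Q \<rightarrow> carrier G. alg_iso \<tau> (sd T) (sd T) (shift \<sigma> \<kappa> h))"
  by (rule wells_map_eq_one_iff[OF C_facts V T_compatible])

text \<open>The two inclusions convert between corrections and automorphisms:
  \<open>shift_part\<close> reads a correction off a given \<phi>, and vanishing of \<open>W\<close>
  supplies one whose shift, transported to A, is a preimage of the pair.\<close>

lemma image_\<psi>: "\<psi> ` carrier S = {p \<in> carrier C. W p = \<one>\<^bsub>H2 \<tau> V G Q act\<^esub>}"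
proof (intro equalityI subsetI)
  fix p assume "p \<in> \<psi> ` carrier S"
  then obtain \<phi> where S: "\<phi> \<in> carrier S" and p: "p = \<psi> \<phi>" by blast
  have C: "(restrict \<phi> I, quot_map \<phi>) \<in> carrier C" using \<psi>_C[OF S] unfolding \<psi>_eq[OF S] by simp
  then have "W (restrict \<phi> I, quot_map \<phi>) = \<one>\<^bsub>H2 \<tau> V G Q act\<^esub>"
    using W_eq_one_iff[OF C] shift_part_closed[OF S] shift_part_iso[OF S] by blast
  then show "p \<in> {p \<in> carrier C. W p = \<one>\<^bsub>H2 \<tau> V G Q act\<^esub>}"
    using C unfolding p \<psi>_eq[OF S] by simp
next
  fix p assume "p \<in> {p \<in> carrier C. W p = \<one>\<^bsub>H2 \<tau> V G Q act\<^esub>}"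
  then obtain \<sigma> \<kappa> where p: "p = (\<sigma>, \<kappa>)" and C: "(\<sigma>, \<kappa>) \<in> carrier C"
    and W: "W (\<sigma>, \<kappa>) = \<one>\<^bsub>H2 \<tau> V G Q act\<^esub>" by (cases p) auto
  obtain h where h: "h \<in> carrier Q \<rightarrow> carrier G" and iso: "alg_iso \<tau> (sd T) (sd T) (shift \<sigma> \<kappa> h)"
    using W W_eq_one_iff[OF C] by blast
  have \<sigma>: "\<sigma> \<in> Aut \<tau> IA" and \<kappa>: "\<kappa> \<in> Aut \<tau> Q" using C by (auto simp: C_carrier)
  have \<sigma>cl: "\<sigma> b \<in> I" if "b \<in> I" for b using Aut_closed[OF \<sigma>] that by simp
  let ?\<phi> = "lift (shift \<sigma> \<kappa> h)"
  have \<phi>: "?\<phi> \<in> Aut \<tau> A" by (rule lift_Aut[OF iso])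
  have "shift \<sigma> \<kappa> h (u, I) = (u, I)"
    using \<iota>_lift[OF iso u_closed] Aut_u[OF \<phi>] \<iota>_I[OF u_I] by simp
  then have "M u u (h I) = u" and kI: "\<kappa> I = I" by (auto simp: shift_def C_u[OF C])
  then have hI: "h I = u" using funcset_mem[OF h I_Q] I_closed u_closed by (simp add: M_left)
  have \<phi>\<sigma>: "?\<phi> b = \<sigma> b" if b: "b \<in> I" for b
  proof (rule \<iota>_inj)
    show "\<iota> (?\<phi> b) = \<iota> (\<sigma> b)"
      unfolding \<iota>_lift[OF iso I_closed[OF b]]
      using b \<sigma>cl[OF b] by (simp add: \<iota>_I shift_def hI kI M_right[OF rel_sym])
  qed (use I_closed b \<sigma>cl Aut_closed[OF \<phi>] in auto)
  have "?\<phi> ` I = \<sigma> ` I" using \<phi>\<sigma> by (intro image_cong) auto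
  also have "\<dots> = I" using Aut_image[OF \<sigma>] by simp
  finally have S: "?\<phi> \<in> carrier S" using \<phi> by (simp add: S_carrier)
  have "restrict ?\<phi> I = \<sigma>"
    by (rule extensionalityI[of _ I]) (use \<sigma> \<phi>\<sigma> in \<open>auto simp: Aut_def\<close>)
  moreover have "quot_map ?\<phi> = \<kappa>"
  proof (rule Aut_eqI[OF quot_map_Aut[OF S] \<kappa>])
    fix x assume x: "x \<in> carrier Q"
    have "\<pi> (?\<phi> (l x)) = snd (\<iota> (?\<phi> (l x)))" by (simp add: \<iota>_eq)
    also have "\<dots> = \<kappa> x"
      unfolding \<iota>_lift[OF iso l_closed[OF x]] using x by (simp add: shift_def \<iota>_eq \<pi>_l)
    finally show "quot_map ?\<phi> x = \<kappa> x" by (simp add: quot_map_l[OF S x])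
  qed
  ultimately have "\<psi> ?\<phi> = p" unfolding p \<psi>_eq[OF S] by simp
  then show "p \<in> \<psi> ` carrier S" using S by blast
qed

lemma W_closed: "W \<in> carrier C \<rightarrow> carrier (H2 \<tau> V G Q act)"
proof
  fix p assume "p \<in> carrier C"
  then show "W p \<in> carrier (H2 \<tau> V G Q act)"
    by (cases p) (auto intro: wells_map_closed[OF C_facts V T_compatible])
qed

end

theorem corollary1p4:
  fixes \<tau> :: "'f signature"
    and V :: "(('f, nat) trm \<times> ('f, nat) trm) set"
    and m :: "('f, nat) trm"
    and A :: "('f, 'a) alg"
    and u :: 'a
    and \<alpha> :: "('a \<times> 'a) set"
    and l :: "'a set \<Rightarrow> 'a"
    and Q :: "('f, 'a set) alg"
    and I :: "('f, 'a) alg"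
    and G :: "'a monoid"
    and act :: "'f \<Rightarrow> nat \<Rightarrow> 'a set list \<Rightarrow> 'a list \<Rightarrow> 'a"
    and T :: "'f \<Rightarrow> 'a set list \<Rightarrow> 'a"
    and \<iota> :: "'a \<Rightarrow> 'a \<times> 'a set"
    and \<delta> :: "('a set \<Rightarrow> 'a) \<Rightarrow> 'a \<Rightarrow> 'a"
    and \<psi> :: "('a \<Rightarrow> 'a) \<Rightarrow> ('a \<Rightarrow> 'a) \<times> ('a set \<Rightarrow> 'a set)"
    and W :: "('a \<Rightarrow> 'a) \<times> ('a set \<Rightarrow> 'a set) \<Rightarrow> ('f \<Rightarrow> 'a set list \<Rightarrow> 'a) set"
  assumes "variety \<tau> V"
    and "difference_term \<tau> V m"
    and "weakly_associative \<tau> V m"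
    and "in_variety \<tau> V A"
    and "idempotent_elt \<tau> A u"
    and "characteristic_elt \<tau> A u"
    and "abelian_congruence \<tau> A \<alpha>"
    and "Q = quotient_alg A \<alpha>"
    and "I = class_alg A \<alpha> u"
    and "G = class_group A m \<alpha> u"
    and "is_section A \<alpha> u l"
    and "act = action A m u l"
    and "T = section_cocycle \<tau> A m \<alpha> u l"
    and "\<iota> = representation_map A m \<alpha> u l"
    and "alg_iso \<tau> A (semidirect \<tau> G Q act T) \<iota>"
    and "\<delta> = der_to_aut A G \<iota>"
    and "\<psi> = restriction_pair A \<alpha> u l"
    and "W = wells_map \<tau> V G Q act T"
  shows "comm_group (Der \<tau> G Q act) \<and> comm_group (H2 \<tau> V G Q act) \<and>
    group_hom (Der \<tau> G Q act) (stabilizer_aut_group \<tau> A (carrier I)) \<delta> \<and>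
    kernel (Der \<tau> G Q act) (stabilizer_aut_group \<tau> A (carrier I)) \<delta> =
      {\<one>\<^bsub>Der \<tau> G Q act\<^esub>} \<and>
    group_hom (stabilizer_aut_group \<tau> A (carrier I)) (compatible_pairs \<tau> I Q act) \<psi> \<and>
    \<delta> ` carrier (Der \<tau> G Q act) =
      kernel (stabilizer_aut_group \<tau> A (carrier I)) (compatible_pairs \<tau> I Q act) \<psi> \<and>
    W \<in> carrier (compatible_pairs \<tau> I Q act) \<rightarrow> carrier (H2 \<tau> V G Q act) \<and>
    \<psi> ` carrier (stabilizer_aut_group \<tau> A (carrier I)) =
      {p \<in> carrier (compatible_pairs \<tau> I Q act). W p = \<one>\<^bsub>H2 \<tau> V G Q act\<^esub>}"
proof -
  interpret abelian_representation \<tau> V m A \<alpha> u l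
    by unfold_locales (use assms in simp_all)
  have D: "group (Der \<tau> (class_group A m \<alpha> u) (quotient_alg A \<alpha>) (action A m u l))"
    using Der_comm_group by (rule comm_group.axioms(2))
  show ?thesis
    unfolding assms(8-10,12-14,16-18) IA_simps(1)
    by (intro conjI Der_comm_group H2_comm_group[OF V T_compatible] kernel_\<delta> image_\<delta> W_closed image_\<psi>
        group_hom.intro group_hom_axioms.intro D S_group C_group \<delta>_hom \<psi>_hom)
qed

end
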